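(* Let $(R,F)$ be a one-dimensional commutative formal group law over a commutative domain $R$ and let $(\Lambda,\Phi,\varrho)$ be a reduced root system with simple roots $\{\alpha_i\}_{i\in I}$. The formal affine Demazure algebra $\mathbf{D}_F$ is generated as an $R$-algebra by $R[[\Lambda]]_F$ and the formal Demazure elements $X_i$, $i\in I$, and satisfies the following relations: (1) $\varphi X_i = X_i s_i(\varphi)+\Delta_{i}(\varphi)$ for all $i\in I$ and $\varphi\in R[[\Lambda]]_F$; (2) $X_i^2=X_i\kappa_i$ for all $i\in I$, where $\kappa_i=\frac{1}{x_i}+\frac{1}{x_{-i}}\in R[[\Lambda]]_F$; (3) $X_iX_j=X_jX_i$ for all $i,j\in I$ such that $\langle\alpha_i^\vee,\alpha_j\rangle=0$; (4) for all distinct $i,j\in I$ such that $\langle\alpha_i^\vee,\alpha_j\rangle\neq 0$, the following braid relations: (4a) if $\langle \alpha_i^\vee, \alpha_j \rangle = \langle \alpha_j^\vee, \alpha_i \rangle=-1$ (so $m_{ij}=3$): $$X_jX_iX_j-X_iX_jX_i=X_i\kappa_{i,j}-X_j\kappa_{j,i};$$ (4b) if $\langle \alpha_i^\vee, \alpha_j \rangle=-1$ and $\langle \alpha_j^\vee, \alpha_i \rangle=-2$ (so $m_{ij}=4$): $$X_{jiji}-X_{ijij}=X_{ij}(\kappa_{i+2j,-j}+\kappa_{j,i})-X_{ji}(\kappa_{i+j,j}+\kappa_{i,j})+X_j\big(\Delta_i(\kappa_{i+j,j}+\kappa_{i,j})\big)-X_i\big(\Delta_j(\kappa_{i+2j,-j}+\kappa_{j,i})\big);$$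 (4c) if $\langle \alpha_i^\vee, \alpha_j \rangle=-1$ and $\langle \alpha_j^\vee, \alpha_i \rangle=-3$ (so $m_{ij}=6$), with $A:=\kappa_{j,i}+\kappa_{2i+3j,-i-2j}+\kappa_{-i-3j,i+2j}+\kappa_{i+2j,-j}$ and $B:=\kappa_{i,j}+\kappa_{-2i-3j,i+2j}+\kappa_{-i-2j,i+3j}+\kappa_{i+j,j}$: $$X_{jijiji}-X_{ijijij}=X_{ijij}A-X_{jiji}B+X_{jij}\,\Delta_i(B)-X_{iji}\,\Delta_j(A)+X_{ij}\xi_{ij}-X_{ji}\xi_{ji}+X_j\,\Delta_i(\xi_{ji})-X_i\,\Delta_j(\xi_{ij}).$$ Furthermore, if $m_{ij}\neq 6$ for all $i,j\in I$, then the relations (1), (2), (3) and (4) form a complete set of relations for $\mathbf{D}_F$. In all cases, the relations (1), (2), (3) and (4) form a complete set of relations (over $R[[\Lambda]]_F^\sim$) for $\mathbf{D}_F\otimes_{R[[\Lambda]]_F}R[[\Lambda]]_F^\sim$.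
   Context: A one-dimensional commutative formal group law (FGL) $(R,F)$ is a commutative ring $R$ and $F\in R[[u,v]]$ with $F(u,0)=F(0,u)=u$, $F(u,v)=F(v,u)$, $F(u,F(v,w))=F(F(u,v),w)$; one writes $u+_Fv=F(u,v)$. Throughout $R$ is a commutative domain. Formal group algebra: for an abelian group $\Lambda$, $R[[x_\Lambda]]$ is the completion of the polynomial ring $R[x_\lambda\mid\lambda\in\Lambda]$ at the kernel of the augmentation $x_\lambda\mapsto 0$; $R[[\Lambda]]_F$ is its quotient by the closure of the ideal generated by $x_0$ and $x_{\lambda_1+\lambda_2}-(x_{\lambda_1}+_Fx_{\lambda_2})$, $\lambda_1,\lambda_2\in\Lambda$. For $\Lambda\cong\mathbb{Z}^n$ it is isomorphic to $R[[x_1,\dots,x_n]]$, hence a domain. Root system: $(\Lambda,\Phi,\varrho)$ is a reduced root system (root datum in the sense of Demazure): a free $\mathbb{Z}$-module $\Lambda$ of finite rank, a finite set of roots $\Phi\subset\Lambda$, and a map $\varrho:\Phi\to\Lambda^\vee=\mathrm{Hom}_{\mathbb{Z}}(\Lambda,\mathbb{Z})$, $\alpha\mapsto\alpha^\vee$, satisfying the usual axioms. $W$ is the Weyl group generated by $s_\alpha(\lambda)=\lambda-\langle\alpha^\vee,\lambda\rangle\alpha$; $\{\alpha_i\}_{i\in I}$ are fixed simple roots, $s_i=s_{\alpha_i}$, and $m_{ij}$ is the order of $s_is_j$. $W$ acts on $R[[\Lambda]]_F$ by $w(x_\lambda)=x_{w(\lambda)}$. $Q^F$ is the subring of the fraction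 field of $R[[\Lambda]]_F$ generated by $R[[\Lambda]]_F$ and all $x_\lambda^{-1}$, $\lambda\in\Lambda\setminus\{0\}$. The twisted formal group algebra $Q_W^F$ is $R[W]\otimes_RQ^F$ with multiplication $(\delta_{w'}\psi')(\delta_w\psi)=\delta_{w'w}w^{-1}(\psi')\psi$, where $\delta_w\in R[W]$ corresponds to $w\in W$, and $\psi,\psi'\in Q^F$. The formal Demazure operator is $\Delta_\alpha(\psi)=\frac{\psi-s_\alpha(\psi)}{x_\alpha}$; it preserves $R[[\Lambda]]_F$ and also acts on $Q^F$; $\Delta_i=\Delta_{\alpha_i}$. The formal Demazure element (distinct from the operator) is $X_\alpha=\frac{1}{x_\alpha}(1-\delta_{s_\alpha})\in Q_W^F$; $X_i=X_{\alpha_i}$, $X_{i_1\cdots i_k}=X_{i_1}\cdots X_{i_k}$. The formal affine Demazure algebra $\mathbf{D}_F$ is the $R$-subalgebra of $Q_W^F$ generated by all $X_i$, $i\in I$, and $R[[\Lambda]]_F$. Write $x_{ni+mj}=x_{n\alpha_i+m\alpha_j}$ for integers $n,m$ (e.g. $x_{-i}=x_{-\alpha_i}$). For $\lambda,\nu\in\Lambda\setminus\{0\}$ with $\lambda+\nu\ne0$, $$\kappa_{\lambda,\nu}=\frac{1}{x_{\lambda+\nu}x_\nu}-\frac{1}{x_{\lambda+\nu}x_{-\lambda}}-\frac{1}{x_\lambda x_\nu}\in R[[\Lambda]]_F,$$ and $\kappa_{n_1i+m_1j,\,n_2i+m_2j}=\kappa_{n_1\alpha_i+m_1\alpha_j,\,n_2\alpha_i+m_2\alpha_j}$.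 For $\langle \alpha_i^\vee, \alpha_j \rangle=-1$, $\langle \alpha_j^\vee, \alpha_i \rangle=-3$: $$\xi_{ij}=\tfrac{1}{x_i x_{i+j} x_{i+2j} x_{2i+3j}}+\tfrac{1}{x_ix_jx_{i+2j}x_{-2i-3j}}+\tfrac{1}{x_ix_jx_{2i+3j}x_{-i-j}}-\tfrac{1}{x_ix_{i+j}x_{i+2j}x_{-i-3j}}-\tfrac{1}{x_ix_{i+j}x_{i+3j}x_{-j}}+\tfrac{1}{x_{i+j}x_{i+3j}x_{-j}x_{-2i-3j}}+\tfrac{1}{x_{i+3j}x_{2i+3j}x_{-j}x_{-i-2j}}+\tfrac{1}{x_{i+j}x_{i+2j}x_{-i-3j}x_{-2i-3j}}-\tfrac{1}{x_ix_jx_{i+2j}x_{i+3j}},$$ $$\xi_{ji}=\tfrac{1}{x_ix_jx_{2i+3j}x_{-i-2j}}+\tfrac{1}{x_ix_jx_{i+2j}x_{-i-3j}}+\tfrac{1}{x_jx_{i+2j}x_{i+3j}x_{2i+3j}}-\tfrac{1}{x_ix_jx_{i+j}x_{2i+3j}}+\tfrac{1}{x_{i+j}x_{i+2j}x_{-i}x_{-2i-3j}}+\tfrac{1}{x_{i+3j}x_{2i+3j}x_{-i-j}x_{-i-2j}}+\tfrac{1}{x_{i+j}x_{i+3j}x_{-i}x_{-i-2j}}-\tfrac{1}{x_j x_{i+3j}x_{2i+3j}x_{-i-j}}-\tfrac{1}{x_jx_{i+j}x_{i+3j}x_{-i}}.$$ $R[[\Lambda]]_F^\sim$ is the subalgebra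 $R[W]\cdot R[[\Lambda]]_F[\xi_{ij},\xi_{ji}\mid i,j\in I,\ m_{ij}=6]$ of $Q^F$, i.e. the subalgebra generated by all $W$-translates (for the natural action of $R[W]$ on $Q^F$) of elements of $R[[\Lambda]]_F[\xi_{ij},\xi_{ji}]$. It equals $R[[\Lambda]]_F$ if no $m_{ij}$ is $6$. "Complete set of relations over $R[[\Lambda]]_F^\sim$" means: the $R$-algebra generated by the algebra $R[[\Lambda]]_F^\sim$ and symbols $X_i'$, $i\in I$, subject to the listed relations (with $\varphi\in R[[\Lambda]]_F^\sim$ in (1)), maps isomorphically onto $\mathbf{D}_F\otimes_{R[[\Lambda]]_F}R[[\Lambda]]_F^\sim$ via the identity on $R[[\Lambda]]_F^\sim$ and $X_i'\mapsto X_i$. Here the tensor product extends the right coefficients of $\mathbf{D}_F$, with products computed as in $Q_W^F$.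
   Formalization: It is assumed that x_λ ≠ 0 in R[[Λ]]_F for every λ ≠ 0, which the definition of Q^F (inverting all such x_λ) requires; it fails e.g. for the additive law in characteristic p, where x_{pλ} = 0. *)

theory Defs
  imports
    "HOL-Library.Poly_Mapping"
    "HOL-Computational_Algebra.Formal_Power_Series"
    "HOL-Algebra.Algebra"
    "HOL-Algebra.Algebraic_Closure_Type"
begin

section \<open>Completed polynomial rings and formal group laws\<close>

text \<open>\<open>('v, 'r) mpoly\<close> is the polynomial ring over \<open>'r\<close> in the variables \<open>x\<^sub>v\<close>, \<open>v :: 'v\<close>
  (finitely supported functions on monomials, with the convolution product of the library).\<close>

type_synonym ('v, 'r) mpoly = "('v \<Rightarrow>\<^sub>0 nat) \<Rightarrow>\<^sub>0 'r"
type_synonym ('v, 'r) mpoly_hat = "nat \<Rightarrow> ('v, 'r) mpoly set"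

definition poly_const :: "'r::comm_ring_1 \<Rightarrow> ('v, 'r) mpoly" where
  "poly_const r = Poly_Mapping.single 0 r"

definition poly_var :: "'v \<Rightarrow> ('v, 'r::comm_ring_1) mpoly" where
  "poly_var v = Poly_Mapping.single (Poly_Mapping.single v 1) 1"

text \<open>The kernel of \<open>x\<^sub>v \<mapsto> 0\<close>.\<close>

definition augmentation_ideal :: "('v, 'r::comm_ring_1) mpoly set" where
  "augmentation_ideal = {p. Poly_Mapping.lookup p 0 = 0}"

primrec ideal_power :: "('a, 'm) ring_scheme \<Rightarrow> 'a set \<Rightarrow> nat \<Rightarrow> 'a set" where
  "ideal_power A J 0 = carrier A"
| "ideal_power A J (Suc n) = ideal_prod A (ideal_power A J n) J"

text \<open>The inverse limit of the rings \<open>A/J\<^sup>n\<close>.  Since \<open>J\<^sup>n\<^sup>+\<^sup>1 \<subseteq> J\<^sup>n\<close>, a coset \<open>c\<close> of \<open>J\<^sup>n\<^sup>+\<^sup>1\<close> is sent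
  by the transition map to the unique coset of \<open>J\<^sup>n\<close> containing \<open>c\<close>.\<close>

definition adic_completion :: "('a, 'm) ring_scheme \<Rightarrow> 'a set \<Rightarrow> (nat \<Rightarrow> 'a set) ring" where
  "adic_completion A J =
    \<lparr>carrier = {a. \<forall>n. a n \<in> carrier (A Quot ideal_power A J n) \<and> a (Suc n) \<subseteq> a n},
     monoid.mult = (\<lambda>a b n. a n \<otimes>\<^bsub>A Quot ideal_power A J n\<^esub> b n),
     one = (\<lambda>n. \<one>\<^bsub>A Quot ideal_power A J n\<^esub>),
     ring.zero = (\<lambda>n. \<zero>\<^bsub>A Quot ideal_power A J n\<^esub>),
     add = (\<lambda>a b n. a n \<oplus>\<^bsub>A Quot ideal_power A J n\<^esub> b n)\<rparr>"

text \<open>Closure for the inverse limit topology (each \<open>A/J\<^sup>n\<close> being discrete).\<close>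

definition adic_closure :: "('a, 'm) ring_scheme \<Rightarrow> 'a set \<Rightarrow> (nat \<Rightarrow> 'a set) set \<Rightarrow> (nat \<Rightarrow> 'a set) set" where
  "adic_closure A J B = {a \<in> carrier (adic_completion A J). \<forall>n. \<exists>b\<in>B. b n = a n}"

definition poly_quot :: "nat \<Rightarrow> ('v, 'r::comm_ring_1) mpoly set ring" where
  "poly_quot n = ring_of_type_algebra Quot ideal_power ring_of_type_algebra augmentation_ideal n"

definition poly_completion :: "('v, 'r::comm_ring_1) mpoly_hat ring" where
  "poly_completion = adic_completion ring_of_type_algebra augmentation_ideal"

definition hat :: "('v, 'r::comm_ring_1) mpoly \<Rightarrow> ('v, 'r) mpoly_hat" where
  "hat p n = ideal_power ring_of_type_algebra augmentation_ideal n +>\<^bsub>ring_of_type_algebra\<^esub> p"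

text \<open>A power series \<open>F \<in> R[[u,v]]\<close> is an element of \<open>'r fps fps\<close>, the coefficient of \<open>u\<^sup>i v\<^sup>j\<close> being
  \<open>fps_nth (fps_nth F i) j\<close>.  For \<open>a\<close>, \<open>b\<close> in the kernel of the augmentation of the completed
  polynomial ring, \<open>F(a,b)\<close> is the following element: modulo the \<open>n\<close>-th power of the augmentation
  ideal, all terms with \<open>i + j \<ge> n\<close> vanish.\<close>

definition formal_sum ::
    "'r::comm_ring_1 fps fps \<Rightarrow> ('v, 'r) mpoly_hat \<Rightarrow> ('v, 'r) mpoly_hat \<Rightarrow> ('v, 'r) mpoly_hat" where
  "formal_sum F a b = (\<lambda>n. finsum (poly_quot n)
     (\<lambda>(i, j). hat (poly_const (fps_nth (fps_nth F i) j)) n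
        \<otimes>\<^bsub>poly_quot n\<^esub> (a n [^]\<^bsub>poly_quot n\<^esub> i \<otimes>\<^bsub>poly_quot n\<^esub> b n [^]\<^bsub>poly_quot n\<^esub> j))
     {(i, j). i + j < n})"

datatype uvw = var_u | var_v | var_w

definition formal_group_law :: "'r::comm_ring_1 fps fps \<Rightarrow> bool" where
  "formal_group_law F \<longleftrightarrow>
    (let u = hat (poly_var var_u) :: (uvw, 'r) mpoly_hat;
         v = hat (poly_var var_v); w = hat (poly_var var_w);
         z = \<zero>\<^bsub>poly_completion\<^esub>
     in formal_sum F u z = u \<and> formal_sum F z u = u \<and>
        formal_sum F u v = formal_sum F v u \<and>
        formal_sum F u (formal_sum F v w) = formal_sum F (formal_sum F u v) w)"

section \<open>The formal group algebra\<close>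

type_synonym ('l, 'r) fga = "('l, 'r) mpoly_hat set"

definition fga_ideal :: "'r::comm_ring_1 fps fps \<Rightarrow> ('l::ab_group_add, 'r) mpoly_hat set" where
  "fga_ideal F = adic_closure ring_of_type_algebra augmentation_ideal
     (genideal poly_completion
       ({hat (poly_var 0)} \<union>
        {hat (poly_var (l + m)) \<ominus>\<^bsub>poly_completion\<^esub> formal_sum F (hat (poly_var l)) (hat (poly_var m)) | l m. True}))"

definition FGA :: "'r::comm_ring_1 fps fps \<Rightarrow> ('l::ab_group_add, 'r) fga ring" where
  "FGA F = poly_completion Quot fga_ideal F"

definition fga_var :: "'r::comm_ring_1 fps fps \<Rightarrow> 'l::ab_group_add \<Rightarrow> ('l, 'r) fga" where
  "fga_var F l = fga_ideal F +>\<^bsub>poly_completion\<^esub> hat (poly_var l)"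

definition fga_const :: "'r::comm_ring_1 fps fps \<Rightarrow> 'r \<Rightarrow> ('l::ab_group_add, 'r) fga" where
  "fga_const F r = fga_ideal F +>\<^bsub>poly_completion\<^esub> hat (poly_const r)"

text \<open>The action of an automorphism \<open>w\<close> of the lattice, \<open>x\<^sub>l \<mapsto> x\<^bsub>w l\<^esub>\<close>, on polynomials and then, coset
  by coset, on the completion and on its quotient.\<close>

definition poly_act :: "('l \<Rightarrow> 'l) \<Rightarrow> ('l, 'r::comm_ring_1) mpoly \<Rightarrow> ('l, 'r) mpoly" where
  "poly_act w p = (\<Sum>m\<in>Poly_Mapping.keys p.
     Poly_Mapping.single (\<Sum>l\<in>Poly_Mapping.keys m. Poly_Mapping.single (w l) (Poly_Mapping.lookup m l))
       (Poly_Mapping.lookup p m))"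

definition fga_act :: "('l \<Rightarrow> 'l) \<Rightarrow> ('l, 'r::comm_ring_1) fga \<Rightarrow> ('l, 'r) fga" where
  "fga_act w A = (\<lambda>a n. poly_act w ` a n) ` A"

text \<open>\<open>e\<close> exhibits the field \<open>'k\<close> as the fraction field of the domain \<open>A\<close>.\<close>

definition fraction_field :: "('a, 'm) ring_scheme \<Rightarrow> ('a \<Rightarrow> 'k::field) \<Rightarrow> bool" where
  "fraction_field A e \<longleftrightarrow> e \<in> ring_hom A ring_of_type_algebra \<and> inj_on e (carrier A) \<and>
     (\<forall>q. \<exists>a\<in>carrier A. \<exists>b\<in>carrier A. e b \<noteq> 0 \<and> q = e a / e b)"

section \<open>Root data\<close>

definition zsmul :: "int \<Rightarrow> 'l::ab_group_add \<Rightarrow> 'l" where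
  "zsmul n a = (if n \<ge> 0 then ((+) a ^^ nat n) 0 else - (((+) a ^^ nat (- n)) 0))"

definition z_basis :: "'l::ab_group_add set \<Rightarrow> bool" where
  "z_basis B \<longleftrightarrow> \<not> module.dependent zsmul B \<and> module.span zsmul B = UNIV"

definition reflection :: "('l \<Rightarrow> 'l \<Rightarrow> int) \<Rightarrow> 'l \<Rightarrow> 'l::ab_group_add \<Rightarrow> 'l" where
  "reflection cr a l = l - zsmul (cr a l) a"

text \<open>\<open>cr a\<close> is the coroot of \<open>a\<close>, so that \<open>cr a l\<close> is the pairing of \<open>a\<^sup>\<or>\<close> with \<open>l\<close>.  The
  penultimate condition is stability of the coroots under the dual reflections.\<close>

definition reduced_root_datum :: "'l::ab_group_add set \<Rightarrow> ('l \<Rightarrow> 'l \<Rightarrow> int) \<Rightarrow> bool" where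
  "reduced_root_datum Phi cr \<longleftrightarrow>
     finite Phi \<and> inj_on cr Phi \<and>
     (\<forall>a\<in>Phi. Modules.additive (cr a)) \<and>
     (\<forall>a\<in>Phi. cr a a = 2) \<and>
     (\<forall>a\<in>Phi. \<forall>b\<in>Phi. reflection cr a b \<in> Phi) \<and>
     (\<forall>a\<in>Phi. \<forall>b\<in>Phi. (\<lambda>l. cr b l - cr b a * cr a l) \<in> cr ` Phi) \<and>
     (\<forall>a\<in>Phi. a + a \<notin> Phi)"

definition simple_roots :: "'l::ab_group_add set \<Rightarrow> 'i set \<Rightarrow> ('i \<Rightarrow> 'l) \<Rightarrow> bool" where
  "simple_roots Phi I al \<longleftrightarrow>
     al ` I \<subseteq> Phi \<and> inj_on al I \<and> \<not> module.dependent zsmul (al ` I) \<and>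
     (\<forall>b\<in>Phi. \<exists>c :: 'i \<Rightarrow> nat.
        b = (\<Sum>i\<in>I. zsmul (int (c i)) (al i)) \<or> b = - (\<Sum>i\<in>I. zsmul (int (c i)) (al i)))"

section \<open>Free algebras\<close>

text \<open>The free monoid, written additively so that \<open>'g word \<Rightarrow>\<^sub>0 'r\<close> is the free associative
  \<open>'r\<close>-algebra on \<open>'g\<close>.\<close>

datatype 'g word = Word (letters: "'g list")

instantiation word :: (type) monoid_add
begin

definition zero_word :: "'a word" where "0 = Word []"

definition plus_word :: "'a word \<Rightarrow> 'a word \<Rightarrow> 'a word" where
  "v + w = Word (letters v @ letters w)"

instance
  by standard (auto simp: zero_word_def plus_word_def)

end

text \<open>The free \<open>'r\<close>-algebra on the set \<open>H\<close> of generators.\<close>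

definition free_algebra :: "'g set \<Rightarrow> ('g word \<Rightarrow>\<^sub>0 'r::comm_ring_1) ring" where
  "free_algebra H = ring_of_type_algebra
     \<lparr>carrier := {p. \<forall>w\<in>Poly_Mapping.keys p. set (letters w) \<subseteq> H}\<rparr>"

definition free_gen :: "'g \<Rightarrow> 'g word \<Rightarrow>\<^sub>0 'r::comm_ring_1" where
  "free_gen g = Poly_Mapping.single (Word [g]) 1"

text \<open>\<open>monomial G Y [i\<^sub>1, \<dots>, i\<^sub>k]\<close> is \<open>Y i\<^sub>1 \<cdots> Y i\<^sub>k\<close>.\<close>

definition monomial :: "('g, 'm) ring_scheme \<Rightarrow> ('i \<Rightarrow> 'g) \<Rightarrow> 'i list \<Rightarrow> 'g" where
  "monomial G Y ks = foldr (\<lambda>k y. Y k \<otimes>\<^bsub>G\<^esub> y) ks (\<one>\<^bsub>G\<^esub>)"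

section \<open>The formal affine Demazure algebra\<close>

text \<open>The locale only fixes the data and makes no assumptions.\<close>

locale demazure =
  fixes F :: "'r::idom fps fps"
    and \<iota> :: "('l::ab_group_add, 'r) fga \<Rightarrow> 'k::field"
    and Phi :: "'l set"
    and cr :: "'l \<Rightarrow> 'l \<Rightarrow> int"
    and I :: "'i set"
    and al :: "'i \<Rightarrow> 'l"
begin

subsection \<open>The Weyl group and the coefficient rings\<close>

text \<open>As reflections are involutions, the monoid generated by them is the Weyl group.\<close>

inductive_set W :: "('l \<Rightarrow> 'l) set" where
  id_W: "id \<in> W"
| refl_W: "a \<in> Phi \<Longrightarrow> w \<in> W \<Longrightarrow> reflection cr a \<circ> w \<in> W"

definition cox :: "'i \<Rightarrow> 'i \<Rightarrow> nat" where
  "cox i j = (LEAST n. n > 0 \<and> ((reflection cr (al i) \<circ> reflection cr (al j)) ^^ n) = id)"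

text \<open>The images of \<open>R[[\<Lambda>]]\<^sub>F\<close>, \<open>x\<^sub>l\<close> and of the constants in the fraction field \<open>'k\<close>.\<close>

definition S :: "'k set" where "S = \<iota> ` carrier (FGA F)"

definition x :: "'l \<Rightarrow> 'k" where "x l = \<iota> (fga_var F l)"

definition scalar :: "'r \<Rightarrow> 'k" where "scalar r = \<iota> (fga_const F r)"

text \<open>The extension to the fraction field of the action on \<open>R[[\<Lambda>]]\<^sub>F\<close>.\<close>

definition act :: "('l \<Rightarrow> 'l) \<Rightarrow> 'k \<Rightarrow> 'k" where
  "act w q = (THE p. \<exists>a\<in>carrier (FGA F). \<exists>b\<in>carrier (FGA F).
     \<iota> b \<noteq> 0 \<and> q = \<iota> a / \<iota> b \<and> p = \<iota> (fga_act w a) / \<iota> (fga_act w b))"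

definition Q :: "'k set" where
  "Q = generate_ring ring_of_type_algebra (S \<union> {inverse (x l) | l. l \<noteq> 0})"

definition Dop :: "'l \<Rightarrow> 'k \<Rightarrow> 'k" where
  "Dop a q = (q - act (reflection cr a) q) / x a"

definition Dlt :: "'i \<Rightarrow> 'k \<Rightarrow> 'k" where "Dlt i = Dop (al i)"

subsection \<open>The coefficients of the braid relations\<close>

definition kappa1 :: "'i \<Rightarrow> 'k" where
  "kappa1 i = 1 / x (al i) + 1 / x (- al i)"

definition kappa :: "'l \<Rightarrow> 'l \<Rightarrow> 'k" where
  "kappa l n = 1 / (x (l + n) * x n) - 1 / (x (l + n) * x (- l)) - 1 / (x l * x n)"

definition rt :: "'i \<Rightarrow> 'i \<Rightarrow> int \<Rightarrow> int \<Rightarrow> 'l" where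
  "rt i j n m = zsmul n (al i) + zsmul m (al j)"

text \<open>\<open>xi_ij i j\<close> and \<open>xi_ji i j\<close> are \<open>\<xi>\<^sub>i\<^sub>j\<close> and \<open>\<xi>\<^sub>j\<^sub>i\<close>, for \<open>i\<close>, \<open>j\<close> with pairings
  \<open>cr (al i) (al j) = -1\<close> and \<open>cr (al j) (al i) = -3\<close>; \<open>y n m\<close> is \<open>x\<^bsub>ni+mj\<^esub>\<close>.\<close>

definition xi_ij :: "'i \<Rightarrow> 'i \<Rightarrow> 'k" where
  "xi_ij i j = (let y = (\<lambda>n m. x (rt i j n m)) in
      1 / (y 1 0 * y 1 1 * y 1 2 * y 2 3)
    + 1 / (y 1 0 * y 0 1 * y 1 2 * y (-2) (-3))
    + 1 / (y 1 0 * y 0 1 * y 2 3 * y (-1) (-1))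
    - 1 / (y 1 0 * y 1 1 * y 1 2 * y (-1) (-3))
    - 1 / (y 1 0 * y 1 1 * y 1 3 * y 0 (-1))
    + 1 / (y 1 1 * y 1 3 * y 0 (-1) * y (-2) (-3))
    + 1 / (y 1 3 * y 2 3 * y 0 (-1) * y (-1) (-2))
    + 1 / (y 1 1 * y 1 2 * y (-1) (-3) * y (-2) (-3))
    - 1 / (y 1 0 * y 0 1 * y 1 2 * y 1 3))"

definition xi_ji :: "'i \<Rightarrow> 'i \<Rightarrow> 'k" where
  "xi_ji i j = (let y = (\<lambda>n m. x (rt i j n m)) in
      1 / (y 1 0 * y 0 1 * y 2 3 * y (-1) (-2))
    + 1 / (y 1 0 * y 0 1 * y 1 2 * y (-1) (-3))
    + 1 / (y 0 1 * y 1 2 * y 1 3 * y 2 3)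
    - 1 / (y 1 0 * y 0 1 * y 1 1 * y 2 3)
    + 1 / (y 1 1 * y 1 2 * y (-1) 0 * y (-2) (-3))
    + 1 / (y 1 3 * y 2 3 * y (-1) (-1) * y (-1) (-2))
    + 1 / (y 1 1 * y 1 3 * y (-1) 0 * y (-1) (-2))
    - 1 / (y 0 1 * y 1 3 * y 2 3 * y (-1) (-1))
    - 1 / (y 0 1 * y 1 1 * y 1 3 * y (-1) 0))"

text \<open>Of the two orderings of a pair with \<open>m\<^sub>i\<^sub>j = 6\<close>, exactly one satisfies the condition on the
  pairings under which the two elements are defined.\<close>

definition xi_set :: "'k set" where
  "xi_set = (\<Union>(i, j)\<in>{(i, j). i \<in> I \<and> j \<in> I \<and> cox i j = 6 \<and>
       cr (al i) (al j) = -1 \<and> cr (al j) (al i) = -3}. {xi_ij i j, xi_ji i j})"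

definition S_tilde :: "'k set" where
  "S_tilde = generate_ring ring_of_type_algebra
     (\<Union>w\<in>W. act w ` generate_ring ring_of_type_algebra (S \<union> xi_set))"

subsection \<open>The twisted formal group algebra\<close>

text \<open>\<open>f\<close> stands for \<open>\<Sum>\<^bsub>w\<in>W\<^esub> \<delta>\<^sub>w f(w)\<close>; these are the elements of \<open>R[W] \<otimes>\<^sub>R Q\<close>, the \<open>\<delta>\<^sub>w\<close> being an
  \<open>R\<close>-basis of \<open>R[W]\<close>.\<close>

definition QW :: "(('l \<Rightarrow> 'l) \<Rightarrow> 'k) ring" where
  "QW = \<lparr>carrier = {f. (\<forall>w\<in>W. f w \<in> Q) \<and> (\<forall>w. w \<notin> W \<longrightarrow> f w = 0)},
     monoid.mult = (\<lambda>f g u. \<Sum>(v, w)\<in>{(v, w). v \<in> W \<and> w \<in> W \<and> v \<circ> w = u}. act (inv_into UNIV w) (f v) * g w),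
     one = (\<lambda>u. if u = id then 1 else 0),
     ring.zero = (\<lambda>u. 0),
     add = (\<lambda>f g u. f u + g u)\<rparr>"

definition delta :: "('l \<Rightarrow> 'l) \<Rightarrow> (('l \<Rightarrow> 'l) \<Rightarrow> 'k)" where
  "delta w = (\<lambda>u. if u = w then 1 else 0)"

definition coef :: "'k \<Rightarrow> (('l \<Rightarrow> 'l) \<Rightarrow> 'k)" where
  "coef q = (\<lambda>u. if u = id then q else 0)"

definition Xroot :: "'l \<Rightarrow> (('l \<Rightarrow> 'l) \<Rightarrow> 'k)" where
  "Xroot a = coef (1 / x a) \<otimes>\<^bsub>QW\<^esub> (\<one>\<^bsub>QW\<^esub> \<ominus>\<^bsub>QW\<^esub> delta (reflection cr a))"

definition Xel :: "'i \<Rightarrow> (('l \<Rightarrow> 'l) \<Rightarrow> 'k)" where "Xel i = Xroot (al i)"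

definition R_subalgebra :: "(('l \<Rightarrow> 'l) \<Rightarrow> 'k) set \<Rightarrow> bool" where
  "R_subalgebra B \<longleftrightarrow> subring B QW \<and> (\<forall>r. \<forall>b\<in>B. coef (scalar r) \<otimes>\<^bsub>QW\<^esub> b \<in> B)"

definition D :: "(('l \<Rightarrow> 'l) \<Rightarrow> 'k) set" where
  "D = \<Inter> {B. R_subalgebra B \<and> coef ` S \<subseteq> B \<and> Xel ` I \<subseteq> B}"

definition D_ring :: "(('l \<Rightarrow> 'l) \<Rightarrow> 'k) ring" where
  "D_ring = QW\<lparr>carrier := D\<rparr>"

subsection \<open>The relations\<close>

text \<open>Each set consists of pairs (left hand side, right hand side) in a ring \<open>G\<close> with elements
  \<open>Y i\<close> in place of \<open>X\<^sub>i\<close> and \<open>c q\<close> in place of the coefficient \<open>q\<close>.  This way the relations can be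
  read both in \<open>Q\<^sub>W\<close> and in a free algebra.\<close>

context
  fixes G :: "'g ring" (structure)
    and c :: "'k \<Rightarrow> 'g"
    and Y :: "'i \<Rightarrow> 'g"
begin

definition rel1 :: "'k set \<Rightarrow> ('g \<times> 'g) set" where
  "rel1 A = {(c q \<otimes> Y i, Y i \<otimes> c (act (reflection cr (al i)) q) \<oplus> c (Dlt i q)) | i q. i \<in> I \<and> q \<in> A}"

definition rel2 :: "('g \<times> 'g) set" where
  "rel2 = {(Y i \<otimes> Y i, Y i \<otimes> c (kappa1 i)) | i. i \<in> I}"

definition rel3 :: "('g \<times> 'g) set" where
  "rel3 = {(Y i \<otimes> Y j, Y j \<otimes> Y i) | i j. i \<in> I \<and> j \<in> I \<and> cr (al i) (al j) = 0}"

definition rel4a :: "('g \<times> 'g) set" where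
  "rel4a = {(monomial G Y [j,i,j] \<ominus> monomial G Y [i,j,i],
      Y i \<otimes> c (kappa (al i) (al j)) \<ominus> Y j \<otimes> c (kappa (al j) (al i))) | i j.
      i \<in> I \<and> j \<in> I \<and> i \<noteq> j \<and> cr (al i) (al j) = -1 \<and> cr (al j) (al i) = -1}"

definition rel4b :: "('g \<times> 'g) set" where
  "rel4b = {(let A = kappa (rt i j 1 2) (rt i j 0 (-1)) + kappa (al j) (al i);
                 B = kappa (rt i j 1 1) (rt i j 0 1) + kappa (al i) (al j)
      in (monomial G Y [j,i,j,i] \<ominus> monomial G Y [i,j,i,j],
          monomial G Y [i,j] \<otimes> c A \<ominus> monomial G Y [j,i] \<otimes> c B
            \<oplus> Y j \<otimes> c (Dlt i B) \<ominus> Y i \<otimes> c (Dlt j A))) | i j.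
      i \<in> I \<and> j \<in> I \<and> i \<noteq> j \<and> cr (al i) (al j) = -1 \<and> cr (al j) (al i) = -2}"

definition rel4c :: "('g \<times> 'g) set" where
  "rel4c = {(let A = kappa (al j) (al i) + kappa (rt i j 2 3) (rt i j (-1) (-2))
                   + kappa (rt i j (-1) (-3)) (rt i j 1 2) + kappa (rt i j 1 2) (rt i j 0 (-1));
                 B = kappa (al i) (al j) + kappa (rt i j (-2) (-3)) (rt i j 1 2)
                   + kappa (rt i j (-1) (-2)) (rt i j 1 3) + kappa (rt i j 1 1) (rt i j 0 1)
      in (monomial G Y [j,i,j,i,j,i] \<ominus> monomial G Y [i,j,i,j,i,j],
          monomial G Y [i,j,i,j] \<otimes> c A \<ominus> monomial G Y [j,i,j,i] \<otimes> c B
            \<oplus> monomial G Y [j,i,j] \<otimes> c (Dlt i B) \<ominus> monomial G Y [i,j,i] \<otimes> c (Dlt j A)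
            \<oplus> monomial G Y [i,j] \<otimes> c (xi_ij i j) \<ominus> monomial G Y [j,i] \<otimes> c (xi_ji i j)
            \<oplus> Y j \<otimes> c (Dlt i (xi_ji i j)) \<ominus> Y i \<otimes> c (Dlt j (xi_ij i j)))) | i j.
      i \<in> I \<and> j \<in> I \<and> i \<noteq> j \<and> cr (al i) (al j) = -1 \<and> cr (al j) (al i) = -3}"

definition relations :: "'k set \<Rightarrow> ('g \<times> 'g) set" where
  "relations A = rel1 A \<union> rel2 \<union> rel3 \<union> rel4a \<union> rel4b \<union> rel4c"

end

subsection \<open>Completeness of the relations\<close>

text \<open>For an \<open>R\<close>-subalgebra \<open>A\<close> of \<open>Q\<close>: the \<open>R\<close>-algebra generated by the algebra \<open>A\<close> and symbols
  \<open>X'\<^sub>i\<close>, subject to the relations.  It is the quotient of the free \<open>R\<close>-algebra on the symbols \<open>Inl a\<close>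
  (\<open>a \<in> A\<close>) and \<open>Inr i\<close> (\<open>i \<in> I\<close>) by the relations, among them those expressing the algebra
  structure of \<open>A\<close>.\<close>

abbreviation FA :: "'k set \<Rightarrow> (('k + 'i) word \<Rightarrow>\<^sub>0 'r) ring" where
  "FA A \<equiv> free_algebra (Inl ` A \<union> Inr ` I)"

abbreviation genA :: "'k \<Rightarrow> ('k + 'i) word \<Rightarrow>\<^sub>0 'r" where "genA a \<equiv> free_gen (Inl a)"

abbreviation genX :: "'i \<Rightarrow> ('k + 'i) word \<Rightarrow>\<^sub>0 'r" where "genX i \<equiv> free_gen (Inr i)"

definition coefficient_relations :: "'k set \<Rightarrow> ((('k + 'i) word \<Rightarrow>\<^sub>0 'r) \<times> (('k + 'i) word \<Rightarrow>\<^sub>0 'r)) set" where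
  "coefficient_relations A =
     {(genA (a + b), genA a + genA b) | a b. a \<in> A \<and> b \<in> A} \<union>
     {(genA (a * b), genA a * genA b) | a b. a \<in> A \<and> b \<in> A} \<union>
     {(genA (scalar r), Poly_Mapping.single 0 r) | r. True}"

definition presentation_ideal :: "'k set \<Rightarrow> (('k + 'i) word \<Rightarrow>\<^sub>0 'r) set" where
  "presentation_ideal A = genideal (FA A)
     ((\<lambda>(l, r). l \<ominus>\<^bsub>FA A\<^esub> r) ` (coefficient_relations A \<union> relations (FA A) genA genX A))"

definition presented :: "'k set \<Rightarrow> (('k + 'i) word \<Rightarrow>\<^sub>0 'r) set ring" where
  "presented A = FA A Quot presentation_ideal A"

definition complete_relations :: "'k set \<Rightarrow> ('t, 'm) ring_scheme \<Rightarrow> ('k \<Rightarrow> 't) \<Rightarrow> ('i \<Rightarrow> 't) \<Rightarrow> bool" where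
  "complete_relations A T c Y \<longleftrightarrow>
     (\<exists>h\<in>ring_iso (presented A) T.
        (\<forall>a\<in>A. h (presentation_ideal A +>\<^bsub>FA A\<^esub> genA a) = c a) \<and>
        (\<forall>i\<in>I. h (presentation_ideal A +>\<^bsub>FA A\<^esub> genX i) = Y i))"

subsection \<open>Extension of the right coefficients\<close>

text \<open>The tensor product of the right \<open>S\<close>-module \<open>D\<close> with \<open>S_tilde\<close> over \<open>S\<close>, as a quotient of the
  free abelian group on the pairs \<open>(d, a)\<close>.\<close>

definition pairs_group :: "(((('l \<Rightarrow> 'l) \<Rightarrow> 'k) \<times> 'k) \<Rightarrow>\<^sub>0 int) monoid" where
  "pairs_group = free_Abelian_group (D \<times> S_tilde)"

definition tensor_kernel :: "(((('l \<Rightarrow> 'l) \<Rightarrow> 'k) \<times> 'k) \<Rightarrow>\<^sub>0 int) set" where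
  "tensor_kernel = generate pairs_group
     ({frag_of (d \<oplus>\<^bsub>QW\<^esub> e, a) - frag_of (d, a) - frag_of (e, a) | d e a. d \<in> D \<and> e \<in> D \<and> a \<in> S_tilde} \<union>
      {frag_of (d, a + b) - frag_of (d, a) - frag_of (d, b) | d a b. d \<in> D \<and> a \<in> S_tilde \<and> b \<in> S_tilde} \<union>
      {frag_of (d \<otimes>\<^bsub>QW\<^esub> coef s, a) - frag_of (d, s * a) | d s a. d \<in> D \<and> s \<in> S \<and> a \<in> S_tilde})"

definition tensor_group :: "(((('l \<Rightarrow> 'l) \<Rightarrow> 'k) \<times> 'k) \<Rightarrow>\<^sub>0 int) set monoid" where
  "tensor_group = pairs_group Mod tensor_kernel"

definition tensor :: "(('l \<Rightarrow> 'l) \<Rightarrow> 'k) \<Rightarrow> 'k \<Rightarrow> (((('l \<Rightarrow> 'l) \<Rightarrow> 'k) \<times> 'k) \<Rightarrow>\<^sub>0 int) set" where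
  "tensor d a = tensor_kernel #>\<^bsub>pairs_group\<^esub> frag_of (d, a)"

text \<open>The canonical map to \<open>Q\<^sub>W\<close> with \<open>d \<otimes> a \<mapsto> d a\<close>; the linear extension is constant on cosets of
  \<open>tensor_kernel\<close>.\<close>

definition tensor_lin :: "(((('l \<Rightarrow> 'l) \<Rightarrow> 'k) \<times> 'k) \<Rightarrow>\<^sub>0 int) \<Rightarrow> (('l \<Rightarrow> 'l) \<Rightarrow> 'k)" where
  "tensor_lin z = (\<lambda>u. \<Sum>p\<in>Poly_Mapping.keys z.
     of_int (Poly_Mapping.lookup z p) * (fst p \<otimes>\<^bsub>QW\<^esub> coef (snd p)) u)"

definition tensor_can :: "(((('l \<Rightarrow> 'l) \<Rightarrow> 'k) \<times> 'k) \<Rightarrow>\<^sub>0 int) set \<Rightarrow> (('l \<Rightarrow> 'l) \<Rightarrow> 'k)" where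
  "tensor_can C = the_elem (tensor_lin ` C)"

text \<open>Products in the tensor product are computed in \<open>Q\<^sub>W\<close>.  The definition of the product is
  meaningful when \<open>tensor_can\<close> is injective with multiplicatively closed image.\<close>

definition D_tensor :: "(((('l \<Rightarrow> 'l) \<Rightarrow> 'k) \<times> 'k) \<Rightarrow>\<^sub>0 int) set ring" where
  "D_tensor = \<lparr>carrier = carrier tensor_group,
     monoid.mult = (\<lambda>s t. the_inv_into (carrier tensor_group) tensor_can (tensor_can s \<otimes>\<^bsub>QW\<^esub> tensor_can t)),
     one = tensor (\<one>\<^bsub>QW\<^esub>) 1,
     ring.zero = \<one>\<^bsub>tensor_group\<^esub>,
     add = (\<otimes>\<^bsub>tensor_group\<^esub>)\<rparr>"

end

end

theory Submission imports Defs begin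

text \<open>Let \<open>S = R[[\<Lambda>]]\<^sub>F\<close>.  The elements of \<open>Q\<^sub>W\<close> are functions on \<open>W\<close>, and left multiplication by \<open>X\<^sub>i\<close> is a divided
  difference of such functions (lemma \<open>X_mult\<close>).  In terms of the inverses \<open>z\<^sub>\<beta> = 1/x\<^sub>\<beta>\<close> of the roots \<open>\<beta>\<close> spanned by
  \<open>\<alpha>\<^sub>i\<close> and \<open>\<alpha>\<^sub>j\<close>, each braid relation becomes an identity on one orbit of the dihedral group generated by \<open>s\<^sub>i\<close> and
  \<open>s\<^sub>j\<close>, and this identity already holds between polynomials in independent variables \<open>z\<^sub>\<beta>\<close> (lemmas \<open>braid_A2\<close>,
  \<open>braid_B2\<close>, \<open>braid_G2\<close>).  So the relations hold in \<open>Q\<^sub>W\<close> (theorem \<open>relations_hold\<close>).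

  The formal group law is responsible for the integrality of the coefficients.  It has the shape
  \<open>F(u, v) = u + v + u v H(u, v)\<close>, which gives \<open>x\<^sub>l\<^sub>+\<^sub>m = x\<^sub>l + x\<^sub>m + x\<^sub>l x\<^sub>m H(x\<^sub>l, x\<^sub>m)\<close>.  It follows that \<open>\<Delta>\<^sub>i\<close> preserves \<open>S\<close>
  (\<open>Dlt_S\<close>, through the divided differences of power series in \<open>divided_difference\<close>) and that the \<open>\<kappa>\<close> lie in \<open>S\<close>
  (\<open>kappa_S\<close>).  The elements \<open>\<xi>\<^sub>i\<^sub>j\<close> and \<open>\<xi>\<^sub>j\<^sub>i\<close> lie in \<open>S\<close> as well (theorem \<open>xi_S\<close>): the braid relation of type G2, read as
  an identity of operators on \<open>S\<close>, shows that they are coefficients of an operator that preserves \<open>S\<close>, and they can be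
  recovered from its values at the fundamental weights, where the divided differences are units.  Hence the ring
  \<open>R[[\<Lambda>]]\<^sub>F\<^sup>\<sim>\<close> is \<open>S\<close> itself, and the two completeness statements are about the same coefficients.

  For the completeness, evaluation maps the free algebra on \<open>S\<close> and the symbols \<open>X\<^sub>i'\<close> onto \<open>D\<close> (lemma \<open>image_ev\<close>), and its kernel
  has to be the ideal of the relations.  Modulo the relations coefficients can be moved to the right.  Two reduced words
  of the same \<open>w\<close> agree up to shorter words, since by the theorem of Matsumoto (\<open>word_property\<close>) they are connected by braid
  moves, and a word that is not reduced is a combination of shorter ones by means of \<open>X\<^sub>i\<^sup>2 = X\<^sub>i \<kappa>\<^sub>i\<close>.  Thus the
  monomials of the chosen reduced words, one for each \<open>w\<close>, span as a right \<open>S\<close>-module (\<open>V_normal\<close>).  In \<open>Q\<^sub>W\<close> the monomial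
  of \<open>w\<close> does not vanish at \<open>w\<close> and otherwise lives on shorter elements (\<open>mono_support\<close>, \<open>mono_leading\<close>), so
  these monomials are independent and the kernel is no larger (\<open>kernel_ev\<close>).  Finally, every element of \<open>D \<otimes>\<^sub>S S\<close> is a pure tensor
  \<open>d \<otimes> 1\<close>, so the extension of coefficients is isomorphic to \<open>D\<close> and inherits the presentation (\<open>complete_tensor\<close>).\<close>

section \<open>Polynomials, powers of the augmentation ideal and their cosets\<close>

lemma typering_simps [simp]:
  "carrier (ring_of_type_algebra :: 'a::ring_1 ring) = UNIV"
  "x \<otimes>\<^bsub>(ring_of_type_algebra :: 'a ring)\<^esub> y = x * y"
  "x \<oplus>\<^bsub>(ring_of_type_algebra :: 'a ring)\<^esub> y = x + y"
  "\<one>\<^bsub>(ring_of_type_algebra :: 'a ring)\<^esub> = 1"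
  "\<zero>\<^bsub>(ring_of_type_algebra :: 'a ring)\<^esub> = 0"
  by (simp_all add: ring_of_type_algebra_def)

lemma ring_typering: "ring (ring_of_type_algebra :: 'a::ring_1 ring)"
proof -
  have "\<exists>y. x + y = 0" for x :: 'a
    using add.right_inverse by blast
  moreover have "\<exists>y. y + x = 0" for x :: 'a
    using add.left_inverse by blast
  ultimately show ?thesis
    unfolding ring_of_type_algebra_def
    by unfold_locales (auto simp: algebra_simps Units_def)
qed

lemma cring_typering: "cring (ring_of_type_algebra :: 'a::comm_ring_1 ring)"
  by (rule cring_from_type_algebra)

lemma typering_inv [simp]: "\<ominus>\<^bsub>(ring_of_type_algebra :: 'a::ring_1 ring)\<^esub> x = - x"
proof -
  interpret ring "ring_of_type_algebra :: 'a ring" by (rule ring_typering)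
  show ?thesis by (rule minus_equality) auto
qed

abbreviation (input) aug_pow :: "nat \<Rightarrow> ('v, 'r::comm_ring_1) mpoly set" where
  "aug_pow n \<equiv> ideal_power ring_of_type_algebra augmentation_ideal n"

lemma single_expansion: "p = (\<Sum>m\<in>Poly_Mapping.keys p. Poly_Mapping.single m (Poly_Mapping.lookup p m))"
  by (rule poly_mapping_eqI)
    (auto simp: lookup_sum lookup_single when_def in_keys_iff not_in_keys_iff_lookup_eq_zero)

lemma lookup_mult_0:
  fixes p q :: "('v, 'r::comm_ring_1) mpoly"
  shows "Poly_Mapping.lookup (p * q) 0 = Poly_Mapping.lookup p 0 * Poly_Mapping.lookup q 0"
proof -
  have zero: "(0 = l + m) \<longleftrightarrow> l = 0 \<and> m = 0" for l m :: "'v \<Rightarrow>\<^sub>0 nat"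
    by (auto simp: poly_mapping_eq_iff fun_eq_iff lookup_add)
  have "Sum_any (\<lambda>m. Poly_Mapping.lookup q m when (0::'v \<Rightarrow>\<^sub>0 nat) = l + m) =
      (Poly_Mapping.lookup q 0 when l = 0)" for l :: "'v \<Rightarrow>\<^sub>0 nat"
    by (cases "l = 0") (auto simp: zero)
  then show ?thesis
    by (simp add: lookup_mult mult_when)
qed

lemma aug_ideal: "ideal augmentation_ideal (ring_of_type_algebra :: ('v, 'r::comm_ring_1) mpoly ring)"
proof (rule idealI)
  show "subgroup augmentation_ideal (add_monoid (ring_of_type_algebra :: ('v, 'r) mpoly ring))"
  proof (rule group.subgroupI)
    interpret ring "ring_of_type_algebra :: ('v, 'r) mpoly ring" by (rule ring_typering)
    show "Group.group (add_monoid (ring_of_type_algebra :: ('v, 'r) mpoly ring))" 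
      by (rule add.is_group)
    show "inv\<^bsub>add_monoid ring_of_type_algebra\<^esub> a \<in> augmentation_ideal" if "a \<in> augmentation_ideal"
      for a :: "('v, 'r) mpoly"
      using that typering_inv[of a] by (simp add: augmentation_ideal_def a_inv_def)
  qed (auto simp: augmentation_ideal_def lookup_add intro: exI[of _ 0])
qed (auto simp: augmentation_ideal_def lookup_mult_0 ring_typering)

lemma aug_pow_ideal:
  "ideal (aug_pow n) (ring_of_type_algebra :: ('v, 'r::comm_ring_1) mpoly ring)"
proof (induction n)
  case 0
  then show ?case using ring.oneideal[OF ring_typering] by simp
next
  case (Suc n)
  then show ?case
    using ring.ideal_prod_is_ideal[OF ring_typering _ aug_ideal] by simp
qed

lemma aug_pow_0 [simp]: "p \<in> aug_pow 0" by simp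

lemma aug_pow_zero [simp]: "0 \<in> aug_pow n"
  using additive_subgroup.zero_closed[OF ideal.axioms(1)[OF aug_pow_ideal[of n]]] by simp

lemma aug_pow_add: "p \<in> aug_pow n \<Longrightarrow> q \<in> aug_pow n \<Longrightarrow> p + q \<in> aug_pow n"
  using additive_subgroup.a_closed[OF ideal.axioms(1)[OF aug_pow_ideal[of n]]] by simp

lemma aug_pow_uminus: "p \<in> aug_pow n \<Longrightarrow> - p \<in> aug_pow n"
  using ideal.I_l_closed[OF aug_pow_ideal[of n], of p "-1"] by simp

lemma aug_pow_diff: "p \<in> aug_pow n \<Longrightarrow> q \<in> aug_pow n \<Longrightarrow> p - q \<in> aug_pow n"
  using aug_pow_add[OF _ aug_pow_uminus] by fastforce

lemma aug_pow_mult: "p \<in> aug_pow n \<Longrightarrow> q * p \<in> aug_pow n"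
  using ideal.I_l_closed[OF aug_pow_ideal[of n]] by simp

lemma aug_pow_mult_right: "p \<in> aug_pow n \<Longrightarrow> p * q \<in> aug_pow n"
  using aug_pow_mult[of p n q] by (simp add: mult.commute)

lemma aug_pow_sum: "(\<And>k. k \<in> A \<Longrightarrow> g k \<in> aug_pow n) \<Longrightarrow> sum g A \<in> aug_pow n"
  by (induction A rule: infinite_finite_induct) (auto intro: aug_pow_add)

lemma aug_pow_Suc_subset: "aug_pow (Suc n) \<subseteq> (aug_pow n :: ('v, 'r::comm_ring_1) mpoly set)"
proof -
  have "aug_pow (Suc n) \<subseteq> (aug_pow n \<inter> augmentation_ideal :: ('v, 'r) mpoly set)"
    unfolding ideal_power.simps by (rule ring.ideal_prod_inter[OF ring_typering aug_pow_ideal aug_ideal])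
  then show ?thesis by blast
qed

lemma aug_pow_mono: "m \<le> n \<Longrightarrow> aug_pow n \<subseteq> aug_pow m"
  by (rule lift_Suc_antimono_le[where f = "\<lambda>n. aug_pow n", OF aug_pow_Suc_subset])

lemma aug_pow_Suc_induct [consumes 1, case_names prod sum]:
  assumes "p \<in> aug_pow (Suc n)"
    and "\<And>p q. p \<in> aug_pow n \<Longrightarrow> q \<in> augmentation_ideal \<Longrightarrow> P (p * q)"
    and "\<And>p q. P p \<Longrightarrow> P q \<Longrightarrow> P (p + q)"
  shows "P p"
proof -
  have "p \<in> ideal_prod ring_of_type_algebra (aug_pow n) augmentation_ideal"
    using assms(1) by simp
  then show ?thesis by induction (use assms in auto)
qed

lemma aug_pow_1: "aug_pow (Suc 0) = augmentation_ideal"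
proof (intro equalityI subsetI)
  show "p \<in> augmentation_ideal" if "p \<in> aug_pow (Suc 0)" for p :: "('v, 'r::comm_ring_1) mpoly"
    using that by (induction rule: aug_pow_Suc_induct)
      (auto simp: augmentation_ideal_def lookup_mult_0 lookup_add)
  show "p \<in> aug_pow (Suc 0)" if "p \<in> augmentation_ideal" for p :: "('v, 'r::comm_ring_1) mpoly"
    using ideal_prod.prod[of 1 UNIV p augmentation_ideal ring_of_type_algebra] that by simp
qed

lemma aug_pow_mult_add:
  "p \<in> aug_pow m \<Longrightarrow> q \<in> aug_pow n \<Longrightarrow> p * q \<in> aug_pow (m + n)"
proof (induction n arbitrary: p q)
  case 0
  then show ?case using aug_pow_mult_right by simp
next
  case (Suc n)
  from Suc.prems(2) show ?case
  proof (induction rule: aug_pow_Suc_induct)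
    case (prod a b)
    then have "(p * a) * b \<in> aug_pow (Suc (m + n))"
      using Suc.IH[OF Suc.prems(1)] ideal_prod.prod[of "p * a" "aug_pow (m + n)" b augmentation_ideal ring_of_type_algebra]
      by simp
    then show ?case by (simp add: mult.assoc)
  next
    case (sum a b)
    then show ?case using aug_pow_add by (metis distrib_left)
  qed
qed

lemma aug_pow_power: "p \<in> aug_pow (Suc 0) \<Longrightarrow> p ^ k \<in> aug_pow k"
  by (induction k) (use aug_pow_mult_add[of p "Suc 0"] in \<open>auto simp del: ideal_power.simps(2)\<close>)

lemma poly_var_aug: "poly_var v \<in> aug_pow (Suc 0)"
  by (simp add: aug_pow_1 del: ideal_power.simps)
    (auto simp: augmentation_ideal_def poly_var_def lookup_single when_def poly_mapping_eq_iff fun_eq_iff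
      split: if_splits)

text \<open>In one variable, the elements of the \<open>n\<close>-th power of the augmentation ideal have no coefficient in degree
  less than \<open>n\<close>. This is what makes it possible to compare coefficients of power series.\<close>

lemma aug_pow_lookup:
  fixes p :: "('v, 'r::comm_ring_1) mpoly"
  assumes "p \<in> aug_pow n" "i < n"
  shows "Poly_Mapping.lookup p (Poly_Mapping.single v i) = 0"
  using assms
proof (induction n arbitrary: p i)
  case (Suc n)
  from Suc.prems(1) show ?case
  proof (induction rule: aug_pow_Suc_induct)
    case (prod a b)
    have "Poly_Mapping.lookup a l * Sum_any (\<lambda>q. Poly_Mapping.lookup b q when Poly_Mapping.single v i = l + q) = 0" for l
    proof (cases "\<exists>q. Poly_Mapping.single v i = l + q")
      case True
      then obtain q where q: "Poly_Mapping.single v i = l + q" by auto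
      have l0: "Poly_Mapping.lookup l u = 0 \<and> Poly_Mapping.lookup q u = 0" if "u \<noteq> v" for u
        using arg_cong[OF q, of "\<lambda>f. Poly_Mapping.lookup f u"] that by (simp add: lookup_add lookup_single)
      have lv: "l = Poly_Mapping.single v (Poly_Mapping.lookup l v)"
        using l0 by (intro poly_mapping_eqI) (auto simp: lookup_single when_def)
      have iv: "i = Poly_Mapping.lookup l v + Poly_Mapping.lookup q v"
        using arg_cong[OF q, of "\<lambda>f. Poly_Mapping.lookup f v"] by (simp add: lookup_add)
      show ?thesis
      proof (cases "Poly_Mapping.lookup l v < n")
        case True
        then show ?thesis using Suc.IH[OF prod(1)] lv by (metis mult_zero_left)
      next
        case False
        then have "l = Poly_Mapping.single v i" using iv Suc.prems(2) lv
          by (metis add_leD1 le_antisym le_eq_less_or_eq less_Suc_eq_le not_less nat_le_iff_add)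
        then have "(Poly_Mapping.lookup b q' when Poly_Mapping.single v i = l + q') =
            (Poly_Mapping.lookup b q' when q' = 0)" for q'
          by (auto simp: when_def)
        then show ?thesis using prod(2) by (simp add: augmentation_ideal_def when_def)
      qed
    next
      case False
      then show ?thesis by simp
    qed
    then show ?case by (simp add: lookup_mult)
  qed (auto simp: lookup_add)
qed simp

lemma hat_eq_iff: "hat p n = hat q n \<longleftrightarrow> p - q \<in> aug_pow n"
proof -
  have im: "hat p n = (\<lambda>j. j + p) ` aug_pow n" for p :: "('a, 'b) mpoly"
    by (auto simp: hat_def a_r_coset_def r_coset_def)
  show ?thesis
  proof
    assume "hat p n = hat q n"
    then have "p \<in> hat q n" using im[of p] aug_pow_zero[of n] by force
    then show "p - q \<in> aug_pow n" by (auto simp: im)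
  next
    assume d: "p - q \<in> aug_pow n"
    have "x \<in> hat q n" if "x \<in> hat p n" for x
      using that aug_pow_add[OF _ d] unfolding im by (force simp: algebra_simps image_iff)
    moreover have "x \<in> hat p n" if "x \<in> hat q n" for x
      using that aug_pow_diff[OF _ d] unfolding im by (force simp: algebra_simps image_iff)
    ultimately show "hat p n = hat q n" by blast
  qed
qed

lemma hat_mem: "q \<in> hat p n \<longleftrightarrow> q - p \<in> aug_pow n"
  by (force simp: hat_def a_r_coset_def r_coset_def image_iff)

lemma poly_quot_simps:
  fixes p q :: "('v, 'r::comm_ring_1) mpoly"
  shows "carrier (poly_quot n :: ('v, 'r::comm_ring_1) mpoly set ring) = range (\<lambda>p. hat p n)"
  "hat p n \<otimes>\<^bsub>poly_quot n\<^esub> hat q n = hat (p * q) n"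
  "hat p n \<oplus>\<^bsub>poly_quot n\<^esub> hat q n = hat (p + q) n"
  "\<one>\<^bsub>poly_quot n\<^esub> = (hat 1 n :: ('v, 'r) mpoly set)"
  "\<zero>\<^bsub>poly_quot n\<^esub> = (hat 0 n :: ('v, 'r) mpoly set)"
proof -
  interpret J: ideal "aug_pow n" "ring_of_type_algebra :: ('v, 'r) mpoly ring" by (rule aug_pow_ideal)
  show "carrier (poly_quot n :: ('v, 'r) mpoly set ring) = range (\<lambda>p. hat p n)"
    by (auto simp: poly_quot_def FactRing_def A_RCOSETS_def' hat_def)
  show "hat p n \<otimes>\<^bsub>poly_quot n\<^esub> hat q n = hat (p * q) n"
    using J.rcoset_mult_add[of p q] by (simp add: poly_quot_def FactRing_def hat_def)
  show "hat p n \<oplus>\<^bsub>poly_quot n\<^esub> hat q n = hat (p + q) n"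
    using J.a_rcos_sum[of p q] by (simp add: poly_quot_def FactRing_def hat_def)
  show "\<one>\<^bsub>poly_quot n\<^esub> = (hat 1 n :: ('v, 'r) mpoly set)"
    by (simp add: poly_quot_def FactRing_def hat_def)
  show "\<zero>\<^bsub>poly_quot n\<^esub> = (hat 0 n :: ('v, 'r) mpoly set)"
    by (auto simp: poly_quot_def FactRing_def hat_mem)
qed

lemma poly_quot_cring: "cring (poly_quot n :: ('v, 'r::comm_ring_1) mpoly set ring)"
  unfolding poly_quot_def by (rule ideal.quotient_is_cring[OF aug_pow_ideal cring_typering])

lemma poly_quot_pow: "hat p n [^]\<^bsub>poly_quot n\<^esub> k = hat (p ^ k) n"
proof (induction k)
  case (Suc k)
  interpret cring "poly_quot n :: ('a, 'b) mpoly set ring" by (rule poly_quot_cring)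
  show ?case using Suc by (simp add: poly_quot_simps mult.commute)
qed (simp add: poly_quot_simps nat_pow_def)

lemma poly_quot_finsum:
  "finite A \<Longrightarrow> finsum (poly_quot n) (\<lambda>k. hat (g k) n) A = hat (\<Sum>k\<in>A. g k) n"
proof (induction A rule: finite_induct)
  case empty
  interpret cring "poly_quot n :: ('b, 'c) mpoly set ring" by (rule poly_quot_cring)
  show ?case by (simp add: poly_quot_simps)
next
  case (insert a A)
  interpret cring "poly_quot n :: ('b, 'c) mpoly set ring" by (rule poly_quot_cring)
  show ?case using insert by (simp add: poly_quot_simps)
qed

section \<open>The completion in terms of sequences of polynomials\<close>

text \<open>An element of the completion is a compatible family of cosets. All computations are made with representatives:
  sequences of polynomials in which the \<open>n\<close>-th and all later terms agree modulo the \<open>n\<close>-th power of the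
  augmentation ideal.\<close>

definition Cauchy :: "(nat \<Rightarrow> ('v, 'r::comm_ring_1) mpoly) \<Rightarrow> bool" where
  "Cauchy p \<longleftrightarrow> (\<forall>n. p (Suc n) - p n \<in> aug_pow n)"

definition cl :: "(nat \<Rightarrow> ('v, 'r::comm_ring_1) mpoly) \<Rightarrow> ('v, 'r) mpoly_hat" where
  "cl p = (\<lambda>n. hat (p n) n)"

lemma Cauchy_const [simp]: "Cauchy (\<lambda>n. p)" by (simp add: Cauchy_def)

lemma Cauchy_add: "Cauchy p \<Longrightarrow> Cauchy q \<Longrightarrow> Cauchy (\<lambda>n. p n + q n)"
  unfolding Cauchy_def
proof
  fix n assume "\<forall>n. p (Suc n) - p n \<in> aug_pow n" "\<forall>n. q (Suc n) - q n \<in> aug_pow n"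
  then have "(p (Suc n) - p n) + (q (Suc n) - q n) \<in> aug_pow n" by (intro aug_pow_add) auto
  then show "p (Suc n) + q (Suc n) - (p n + q n) \<in> aug_pow n" by (simp add: algebra_simps)
qed

lemma Cauchy_mult: "Cauchy p \<Longrightarrow> Cauchy q \<Longrightarrow> Cauchy (\<lambda>n. p n * q n)"
  unfolding Cauchy_def
proof
  fix n assume "\<forall>n. p (Suc n) - p n \<in> aug_pow n" "\<forall>n. q (Suc n) - q n \<in> aug_pow n"
  then have "(p (Suc n) - p n) * q (Suc n) + p n * (q (Suc n) - q n) \<in> aug_pow n"
    by (intro aug_pow_add aug_pow_mult aug_pow_mult_right) auto
  then show "p (Suc n) * q (Suc n) - p n * q n \<in> aug_pow n" by (simp add: algebra_simps)
qed

lemma Cauchy_uminus: "Cauchy p \<Longrightarrow> Cauchy (\<lambda>n. - p n)"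
  using Cauchy_mult[OF Cauchy_const[of "-1"]] by simp

lemma Cauchy_diff: "Cauchy p \<Longrightarrow> Cauchy q \<Longrightarrow> Cauchy (\<lambda>n. p n - q n)"
  using Cauchy_add[OF _ Cauchy_uminus] by simp

lemma Cauchy_diff_le:
  assumes "Cauchy p" "n \<le> m"
  shows "p m - p n \<in> aug_pow n"
  using assms(2)
proof (induction m rule: dec_induct)
  case (step m)
  have "p (Suc m) - p m \<in> aug_pow n"
    using assms(1) aug_pow_mono[OF step(1)] unfolding Cauchy_def by blast
  then show ?case using aug_pow_add[OF _ step.IH] by fastforce
qed simp

lemma poly_completion_simps:
  fixes p q :: "nat \<Rightarrow> ('v, 'r::comm_ring_1) mpoly"
  shows "carrier (poly_completion :: ('v, 'r::comm_ring_1) mpoly_hat ring) = cl ` Collect Cauchy"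
  "cl p \<otimes>\<^bsub>poly_completion\<^esub> cl q = cl (\<lambda>n. p n * q n)"
  "cl p \<oplus>\<^bsub>poly_completion\<^esub> cl q = cl (\<lambda>n. p n + q n)"
  "\<one>\<^bsub>poly_completion\<^esub> = (cl (\<lambda>n. 1) :: ('v, 'r) mpoly_hat)"
  "\<zero>\<^bsub>poly_completion\<^esub> = (cl (\<lambda>n. 0) :: ('v, 'r) mpoly_hat)"
proof -
  have sub: "hat p (Suc n) \<subseteq> hat q n \<longleftrightarrow> p - q \<in> aug_pow n" for p q :: "('v, 'r) mpoly" and n
  proof
    assume "hat p (Suc n) \<subseteq> hat q n"
    moreover have "p \<in> hat p (Suc n)" by (simp add: hat_mem del: ideal_power.simps)
    ultimately have "p \<in> hat q n" by blast
    then show "p - q \<in> aug_pow n" by (simp only: hat_mem)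
  next
    assume d: "p - q \<in> aug_pow n"
    have "x - q \<in> aug_pow n" if "x - p \<in> aug_pow (Suc n)" for x
    proof -
      have "(x - p) + (p - q) \<in> aug_pow n"
        using that d aug_pow_Suc_subset by (intro aug_pow_add) auto
      then show ?thesis by simp
    qed
    then show "hat p (Suc n) \<subseteq> hat q n" by (auto simp: hat_mem simp del: ideal_power.simps)
  qed
  show "carrier (poly_completion :: ('v, 'r) mpoly_hat ring) = cl ` Collect Cauchy" (is "?L = ?R")
  proof (intro equalityI subsetI)
    fix a :: "('v, 'r) mpoly_hat" assume "a \<in> ?L"
    then have a: "\<forall>n. a n \<in> carrier (poly_quot n) \<and> a (Suc n) \<subseteq> a n"
      by (simp add: poly_completion_def adic_completion_def poly_quot_def)
    then have "a n \<in> range (\<lambda>p. hat p n)" for n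
      unfolding poly_quot_simps(1) by (elim allE[of _ n] conjE)
    then have "\<exists>p. a n = hat p n" for n by blast
    then obtain p where p: "\<And>n. a n = hat (p n) n" by metis
    then have "a = cl p" by (auto simp: cl_def)
    moreover have "Cauchy p" using a by (auto simp: Cauchy_def p sub)
    ultimately show "a \<in> ?R" by auto
  next
    fix a :: "('v, 'r) mpoly_hat" assume "a \<in> ?R"
    then obtain p where "a = cl p" "Cauchy p" by auto
    moreover have "hat (p n) n \<in> carrier (poly_quot n)" for n by (simp add: poly_quot_simps)
    ultimately show "a \<in> ?L"
      by (auto simp: poly_completion_def adic_completion_def poly_quot_def[symmetric] cl_def Cauchy_def sub
          simp del: ideal_power.simps)
  qed
  show "cl p \<otimes>\<^bsub>poly_completion\<^esub> cl q = cl (\<lambda>n. p n * q n)"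
    by (simp add: poly_completion_def adic_completion_def poly_quot_def[symmetric] cl_def poly_quot_simps)
  show "cl p \<oplus>\<^bsub>poly_completion\<^esub> cl q = cl (\<lambda>n. p n + q n)"
    by (simp add: poly_completion_def adic_completion_def poly_quot_def[symmetric] cl_def poly_quot_simps)
  show "\<one>\<^bsub>poly_completion\<^esub> = (cl (\<lambda>n. 1) :: ('v, 'r) mpoly_hat)"
    by (simp add: poly_completion_def adic_completion_def poly_quot_def[symmetric] cl_def poly_quot_simps)
  show "\<zero>\<^bsub>poly_completion\<^esub> = (cl (\<lambda>n. 0) :: ('v, 'r) mpoly_hat)"
    by (simp add: poly_completion_def adic_completion_def poly_quot_def[symmetric] cl_def poly_quot_simps)
qed

lemma cl_eq_iff: "cl p = cl q \<longleftrightarrow> (\<forall>n. p n - q n \<in> aug_pow n)"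
  by (simp add: cl_def fun_eq_iff hat_eq_iff)

lemma poly_completion_cring: "cring (poly_completion :: ('v, 'r::comm_ring_1) mpoly_hat ring)"
proof (rule cringI)
  show "abelian_group (poly_completion :: ('v, 'r) mpoly_hat ring)"
  proof (rule abelian_groupI)
    fix a :: "('v, 'r) mpoly_hat"
    assume "a \<in> carrier poly_completion"
    then obtain p where "a = cl p" "Cauchy p" by (auto simp: poly_completion_simps)
    then show "\<exists>b\<in>carrier poly_completion. b \<oplus>\<^bsub>poly_completion\<^esub> a = \<zero>\<^bsub>poly_completion\<^esub>"
      by (intro bexI[of _ "cl (\<lambda>n. - p n)"]) (auto simp: poly_completion_simps Cauchy_uminus)
  qed (auto simp: poly_completion_simps Cauchy_add algebra_simps)
  show "comm_monoid (poly_completion :: ('v, 'r) mpoly_hat ring)"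
    by (rule comm_monoidI) (auto simp: poly_completion_simps Cauchy_mult algebra_simps)
qed (auto simp: poly_completion_simps algebra_simps)

lemma poly_completion_inv:
  assumes "Cauchy p"
  shows "\<ominus>\<^bsub>poly_completion\<^esub> cl p = cl (\<lambda>n. - p n)"
proof -
  interpret cring "poly_completion :: ('a, 'b) mpoly_hat ring" by (rule poly_completion_cring)
  show ?thesis
    by (rule minus_equality) (auto simp: poly_completion_simps assms Cauchy_uminus)
qed

lemma poly_completion_minus:
  assumes "Cauchy q"
  shows "cl p \<ominus>\<^bsub>poly_completion\<^esub> cl q = cl (\<lambda>n. p n - q n)"
  by (simp add: a_minus_def poly_completion_inv assms poly_completion_simps)

lemma hat_cl: "hat p = cl (\<lambda>n. p)"
  by (simp add: cl_def fun_eq_iff)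

text \<open>For \<open>p\<close> and \<open>q\<close> in the augmentation ideal these partial sums, cut off at total degree
  \<open>n\<close>, represent the power series with coefficients \<open>g\<close> in \<open>p\<close> and \<open>q\<close>.\<close>

definition series :: "(nat \<Rightarrow> nat \<Rightarrow> 'r) \<Rightarrow> ('v, 'r::comm_ring_1) mpoly \<Rightarrow> ('v, 'r) mpoly \<Rightarrow> nat \<Rightarrow> ('v, 'r) mpoly" where
  "series g p q n = (\<Sum>(i, j)\<in>{(i, j). i + j < n}. poly_const (g i j) * (p ^ i * q ^ j))"

lemma finite_triangle [simp]: "finite {(i, j). i + j < (n::nat)}"
  by (rule finite_subset[of _ "{..n} \<times> {..n}"]) auto

lemma series_Cauchy:
  assumes "p \<in> aug_pow (Suc 0)" "q \<in> aug_pow (Suc 0)"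
  shows "Cauchy (series g p q)"
  unfolding Cauchy_def
proof
  fix n
  have "{(i, j). i + j < Suc n} = {(i, j). i + j < n} \<union> {(i, j). i + j = n}" by auto
  moreover have "finite {(i, j). i + j = n}" by (rule finite_subset[OF _ finite_triangle[of "Suc n"]]) auto
  ultimately have "series g p q (Suc n) - series g p q n =
      (\<Sum>(i, j)\<in>{(i, j). i + j = n}. poly_const (g i j) * (p ^ i * q ^ j))"
    by (simp add: series_def sum.union_disjoint disjoint_iff)
  also have "\<dots> \<in> aug_pow n"
    by (rule aug_pow_sum) (use aug_pow_mult[OF aug_pow_mult_add[OF aug_pow_power aug_pow_power]] assms in auto)
  finally show "series g p q (Suc n) - series g p q n \<in> aug_pow n" .
qed

lemma formal_sum_cl:
  "formal_sum F (hat p) (hat q) = cl (series (\<lambda>i j. fps_nth (fps_nth F i) j) p q)"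
proof
  fix n
  show "formal_sum F (hat p) (hat q) n = cl (series (\<lambda>i j. fps_nth (fps_nth F i) j) p q) n"
    unfolding formal_sum_def cl_def series_def poly_quot_pow poly_quot_simps
    by (subst poly_quot_finsum[symmetric]) (use finite_triangle[of n] in \<open>auto simp: case_prod_unfold simp del: finite_triangle\<close>)
qed

section \<open>Integer multiples in the lattice\<close>

lemma int_induct_add:
  assumes "P 0" "\<And>n. P n \<Longrightarrow> P (n + 1)" "\<And>n::int. P n \<Longrightarrow> P (n - 1)"
  shows "P n"
  by (induction n rule: int_induct[where k = 0]) (use assms in auto)

lemma zsmul_add: "zsmul (m + n) a = zsmul m a + zsmul n a"
proof -
  have suc: "zsmul (k + 1) a = zsmul k a + a" for k
  proof -
    consider "k \<ge> 0" | "k = -1" | "k \<le> -2" by linarith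
    then show ?thesis
    proof cases
      case 1
      then have "nat (k + 1) = Suc (nat k)" by simp
      then show ?thesis using 1 by (simp add: zsmul_def add.commute)
    next
      case 3
      then have "nat (- k) = Suc (nat (- (k + 1)))" by simp
      moreover have "\<not> k \<ge> 0" "\<not> k + 1 \<ge> 0" using 3 by auto
      ultimately show ?thesis unfolding zsmul_def by (simp del: minus_add_distrib minus_diff_commute)
    qed (simp add: zsmul_def)
  qed
  have pred: "zsmul (k - 1) a = zsmul k a - a" for k using suc[of "k - 1"] by simp
  show ?thesis
  proof (induction n rule: int_induct_add)
    case 1
    then show ?case by (simp add: zsmul_def)
  next
    case (2 n)
    then show ?case using suc[of "m + n"] suc[of n] by (simp add: add.assoc)
  next
    case (3 n)
    then show ?case using pred[of "m + n"] pred[of n] by (simp add: add_diff_eq)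
  qed
qed

lemma zsmul_0 [simp]: "zsmul 0 a = 0" by (simp add: zsmul_def)

lemma zsmul_1 [simp]: "zsmul 1 a = a" by (simp add: zsmul_def)

lemma zsmul_minus_left: "zsmul (- n) a = - zsmul n a"
  using zsmul_add[of n "- n" a] by (simp add: eq_neg_iff_add_eq_0 add.commute)

lemma zsmul_diff_left: "zsmul (m - n) a = zsmul m a - zsmul n a"
  using zsmul_add[of m "- n" a] by (simp add: zsmul_minus_left)

lemma zsmul_additive:
  assumes "Modules.additive f"
  shows "f (zsmul n a) = zsmul n (f a)"
proof -
  interpret Modules.additive f by fact
  show ?thesis
    by (induction n rule: int_induct_add) (auto simp: zsmul_add zsmul_diff_left add diff zero)
qed

lemma zsmul_right: "zsmul n (a + b) = zsmul n a + zsmul n b"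
  by (induction n rule: int_induct_add) (auto simp: zsmul_add zsmul_diff_left algebra_simps)

lemma zsmul_additive_right: "Modules.additive (zsmul n)"
  by standard (rule zsmul_right)

lemma zsmul_zero_right [simp]: "zsmul n 0 = 0"
  and zsmul_minus_right: "zsmul n (- a) = - zsmul n a"
  and zsmul_diff_right: "zsmul n (a - b) = zsmul n a - zsmul n b"
  and zsmul_sum_right: "zsmul n (sum g A) = (\<Sum>k\<in>A. zsmul n (g k))"
  using additive.zero[OF zsmul_additive_right] additive.minus[OF zsmul_additive_right]
    additive.diff[OF zsmul_additive_right] additive.sum[OF zsmul_additive_right] by auto

lemma zsmul_assoc: "zsmul m (zsmul n a) = zsmul (m * n) a"
  by (induction m rule: int_induct_add) (auto simp: zsmul_add zsmul_diff_left algebra_simps)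

interpretation zmod: Modules.module "zsmul :: int \<Rightarrow> 'l::ab_group_add \<Rightarrow> 'l"
  by standard (auto simp: zsmul_right zsmul_add zsmul_assoc)

lemma zsmul_int: "zsmul n (m :: int) = n * m"
  by (induction n rule: int_induct_add) (auto simp: zsmul_add zsmul_diff_left algebra_simps)

lemma additive_int_zsmul:
  assumes "Modules.additive (f :: 'l::ab_group_add \<Rightarrow> int)"
  shows "f (zsmul n a) = n * f a"
  using zsmul_additive[OF assms] by (simp add: zsmul_int)

section \<open>Substitution of variables\<close>

definition mon_act :: "('l \<Rightarrow> 'l) \<Rightarrow> ('l \<Rightarrow>\<^sub>0 nat) \<Rightarrow> ('l \<Rightarrow>\<^sub>0 nat)" where
  "mon_act w m = (\<Sum>l\<in>Poly_Mapping.keys m. Poly_Mapping.single (w l) (Poly_Mapping.lookup m l))"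

lemma mon_act_add: "mon_act w (m + n) = mon_act w m + mon_act w n"
  unfolding mon_act_def by (rule setsum_keys_plus_distrib) (auto simp: single_add)

lemma mon_act_0 [simp]: "mon_act w 0 = 0"
  by (simp add: mon_act_def)

lemma mon_act_single [simp]: "mon_act w (Poly_Mapping.single l k) = Poly_Mapping.single (w l) k"
  by (cases "k = 0") (simp_all add: mon_act_def)

lemma mon_act_eq_0:
  assumes "mon_act w m = 0"
  shows "m = 0"
proof (rule poly_mapping_eqI)
  fix l
  show "Poly_Mapping.lookup m l = Poly_Mapping.lookup 0 l"
  proof (cases "l \<in> Poly_Mapping.keys m")
    case True
    have "0 = Poly_Mapping.lookup (mon_act w m) (w l)" using assms by simp
    also have "\<dots> = (\<Sum>k\<in>Poly_Mapping.keys m. Poly_Mapping.lookup m k when w k = w l)"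
      by (simp add: mon_act_def lookup_sum lookup_single)
    finally show ?thesis using True by (auto simp: sum_eq_0_iff)
  qed (simp add: in_keys_iff)
qed

lemma poly_act_mon: "poly_act w p = (\<Sum>m\<in>Poly_Mapping.keys p. Poly_Mapping.single (mon_act w m) (Poly_Mapping.lookup p m))"
  by (simp add: poly_act_def mon_act_def)

lemma poly_act_add: "poly_act w (p + q) = poly_act w p + poly_act w q"
  unfolding poly_act_mon by (rule setsum_keys_plus_distrib) (auto simp: single_add)

lemma poly_act_single [simp]: "poly_act w (Poly_Mapping.single m c) = Poly_Mapping.single (mon_act w m) c"
  by (cases "c = 0") (simp_all add: poly_act_mon)

lemma poly_act_0 [simp]: "poly_act w 0 = 0"
  by (simp add: poly_act_def)

lemma poly_act_sum: "poly_act w (sum g A) = (\<Sum>a\<in>A. poly_act w (g a))"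
  by (induction A rule: infinite_finite_induct) (auto simp: poly_act_add)

lemma poly_act_uminus: "poly_act w (- p) = - poly_act w p"
  using poly_act_add[of w p "- p"] by (simp add: eq_neg_iff_add_eq_0 add.commute)

lemma poly_act_diff: "poly_act w (p - q) = poly_act w p - poly_act w q"
  using poly_act_add[of w p "- q"] by (simp add: poly_act_uminus)

lemma poly_act_mult: "poly_act w (p * q) = poly_act w p * poly_act w q"
proof -
  have "poly_act w (p * q) = (\<Sum>a\<in>Poly_Mapping.keys p. \<Sum>b\<in>Poly_Mapping.keys q. poly_act w
      (Poly_Mapping.single a (Poly_Mapping.lookup p a) * Poly_Mapping.single b (Poly_Mapping.lookup q b)))"
    by (subst single_expansion[of p], subst single_expansion[of q]) (simp only: sum_product poly_act_sum)
  also have "\<dots> = poly_act w p * poly_act w q"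
    by (simp only: poly_act_mon[of w p] poly_act_mon[of w q] sum_product mult_single poly_act_single mon_act_add)
  finally show ?thesis .
qed

lemma poly_act_const [simp]: "poly_act w (poly_const c) = poly_const c"
  by (simp add: poly_const_def)

lemma poly_act_var [simp]: "poly_act w (poly_var v) = poly_var (w v)"
  by (simp add: poly_var_def)

lemma poly_act_1 [simp]: "poly_act w 1 = 1"
  using poly_act_const[of w 1] by (simp add: poly_const_def)

lemma poly_act_power: "poly_act w (p ^ k) = poly_act w p ^ k"
  by (induction k) (auto simp: poly_act_mult)

lemma mon_act_sum: "mon_act w (sum g A) = (\<Sum>a\<in>A. mon_act w (g a))"
  by (induction A rule: infinite_finite_induct) (auto simp: mon_act_add)

lemma mon_act_comp: "mon_act w (mon_act v m) = mon_act (w \<circ> v) m"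
  by (simp add: mon_act_def[of v] mon_act_def[of "w \<circ> v"] mon_act_sum)

lemma poly_act_comp: "poly_act w (poly_act v p) = poly_act (w \<circ> v) p"
  by (simp add: poly_act_mon[of v] poly_act_mon[of "w \<circ> v"] poly_act_sum mon_act_comp)

lemma poly_act_id [simp]: "poly_act id p = p"
proof -
  have "mon_act id m = m" for m :: "'a \<Rightarrow>\<^sub>0 nat"
    by (simp add: mon_act_def flip: single_expansion)
  then show ?thesis by (simp add: poly_act_mon flip: single_expansion)
qed

text \<open>Only the zero monomial is mapped to the zero monomial, so the substitution preserves the augmentation ideal; as it is
  multiplicative it preserves the powers of this ideal.\<close>

lemma poly_act_aug_pow: "p \<in> aug_pow n \<Longrightarrow> poly_act w p \<in> aug_pow n"
proof (induction n arbitrary: p)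
  case (Suc n)
  have aug: "poly_act w q \<in> augmentation_ideal" if "q \<in> augmentation_ideal" for q :: "('a, 'b) mpoly"
  proof -
    have "(\<Sum>m\<in>Poly_Mapping.keys q. (Poly_Mapping.lookup q m when mon_act w m = 0)) = 0"
      using that mon_act_eq_0[of w] by (intro sum.neutral) (auto simp: augmentation_ideal_def when_def)
    then show ?thesis by (simp add: augmentation_ideal_def poly_act_mon lookup_sum lookup_single)
  qed
  from Suc.prems show ?case
  proof (induction rule: aug_pow_Suc_induct)
    case (prod a b)
    then show ?case
      using ideal_prod.prod[OF Suc.IH[OF prod(1)] aug[OF prod(2)], of ring_of_type_algebra]
      by (simp add: poly_act_mult)
  next
    case (sum a b)
    then show ?case using aug_pow_add by (metis poly_act_add)
  qed
qed simp

lemma poly_act_series: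
  "poly_act w (series g p q n) = series g (poly_act w p) (poly_act w q) n"
  by (simp add: series_def poly_act_sum case_prod_unfold poly_act_mult poly_act_power)

lemma poly_act_Cauchy: "Cauchy p \<Longrightarrow> Cauchy (\<lambda>n. poly_act w (p n))"
  using poly_act_aug_pow[of _ _ w] unfolding Cauchy_def by (metis poly_act_diff)

section \<open>The formal group algebra\<close>

text \<open>The generators of the ideal defining the formal group algebra, written with representatives. The closure of the ideal
  \<open>fga_core\<close> that they generate is \<open>fga_ideal\<close>.\<close>

definition fga_gens :: "'r::comm_ring_1 fps fps \<Rightarrow> ('l::ab_group_add, 'r) mpoly_hat set" where
  "fga_gens F = {cl (\<lambda>n. poly_var 0)} \<union> {cl (\<lambda>n. poly_var (l + m) -
     series (\<lambda>i j. fps_nth (fps_nth F i) j) (poly_var l) (poly_var m) n) | l m. True}"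

abbreviation fga_core :: "'r::comm_ring_1 fps fps \<Rightarrow> ('l::ab_group_add, 'r) mpoly_hat set" where
  "fga_core F \<equiv> genideal poly_completion (fga_gens F)"

lemma series_var_Cauchy [simp]: "Cauchy (series g (poly_var l) (poly_var m))"
  by (intro series_Cauchy poly_var_aug)

lemma fga_ideal_core: "fga_ideal F = adic_closure ring_of_type_algebra augmentation_ideal (fga_core F)"
  unfolding fga_ideal_def fga_gens_def formal_sum_cl
  by (simp add: hat_cl poly_completion_minus)

lemma fga_core_ideal:
  "ideal (fga_core F :: ('l::ab_group_add, 'r::comm_ring_1) mpoly_hat set) poly_completion"
proof -
  interpret cring "poly_completion :: ('l, 'r) mpoly_hat ring" by (rule poly_completion_cring)
  show ?thesis
    by (rule genideal_ideal) (auto simp: fga_gens_def poly_completion_simps Cauchy_diff)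
qed

lemma fga_ideal_mem:
  "a \<in> fga_ideal F \<longleftrightarrow> a \<in> carrier poly_completion \<and> (\<forall>n. \<exists>b\<in>fga_core F. b n = a n)"
  by (simp add: fga_ideal_core adic_closure_def poly_completion_def)

lemma fga_core_subset: "fga_core F \<subseteq> fga_ideal F"
proof
  fix a assume "a \<in> fga_core F"
  moreover from this have "a \<in> carrier poly_completion"
    by (rule subsetD[OF additive_subgroup.a_subset[OF ideal.axioms(1)[OF fga_core_ideal]]])
  ultimately show "a \<in> fga_ideal F" by (auto simp: fga_ideal_mem)
qed

lemma fga_ideal_ideal: "ideal (fga_ideal F) (poly_completion :: ('l::ab_group_add, 'r::comm_ring_1) mpoly_hat ring)"
proof -
  interpret cring "poly_completion :: ('l, 'r) mpoly_hat ring" by (rule poly_completion_cring)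
  interpret G: ideal "fga_core F :: ('l, 'r) mpoly_hat set" poly_completion by (rule fga_core_ideal)
  have val: "(a \<oplus>\<^bsub>poly_completion\<^esub> b) n = a n \<oplus>\<^bsub>poly_quot n\<^esub> b n"
    "(a \<otimes>\<^bsub>poly_completion\<^esub> b) n = a n \<otimes>\<^bsub>poly_quot n\<^esub> b n" for a b :: "('l, 'r) mpoly_hat" and n
    by (simp_all add: poly_completion_def adic_completion_def poly_quot_def)
  show ?thesis
  proof (rule idealI)
    show "subgroup (fga_ideal F) (add_monoid (poly_completion :: ('l, 'r) mpoly_hat ring))"
    proof (rule group.subgroupI)
      show "Group.group (add_monoid (poly_completion :: ('l, 'r) mpoly_hat ring))" by (rule add.is_group)
      show "fga_ideal F \<noteq> ({} :: ('l, 'r) mpoly_hat set)" using fga_core_subset G.zero_closed by blast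
      show "inv\<^bsub>add_monoid poly_completion\<^esub> a \<in> fga_ideal F" if a: "a \<in> fga_ideal F"
        for a :: "('l, 'r) mpoly_hat"
      proof -
        have eq: "inv\<^bsub>add_monoid poly_completion\<^esub> a = \<ominus>\<^bsub>poly_completion\<^esub> \<one>\<^bsub>poly_completion\<^esub> \<otimes>\<^bsub>poly_completion\<^esub> a"
        proof -
          have "inv\<^bsub>add_monoid poly_completion\<^esub> a = \<ominus>\<^bsub>poly_completion\<^esub> a" by (simp only: a_inv_def)
          then show ?thesis using a by (simp add: fga_ideal_mem l_minus)
        qed
        have "\<exists>b\<in>fga_core F. b n = (\<ominus>\<^bsub>poly_completion\<^esub> \<one>\<^bsub>poly_completion\<^esub> \<otimes>\<^bsub>poly_completion\<^esub> a) n" for n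
        proof -
          obtain b where "b \<in> fga_core F" "b n = a n" using a by (auto simp: fga_ideal_mem)
          then show ?thesis
            by (intro bexI[of _ "\<ominus>\<^bsub>poly_completion\<^esub> \<one>\<^bsub>poly_completion\<^esub> \<otimes>\<^bsub>poly_completion\<^esub> b"])
              (auto simp: val G.I_l_closed)
        qed
        then show ?thesis unfolding eq using a by (simp add: fga_ideal_mem)
      qed
      show "a \<otimes>\<^bsub>add_monoid poly_completion\<^esub> b \<in> fga_ideal F" if "a \<in> fga_ideal F" "b \<in> fga_ideal F"
        for a b :: "('l, 'r) mpoly_hat"
      proof -
        have "\<exists>c\<in>fga_core F. c n = (a \<oplus>\<^bsub>poly_completion\<^esub> b) n" for n
        proof -
          obtain c d where "c \<in> fga_core F" "c n = a n" "d \<in> fga_core F" "d n = b n"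
            using \<open>a \<in> fga_ideal F\<close> \<open>b \<in> fga_ideal F\<close> unfolding fga_ideal_mem by blast
          then show ?thesis by (intro bexI[of _ "c \<oplus>\<^bsub>poly_completion\<^esub> d"]) (auto simp: val)
        qed
        then show ?thesis using \<open>a \<in> fga_ideal F\<close> \<open>b \<in> fga_ideal F\<close> by (simp add: fga_ideal_mem)
      qed
    qed (auto simp: fga_ideal_mem)
  next
    fix a b :: "('l, 'r) mpoly_hat"
    assume ab: "a \<in> fga_ideal F" "b \<in> carrier poly_completion"
    have "\<exists>c\<in>fga_core F. c n = (b \<otimes>\<^bsub>poly_completion\<^esub> a) n" for n
    proof -
      obtain c where "c \<in> fga_core F" "c n = a n" using ab(1) unfolding fga_ideal_mem by blast
      then show ?thesis using ab(2) by (intro bexI[of _ "b \<otimes>\<^bsub>poly_completion\<^esub> c"]) (auto simp: val G.I_l_closed)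
    qed
    then show "b \<otimes>\<^bsub>poly_completion\<^esub> a \<in> fga_ideal F" using ab by (simp add: fga_ideal_mem)
    have "\<exists>c\<in>fga_core F. c n = (a \<otimes>\<^bsub>poly_completion\<^esub> b) n" for n
    proof -
      obtain c where "c \<in> fga_core F" "c n = a n" using ab(1) unfolding fga_ideal_mem by blast
      then show ?thesis using ab(2) by (intro bexI[of _ "c \<otimes>\<^bsub>poly_completion\<^esub> b"]) (auto simp: val G.I_r_closed)
    qed
    then show "a \<otimes>\<^bsub>poly_completion\<^esub> b \<in> fga_ideal F" using ab by (simp add: fga_ideal_mem)
  qed (rule ring_axioms)
qed

definition proj :: "'r::comm_ring_1 fps fps \<Rightarrow> (nat \<Rightarrow> ('l::ab_group_add, 'r) mpoly) \<Rightarrow> ('l, 'r) fga" where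
  "proj F p = fga_ideal F +>\<^bsub>poly_completion\<^esub> cl p"

lemma FGA_carrier: "carrier (FGA F) = proj F ` Collect Cauchy"
  by (auto simp: FGA_def FactRing_def A_RCOSETS_def' poly_completion_simps proj_def)

lemma FGA_ops:
  fixes F :: "'r::comm_ring_1 fps fps" and p q :: "nat \<Rightarrow> ('l::ab_group_add, 'r) mpoly"
  assumes "Cauchy p" "Cauchy q"
  shows "proj F p \<otimes>\<^bsub>FGA F\<^esub> proj F q = proj F (\<lambda>n. p n * q n)"
    "proj F p \<oplus>\<^bsub>FGA F\<^esub> proj F q = proj F (\<lambda>n. p n + q n)"
proof -
  interpret ideal "fga_ideal F" "poly_completion :: ('l, 'r) mpoly_hat ring" by (rule fga_ideal_ideal)
  have c: "cl p \<in> carrier poly_completion" "cl q \<in> carrier poly_completion"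
    using assms by (auto simp: poly_completion_simps)
  have mult: "monoid.mult (FGA F) = rcoset_mult poly_completion (fga_ideal F)"
    and add: "add (FGA F) = set_add poly_completion"
    by (simp_all add: FGA_def FactRing_def)
  show "proj F p \<otimes>\<^bsub>FGA F\<^esub> proj F q = proj F (\<lambda>n. p n * q n)"
    unfolding mult proj_def rcoset_mult_add[OF c] by (simp only: poly_completion_simps)
  show "proj F p \<oplus>\<^bsub>FGA F\<^esub> proj F q = proj F (\<lambda>n. p n + q n)"
    unfolding add proj_def a_rcos_sum[OF c] by (simp only: poly_completion_simps)
qed

lemma FGA_one: "\<one>\<^bsub>FGA F\<^esub> = proj F (\<lambda>n. 1)"
  by (simp add: FGA_def FactRing_def proj_def poly_completion_simps)

lemma FGA_zero:
  fixes F :: "'r::comm_ring_1 fps fps"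
  shows "\<zero>\<^bsub>FGA F\<^esub> = (proj F (\<lambda>n. 0) :: ('l::ab_group_add, 'r) fga)"
proof -
  interpret ideal "fga_ideal F" "poly_completion :: ('l, 'r) mpoly_hat ring" by (rule fga_ideal_ideal)
  have "fga_ideal F +>\<^bsub>poly_completion\<^esub> \<zero>\<^bsub>poly_completion\<^esub> = (fga_ideal F :: ('l, 'r) mpoly_hat set)"
    by (rule a_rcos_const) (rule additive_subgroup.zero_closed[OF is_additive_subgroup])
  then show ?thesis by (simp add: FGA_def FactRing_def proj_def poly_completion_simps(5))
qed

lemma proj_eq_zero_iff:
  fixes F :: "'r::comm_ring_1 fps fps" and p :: "nat \<Rightarrow> ('l::ab_group_add, 'r) mpoly"
  assumes "Cauchy p"
  shows "proj F p = proj F (\<lambda>n. 0) \<longleftrightarrow> cl p \<in> fga_ideal F"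
proof -
  interpret ideal "fga_ideal F" "poly_completion :: ('l, 'r) mpoly_hat ring" by (rule fga_ideal_ideal)
  have "proj F (\<lambda>n. 0) = (fga_ideal F :: ('l, 'r) mpoly_hat set)"
  proof -
    have "\<zero>\<^bsub>FGA F\<^esub> = (proj F (\<lambda>n. 0) :: ('l, 'r) fga)" by (rule FGA_zero)
    then show ?thesis by (simp add: FGA_def FactRing_def)
  qed
  moreover have "fga_ideal F +>\<^bsub>poly_completion\<^esub> cl p = fga_ideal F \<longleftrightarrow> cl p \<in> fga_ideal F"
  proof
    have "cl p \<in> carrier poly_completion" using assms by (auto simp: poly_completion_simps)
    then have "cl p \<in> fga_ideal F +>\<^bsub>poly_completion\<^esub> cl p" by (rule a_rcos_self)
    then show "cl p \<in> fga_ideal F" if "fga_ideal F +>\<^bsub>poly_completion\<^esub> cl p = fga_ideal F"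
      using that by simp
  qed (rule a_rcos_const)
  ultimately show ?thesis by (simp add: proj_def)
qed

definition hat_act :: "('l \<Rightarrow> 'l) \<Rightarrow> ('l, 'r::comm_ring_1) mpoly_hat \<Rightarrow> ('l, 'r) mpoly_hat" where
  "hat_act w a = (\<lambda>n. poly_act w ` a n)"

lemma bij_comp_inv: "bij w \<Longrightarrow> w \<circ> inv_into UNIV w = id" "bij w \<Longrightarrow> inv_into UNIV w \<circ> w = id"
  by (simp_all add: fun_eq_iff bij_is_surj surj_f_inv_f bij_is_inj)

lemma hat_act_cl:
  assumes "bij w"
  shows "hat_act w (cl p) = cl (\<lambda>n. poly_act w (p n))"
proof -
  have "poly_act w ` hat q n = hat (poly_act w q) n" for q :: "('a, 'b) mpoly" and n
  proof (intro equalityI subsetI)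
    show "s \<in> hat (poly_act w q) n" if s: "s \<in> poly_act w ` hat q n" for s
    proof -
      obtain t where t: "s = poly_act w t" "t \<in> hat q n" using s by blast
      have "poly_act w (t - q) \<in> aug_pow n" by (rule poly_act_aug_pow[OF t(2)[unfolded hat_mem]])
      then show ?thesis by (simp only: hat_mem t(1) poly_act_diff)
    qed
    show "s \<in> poly_act w ` hat q n" if "s \<in> hat (poly_act w q) n" for s
    proof -
      have "poly_act (inv_into UNIV w) (s - poly_act w q) \<in> aug_pow n"
        by (rule poly_act_aug_pow) (use that in \<open>simp only: hat_mem\<close>)
      then have "poly_act (inv_into UNIV w) s \<in> hat q n"
        by (simp only: hat_mem poly_act_diff poly_act_comp bij_comp_inv[OF assms] poly_act_id)
      moreover have "s = poly_act w (poly_act (inv_into UNIV w) s)"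
        using assms by (simp only: poly_act_comp bij_comp_inv[OF assms] poly_act_id)
      ultimately show ?thesis by blast
    qed
  qed
  then show ?thesis by (simp add: hat_act_def cl_def)
qed

text \<open>An automorphism of the lattice permutes the generators, hence preserves the ideal and its closure. This is why it acts
  on the quotient.\<close>

lemma fga_gens_act:
  fixes F :: "'r::comm_ring_1 fps fps" and w :: "'l::ab_group_add \<Rightarrow> 'l"
  assumes "bij w" "Modules.additive w" "a \<in> fga_gens F"
  shows "hat_act w a \<in> fga_gens F"
proof -
  interpret w: Modules.additive w by fact
  from assms(3) consider "a = cl (\<lambda>n. poly_var 0)"
    | l m where "a = cl (\<lambda>n. poly_var (l + m) - series (\<lambda>i j. fps_nth (fps_nth F i) j) (poly_var l) (poly_var m) n)"
    by (auto simp: fga_gens_def)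
  then show ?thesis
  proof cases
    case 1
    then show ?thesis by (simp add: fga_gens_def hat_act_cl assms w.zero)
  next
    case 2
    then have "hat_act w a = cl (\<lambda>n. poly_var (w l + w m) - series (\<lambda>i j. fps_nth (fps_nth F i) j) (poly_var (w l)) (poly_var (w m)) n)"
      by (simp add: hat_act_cl assms poly_act_diff poly_act_series w.add)
    then show ?thesis by (auto simp: fga_gens_def)
  qed
qed

lemma hat_act_hom:
  assumes "bij w"
  shows "ring_hom_ring poly_completion poly_completion (hat_act w :: ('l, 'r::comm_ring_1) mpoly_hat \<Rightarrow> _)"
proof (rule ring_hom_ringI)
  show "ring (poly_completion :: ('l, 'r) mpoly_hat ring)" 
    using poly_completion_cring cring.axioms(1) by blast
  then show "ring (poly_completion :: ('l, 'r) mpoly_hat ring)" .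
qed (auto simp: poly_completion_simps hat_act_cl assms poly_act_Cauchy poly_act_mult poly_act_add)

lemma fga_core_act:
  fixes F :: "'r::comm_ring_1 fps fps" and w :: "'l::ab_group_add \<Rightarrow> 'l"
  assumes "bij w" "Modules.additive w" "a \<in> fga_core F"
  shows "hat_act w a \<in> fga_core F"
proof -
  interpret cring "poly_completion :: ('l, 'r) mpoly_hat ring" by (rule poly_completion_cring)
  interpret h: ring_hom_ring "poly_completion :: ('l, 'r) mpoly_hat ring" poly_completion "hat_act w"
    by (rule hat_act_hom[OF assms(1)])
  have gens: "fga_gens F \<subseteq> carrier poly_completion"
    by (auto simp: fga_gens_def poly_completion_simps Cauchy_diff)
  have "ideal {r \<in> carrier poly_completion. hat_act w r \<in> fga_core F} poly_completion"
    by (rule h.ideal_vimage[OF fga_core_ideal])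
  moreover have "fga_gens F \<subseteq> {r \<in> carrier poly_completion. hat_act w r \<in> fga_core F}"
    using gens fga_gens_act[OF assms(1,2)] genideal_self[OF gens] by auto
  ultimately have "fga_core F \<subseteq> {r \<in> carrier poly_completion. hat_act w r \<in> fga_core F}"
    by (rule genideal_minimal)
  then show ?thesis using assms(3) by auto
qed

lemma fga_ideal_act:
  fixes F :: "'r::comm_ring_1 fps fps" and w :: "'l::ab_group_add \<Rightarrow> 'l"
  assumes "bij w" "Modules.additive w" "a \<in> fga_ideal F"
  shows "hat_act w a \<in> fga_ideal F"
proof -
  interpret h: ring_hom_ring "poly_completion :: ('l, 'r) mpoly_hat ring" poly_completion "hat_act w"
    by (rule hat_act_hom[OF assms(1)])
  have "\<exists>b\<in>fga_core F. b n = hat_act w a n" for n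
  proof -
    obtain b where "b \<in> fga_core F" "b n = a n" using assms(3) by (auto simp: fga_ideal_mem)
    then show ?thesis using fga_core_act[OF assms(1,2)] by (intro bexI[of _ "hat_act w b"]) (auto simp: hat_act_def)
  qed
  then show ?thesis using assms(3) by (simp add: fga_ideal_mem)
qed

lemma additive_inv:
  assumes "bij w" "Modules.additive w"
  shows "Modules.additive (inv_into UNIV w)"
proof
  interpret w: Modules.additive w by fact
  fix a b
  show "inv_into UNIV w (a + b) = inv_into UNIV w a + inv_into UNIV w b"
    using assms(1) by (intro inv_f_eq) (auto simp: w.add bij_is_inj bij_is_surj surj_f_inv_f)
qed

lemma fga_act_proj:
  fixes F :: "'r::comm_ring_1 fps fps" and w :: "'l::ab_group_add \<Rightarrow> 'l"
  assumes "bij w" "Modules.additive w" "Cauchy p"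
  shows "fga_act w (proj F p) = proj F (\<lambda>n. poly_act w (p n))"
proof -
  interpret I: ideal "fga_ideal F" "poly_completion :: ('l, 'r) mpoly_hat ring" by (rule fga_ideal_ideal)
  interpret h: ring_hom_ring "poly_completion :: ('l, 'r) mpoly_hat ring" poly_completion "hat_act w"
    by (rule hat_act_hom[OF assms(1)])
  have cp: "cl p \<in> carrier poly_completion" using assms(3) by (auto simp: poly_completion_simps)
  have surj: "a \<in> hat_act w ` fga_ideal F" if a: "a \<in> fga_ideal F" for a
  proof -
    have "hat_act (inv_into UNIV w) a \<in> fga_ideal F"
      by (rule fga_ideal_act) (use a assms additive_inv bij_imp_bij_inv in auto)
    moreover have "hat_act w (hat_act (inv_into UNIV w) a) = a"
      using assms(1) by (simp add: hat_act_def image_image poly_act_comp bij_comp_inv)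
    ultimately show ?thesis by (metis imageI)
  qed
  have "fga_act w (proj F p) = hat_act w ` (proj F p)"
    by (simp add: fga_act_def hat_act_def)
  also have "\<dots> = (\<lambda>j. hat_act w j \<oplus>\<^bsub>poly_completion\<^esub> hat_act w (cl p)) ` fga_ideal F"
    using cp I.a_Hcarr by (force simp: proj_def a_r_coset_def r_coset_def)
  also have "\<dots> = (\<lambda>j. j \<oplus>\<^bsub>poly_completion\<^esub> hat_act w (cl p)) ` fga_ideal F"
    using surj fga_ideal_act[OF assms(1,2)] by force
  also have "\<dots> = proj F (\<lambda>n. poly_act w (p n))"
    by (auto simp: proj_def a_r_coset_def r_coset_def hat_act_cl assms)
  finally show ?thesis .
qed

lemma fga_gens_core: "fga_gens F \<subseteq> fga_core F"
  by (rule ring.genideal_self[OF cring.axioms(1)[OF poly_completion_cring]])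
    (auto simp: fga_gens_def poly_completion_simps Cauchy_diff)

section \<open>The formal group algebra inside its fraction field\<close>

text \<open>The analysis of the formal group algebra and the combinatorics of the root system are independent of each other. They
  are developed in two locales, which are joined when the twisted algebra is studied.\<close>

locale formal_group_data = demazure F \<iota> Phi cr I al
  for F :: "'r::idom fps fps" and \<iota> :: "('l::ab_group_add, 'r) fga \<Rightarrow> 'k::field"
    and Phi :: "'l set" and cr :: "'l \<Rightarrow> 'l \<Rightarrow> int" and I :: "'i set" and al :: "'i \<Rightarrow> 'l" +
  assumes fgl: "formal_group_law F"
    and frac: "fraction_field (FGA F) \<iota>"
    and x_nonzero: "\<And>l :: 'l. l \<noteq> 0 \<Longrightarrow> fga_var F l \<noteq> \<zero>\<^bsub>FGA F\<^esub>"
begin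

text \<open>The element of the field that a sequence of representatives stands for. With it the quotient by
  \<open>fga_ideal\<close> and the embedding into the field need not be unfolded again.\<close>

definition val :: "(nat \<Rightarrow> ('l, 'r) mpoly) \<Rightarrow> 'k" where "val p = \<iota> (proj F p)"

lemma iota_hom: "\<iota> \<in> ring_hom (FGA F) ring_of_type_algebra"
  and iota_inj: "inj_on \<iota> (carrier (FGA F))"
  and iota_frac: "\<exists>a\<in>carrier (FGA F). \<exists>b\<in>carrier (FGA F). \<iota> b \<noteq> 0 \<and> q = \<iota> a / \<iota> b"
  using frac by (auto simp: fraction_field_def)

lemma val_add: "Cauchy p \<Longrightarrow> Cauchy q \<Longrightarrow> val (\<lambda>n. p n + q n) = val p + val q"
  using ring_hom_add[OF iota_hom, of "proj F p" "proj F q"] by (simp add: FGA_ops FGA_carrier val_def)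

lemma val_mult: "Cauchy p \<Longrightarrow> Cauchy q \<Longrightarrow> val (\<lambda>n. p n * q n) = val p * val q"
  using ring_hom_mult[OF iota_hom, of "proj F p" "proj F q"] by (simp add: FGA_ops FGA_carrier val_def)

lemma val_1 [simp]: "val (\<lambda>n. 1) = 1"
  using ring_hom_one[OF iota_hom] by (simp add: FGA_one val_def)

lemma val_0 [simp]: "val (\<lambda>n. 0) = 0"
proof -
  have "val (\<lambda>n. 0) + val (\<lambda>n. 0) = val (\<lambda>n. 0) + 0"
    using val_add[of "\<lambda>n. 0" "\<lambda>n. 0"] by simp
  then show ?thesis by (rule add_left_imp_eq)
qed

lemma val_uminus: "Cauchy p \<Longrightarrow> val (\<lambda>n. - p n) = - val p"
  using val_add[of p "\<lambda>n. - p n"] by (simp add: Cauchy_uminus eq_neg_iff_add_eq_0 add.commute)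

lemma val_diff: "Cauchy p \<Longrightarrow> Cauchy q \<Longrightarrow> val (\<lambda>n. p n - q n) = val p - val q"
  using val_add[of p "\<lambda>n. - q n"] by (simp add: Cauchy_uminus val_uminus)

lemma val_sum: "(\<And>k. k \<in> A \<Longrightarrow> Cauchy (g k)) \<Longrightarrow> Cauchy (\<lambda>n. \<Sum>k\<in>A. g k n) \<and> val (\<lambda>n. \<Sum>k\<in>A. g k n) = (\<Sum>k\<in>A. val (g k))"
  by (induction A rule: infinite_finite_induct) (auto simp: val_add Cauchy_add)

lemma val_eqI: "\<lbrakk>Cauchy p; Cauchy q; \<And>n. p n - q n \<in> aug_pow n\<rbrakk> \<Longrightarrow> val p = val q"
  using cl_eq_iff[of p q] by (simp add: val_def proj_def)

lemma val_eq_0_iff: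
  assumes "Cauchy p"
  shows "val p = 0 \<longleftrightarrow> cl p \<in> fga_ideal F"
proof -
  have "val p = 0 \<longleftrightarrow> \<iota> (proj F p) = \<iota> (proj F (\<lambda>n. 0))" using val_0 unfolding val_def by simp
  also have "\<dots> \<longleftrightarrow> proj F p = proj F (\<lambda>n. 0)"
    by (rule inj_on_eq_iff[OF iota_inj]) (use assms in \<open>auto simp: FGA_carrier\<close>)
  finally show ?thesis using proj_eq_zero_iff[OF assms, of F] by simp
qed

text \<open>This is where it matters that the ideal has been closed: a series that can be approximated to every order by series
  with value \<open>0\<close> has value \<open>0\<close> itself.\<close>

lemma val_closed:
  assumes p: "Cauchy p" and approx: "\<And>n. \<exists>q. Cauchy q \<and> val q = 0 \<and> p n - q n \<in> aug_pow n"
  shows "val p = 0"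
proof -
  have "\<exists>b\<in>fga_core F. b n = cl p n" for n
  proof -
    obtain q where q: "Cauchy q" "val q = 0" "p n - q n \<in> aug_pow n" using approx by blast
    then obtain b where "b \<in> fga_core F" "b n = cl q n" by (auto simp: val_eq_0_iff fga_ideal_mem)
    moreover have "cl q n = cl p n" using q(3) by (simp add: cl_def hat_eq_iff[THEN iffD2])
    ultimately show ?thesis by auto
  qed
  then show ?thesis using p by (auto simp: val_eq_0_iff fga_ideal_mem poly_completion_simps)
qed

lemma S_eq: "S = val ` Collect Cauchy"
  by (auto simp: S_def FGA_carrier val_def)

lemma val_S [simp]: "Cauchy p \<Longrightarrow> val p \<in> S"
  by (auto simp: S_eq)

lemma S_add: "a \<in> S \<Longrightarrow> b \<in> S \<Longrightarrow> a + b \<in> S"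
  unfolding S_eq by (auto simp flip: val_add intro!: imageI Cauchy_add)

lemma S_mult: "a \<in> S \<Longrightarrow> b \<in> S \<Longrightarrow> a * b \<in> S"
  unfolding S_eq by (auto simp flip: val_mult intro!: imageI Cauchy_mult)

lemma S_uminus: "a \<in> S \<Longrightarrow> - a \<in> S"
  unfolding S_eq by (auto simp flip: val_uminus intro!: imageI Cauchy_uminus)

lemma S_diff: "a \<in> S \<Longrightarrow> b \<in> S \<Longrightarrow> a - b \<in> S"
  using S_add[OF _ S_uminus] by fastforce

lemma S_0 [simp]: "0 \<in> S" and S_1 [simp]: "1 \<in> S"
  using val_S[of "\<lambda>n. 0"] val_S[of "\<lambda>n. 1"] by auto

lemma x_val: "x l = val (\<lambda>n. poly_var l)"
  by (simp add: x_def val_def fga_var_def proj_def hat_cl)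

lemma x_S [simp]: "x l \<in> S"
  by (simp add: x_val)

lemma scalar_val: "scalar r = val (\<lambda>n. poly_const r)"
  by (simp add: scalar_def val_def fga_const_def proj_def hat_cl)

lemma scalar_S [simp]: "scalar r \<in> S"
  by (simp add: scalar_val)

lemma scalar_hom: "scalar (r + s) = scalar r + scalar s" "scalar (r * s) = scalar r * scalar s"
  "scalar 1 = 1" "scalar 0 = 0"
  using val_add[of "\<lambda>n. poly_const r" "\<lambda>n. poly_const s"] val_mult[of "\<lambda>n. poly_const r" "\<lambda>n. poly_const s"]
    val_1 val_0
  by (simp_all add: scalar_val poly_const_def single_add mult_single)

lemma x_eq_0_iff: "x l = 0 \<longleftrightarrow> l = 0"
proof -
  have "cl (\<lambda>n. poly_var 0) \<in> fga_core F"
    using fga_gens_core[of F] by (auto simp: fga_gens_def)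
  then have "x 0 = 0" using fga_core_subset by (auto simp: x_val val_eq_0_iff)
  moreover have "x l \<noteq> 0" if "l \<noteq> 0"
  proof
    assume "x l = 0"
    then have "cl (\<lambda>n. poly_var l) \<in> fga_ideal F" by (simp add: x_val val_eq_0_iff)
    then have "proj F (\<lambda>n. poly_var l) = proj F (\<lambda>n. 0)" by (simp add: proj_eq_zero_iff)
    then show False using x_nonzero[OF that] by (simp add: fga_var_def hat_cl FGA_zero) (simp add: proj_def)
  qed
  ultimately show ?thesis by blast
qed

lemma x_0 [simp]: "x 0 = 0" by (simp add: x_eq_0_iff)

definition cF :: "nat \<Rightarrow> nat \<Rightarrow> 'r" where "cF i j = fps_nth (fps_nth F i) j"

text \<open>The unit laws \<open>F(u, 0) = u = F(0, u)\<close>, read off coefficient by coefficient.\<close>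

lemma F_axis: "cF i 0 = (if i = 1 then 1 else 0)" "cF 0 i = (if i = 1 then 1 else 0)"
proof -
  let ?u = "poly_var var_u :: (uvw, 'r) mpoly"
  have z: "\<zero>\<^bsub>poly_completion\<^esub> = (hat 0 :: (uvw, 'r) mpoly_hat)"
    by (simp add: poly_completion_simps hat_cl)
  have "formal_sum F (hat ?u) (hat 0) = hat ?u" "formal_sum F (hat 0) (hat ?u) = hat ?u"
    using fgl unfolding formal_group_law_def Let_def z by auto
  then have 1: "cl (series cF ?u 0) = cl (\<lambda>n. ?u)" and 2: "cl (series cF 0 ?u) = cl (\<lambda>n. ?u)"
    by (simp_all only: formal_sum_cl cF_def[abs_def]) (simp_all only: hat_cl)
  have pow: "?u ^ k = Poly_Mapping.single (Poly_Mapping.single var_u k) 1" for k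
    by (induction k) (simp_all add: poly_var_def mult_single flip: single_add)
  have s1: "series cF ?u 0 (Suc i) = (\<Sum>k\<le>i. poly_const (cF k 0) * ?u ^ k)"
  proof -
    have "series cF ?u 0 (Suc i) = (\<Sum>(k, j)\<in>(\<lambda>k. (k, 0)) ` {..i}. poly_const (cF k j) * (?u ^ k * 0 ^ j))"
      unfolding series_def by (rule sum.mono_neutral_right) (auto simp: image_iff power_0_left)
    then show ?thesis by (simp add: sum.reindex inj_on_def)
  qed
  have s2: "series cF 0 ?u (Suc i) = (\<Sum>k\<le>i. poly_const (cF 0 k) * ?u ^ k)"
  proof -
    have "series cF 0 ?u (Suc i) = (\<Sum>(j, k)\<in>(\<lambda>k. (0, k)) ` {..i}. poly_const (cF j k) * (0 ^ j * ?u ^ k))"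
      unfolding series_def by (rule sum.mono_neutral_right) (auto simp: image_iff power_0_left)
    then show ?thesis by (simp add: sum.reindex inj_on_def)
  qed
  have lk: "Poly_Mapping.lookup (\<Sum>k\<le>i. poly_const (c k) * ?u ^ k) (Poly_Mapping.single var_u i) = c i" for c
  proof -
    have inj: "Poly_Mapping.single var_u k = Poly_Mapping.single var_u i \<longleftrightarrow> k = i" for k :: nat
      by (metis lookup_single_eq)
    have "Poly_Mapping.lookup (\<Sum>k\<le>i. poly_const (c k) * ?u ^ k) (Poly_Mapping.single var_u i) =
        (\<Sum>k\<le>i. if k = i then c k else 0)"
      unfolding lookup_sum pow
      by (intro sum.cong) (auto simp: poly_const_def mult_single lookup_single when_def inj)
    then show ?thesis by simp
  qed
  have u: "Poly_Mapping.lookup ?u (Poly_Mapping.single var_u i) = (if i = 1 then 1 else 0)"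
  proof -
    have "Poly_Mapping.single var_u (Suc 0) = Poly_Mapping.single var_u i \<longleftrightarrow> i = 1"
      by (metis lookup_single_eq One_nat_def)
    then show ?thesis by (simp add: poly_var_def lookup_single when_def)
  qed
  have "series cF ?u 0 (Suc i) - ?u \<in> aug_pow (Suc i)" "series cF 0 ?u (Suc i) - ?u \<in> aug_pow (Suc i)"
    using 1 2 unfolding cl_eq_iff by blast+
  from this[THEN aug_pow_lookup, of i var_u]
  show "cF i 0 = (if i = 1 then 1 else 0)" "cF 0 i = (if i = 1 then 1 else 0)"
    by (simp_all add: lookup_minus s1 s2 lk u)
qed

text \<open>By the unit laws, \<open>F(u, v) = u + v + u v H(u, v)\<close> with a power series \<open>H\<close>. The formal group
  law enters the theorem through this expansion, the divisibility of \<open>H(u, v) - H(u, v')\<close> by \<open>v - v'\<close> and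
  the invertibility of \<open>1 + u H(u, v)\<close>.\<close>

definition hF :: "nat \<Rightarrow> nat \<Rightarrow> 'r" where "hF i j = cF (Suc i) (Suc j)"

definition H :: "'l \<Rightarrow> 'l \<Rightarrow> 'k" where "H l m = val (series hF (poly_var l) (poly_var m))"

lemma H_S [simp]: "H l m \<in> S"
  by (simp add: H_def)

text \<open>The shift by two in the cutoff is the degree of the factor \<open>p q\<close>.\<close>

lemma series_F:
  "series cF p q (Suc (Suc n)) = p + q + p * q * series hF p q n"
proof -
  define t where "t = (\<lambda>(i, j). poly_const (cF i j) * (p ^ i * q ^ j))"
  let ?T = "\<lambda>n::nat. {(i, j). i + j < n}"
  have c: "poly_const 0 = (0 :: ('c, 'r) mpoly)" "poly_const 1 = (1 :: ('c, 'r) mpoly)"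
    by (simp_all add: poly_const_def)
  have inj: "inj_on (\<lambda>(i, j). (Suc i, Suc j)) A" for A by (auto simp: inj_on_def)
  have "series cF p q (Suc (Suc n)) = sum t (?T (Suc (Suc n)))"
    by (simp add: series_def t_def)
  also have "\<dots> = sum t ({(1, 0), (0, 1)} \<union> (\<lambda>(i, j). (Suc i, Suc j)) ` ?T n)"
  proof (rule sum.mono_neutral_right)
    show "\<forall>k\<in>?T (Suc (Suc n)) - ({(1, 0), (0, 1)} \<union> (\<lambda>(i, j). (Suc i, Suc j)) ` ?T n). t k = 0"
    proof
      fix k assume k: "k \<in> ?T (Suc (Suc n)) - ({(1, 0), (0, 1)} \<union> (\<lambda>(i, j). (Suc i, Suc j)) ` ?T n)"
      obtain i j where ij: "k = (i, j)" by (cases k)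
      have "i = 0 \<or> j = 0"
      proof (rule ccontr)
        assume "\<not> (i = 0 \<or> j = 0)"
        then obtain i' j' where "i = Suc i'" "j = Suc j'" by (metis not0_implies_Suc)
        then show False using k ij by force
      qed
      then show "t k = 0" using k ij F_axis by (auto simp: t_def c)
    qed
  qed auto
  also have "\<dots> = t (1, 0) + t (0, 1) + sum t ((\<lambda>(i, j). (Suc i, Suc j)) ` ?T n)"
    by (subst sum.union_disjoint) auto
  also have "sum t ((\<lambda>(i, j). (Suc i, Suc j)) ` ?T n) = p * q * series hF p q n"
    unfolding sum.reindex[OF inj] by (simp add: series_def sum_distrib_left case_prod_unfold t_def hF_def algebra_simps)
  finally show ?thesis by (simp add: t_def F_axis c)
qed

lemma x_add: "x (l + m) = x l + x m + x l * x m * H l m"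
proof -
  let ?p = "poly_var l :: ('l, 'r) mpoly" and ?q = "poly_var m :: ('l, 'r) mpoly"
  have "cl (\<lambda>n. poly_var (l + m) - series cF ?p ?q n) \<in> fga_core F"
    using fga_gens_core[of F] by (auto simp: fga_gens_def cF_def[abs_def])
  then have "val (\<lambda>n. poly_var (l + m) - series cF ?p ?q n) = 0"
    using fga_core_subset by (auto simp: val_eq_0_iff Cauchy_diff)
  then have "x (l + m) = val (series cF ?p ?q)" by (simp add: val_diff x_val)
  also have "\<dots> = val (\<lambda>n. (?p + ?q) + (?p * ?q) * series hF ?p ?q n)"
  proof (rule val_eqI)
    show "series cF ?p ?q n - (?p + ?q + ?p * ?q * series hF ?p ?q n) \<in> aug_pow n" for n
      using aug_pow_uminus[OF Cauchy_diff_le[of "series cF ?p ?q" n "Suc (Suc n)"]] by (simp add: series_F)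
  qed (intro Cauchy_add Cauchy_mult Cauchy_const series_var_Cauchy)+
  also have "\<dots> = x l + x m + x l * x m * H l m"
    using val_add[of "\<lambda>n. ?p" "\<lambda>n. ?q"] val_mult[of "\<lambda>n. ?p" "\<lambda>n. ?q"]
    by (simp add: val_add val_mult Cauchy_mult x_val H_def)
  finally show ?thesis .
qed

text \<open>Term by term, \<open>v\<^sup>j - v'\<^sup>j\<close> is divisible by \<open>v - v'\<close>. This divisibility is the
  reason why the elements \<open>\<kappa>\<close> have no denominators.\<close>

lemma H_diff: "\<exists>g\<in>S. H l m - H l m' = (x m - x m') * g"
proof -
  let ?p = "poly_var l :: ('l, 'r) mpoly" and ?q = "poly_var m :: ('l, 'r) mpoly" and ?q' = "poly_var m' :: ('l, 'r) mpoly"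
  define g where "g n = (\<Sum>(i, j)\<in>{(i, j). i + j < n}. poly_const (hF i j) * (?p ^ i * (\<Sum>k<j. ?q ^ k * ?q' ^ (j - Suc k))))" for n
  \<comment> \<open>division by a linear form lowers the degree by one, hence the shifted index\<close>
  let ?g = "\<lambda>n. g (Suc n)"
  have eq: "series hF ?p ?q n - series hF ?p ?q' n = (?q - ?q') * g n" for n
  proof -
    have "?q ^ j - ?q' ^ j = (?q - ?q') * (\<Sum>k<j. ?q ^ k * ?q' ^ (j - Suc k))" for j
      by (subst power_diff_sumr2) (simp add: mult.commute)
    moreover have "c * (r * s) - c * (r * t) = d * (c * (r * e))" if "s - t = d * e" for c r s t d e :: "('l, 'r) mpoly"
    proof -
      have "c * (r * s) - c * (r * t) = c * (r * (s - t))" by (simp add: right_diff_distrib)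
      then show ?thesis by (simp only: that mult.left_commute)
    qed
    ultimately have "poly_const (hF i j) * (?p ^ i * ?q ^ j) - poly_const (hF i j) * (?p ^ i * ?q' ^ j) =
        (?q - ?q') * (poly_const (hF i j) * (?p ^ i * (\<Sum>k<j. ?q ^ k * ?q' ^ (j - Suc k))))" for i j
      by blast
    then show ?thesis
      by (simp add: series_def g_def sum_distrib_left case_prod_unfold flip: sum_subtractf)
  qed
  have C: "Cauchy ?g"
    unfolding Cauchy_def
  proof
    fix n
    have "{(i, j). i + j < Suc (Suc n)} = {(i, j). i + j < Suc n} \<union> {(i, j). i + j = Suc n}" by auto
    moreover have "finite {(i, j). i + j = Suc n}" by (rule finite_subset[OF _ finite_triangle[of "Suc (Suc n)"]]) auto
    ultimately have "?g (Suc n) - ?g n =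
        (\<Sum>(i, j)\<in>{(i, j). i + j = Suc n}. poly_const (hF i j) * (?p ^ i * (\<Sum>k<j. ?q ^ k * ?q' ^ (j - Suc k))))"
      unfolding g_def by (subst (1) \<open>{(i, j). i + j < Suc (Suc n)} = _\<close>) (simp add: sum.union_disjoint disjoint_iff)
    also have "\<dots> \<in> aug_pow n"
    proof (rule aug_pow_sum, clarify)
      fix i j assume "i + j = Suc n"
      have "?p ^ i * (\<Sum>k<j. ?q ^ k * ?q' ^ (j - Suc k)) \<in> aug_pow n"
        unfolding sum_distrib_left
      proof (rule aug_pow_sum)
        fix k assume "k \<in> {..<j}"
        then have "n = i + (k + (j - Suc k))" using \<open>i + j = Suc n\<close> by simp
        then show "?p ^ i * (?q ^ k * ?q' ^ (j - Suc k)) \<in> aug_pow n"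
          using aug_pow_mult_add[OF aug_pow_power aug_pow_mult_add[OF aug_pow_power aug_pow_power]] poly_var_aug by metis
      qed
      then show "poly_const (hF i j) * (?p ^ i * (\<Sum>k<j. ?q ^ k * ?q' ^ (j - Suc k))) \<in> aug_pow n"
        by (rule aug_pow_mult)
    qed
    finally show "?g (Suc n) - ?g n \<in> aug_pow n" .
  qed
  have "H l m - H l m' = val (\<lambda>n. series hF ?p ?q n - series hF ?p ?q' n)"
    by (simp add: H_def val_diff)
  also have "\<dots> = val (\<lambda>n. (?q - ?q') * ?g n)"
  proof (rule val_eqI)
    fix n
    have "(series hF ?p ?q (Suc n) - series hF ?p ?q' (Suc n)) - (series hF ?p ?q n - series hF ?p ?q' n) \<in> aug_pow n"
    proof -
      have "Cauchy (\<lambda>n. series hF ?p ?q n - series hF ?p ?q' n)" by (intro Cauchy_diff series_var_Cauchy)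
      then show ?thesis unfolding Cauchy_def by (rule spec)
    qed
    then show "series hF ?p ?q n - series hF ?p ?q' n - (?q - ?q') * ?g n \<in> aug_pow n"
      using aug_pow_uminus by (force simp: eq)
  qed (use C in \<open>auto intro!: Cauchy_diff Cauchy_mult\<close>)
  also have "\<dots> = (x m - x m') * val ?g"
    using C by (simp add: val_mult Cauchy_diff val_diff x_val)
  finally show ?thesis using C by (intro bexI[of _ "val ?g"]) auto
qed

definition S_unit :: "'k \<Rightarrow> bool" where "S_unit a \<longleftrightarrow> a \<in> S \<and> a \<noteq> 0 \<and> inverse a \<in> S"

text \<open>The geometric series in \<open>- x\<^sub>l H\<close> converges, since \<open>x\<^sub>l\<close> lies in the
  augmentation ideal.\<close>

lemma S_unit_H: "S_unit (1 + x l * H l m)"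
proof -
  define p where "p n = - (poly_var l * series hF (poly_var l) (poly_var m) n)" for n
  have p: "Cauchy p" unfolding p_def by (intro Cauchy_uminus Cauchy_mult Cauchy_const series_var_Cauchy)
  have p1: "p n \<in> aug_pow (Suc 0)" for n
    unfolding p_def by (intro aug_pow_uminus aug_pow_mult_right poly_var_aug)
  define s where "s n = (\<Sum>k<n. p n ^ k)" for n
  have s: "Cauchy s" unfolding Cauchy_def
  proof
    fix n
    have "s (Suc n) - s n = p (Suc n) ^ n + (\<Sum>k<n. p (Suc n) ^ k - p n ^ k)"
      by (simp add: s_def sum_subtractf)
    also have "\<dots> \<in> aug_pow n"
    proof (intro aug_pow_add aug_pow_power p1 aug_pow_sum)
      fix k
      have "p (Suc n) - p n \<in> aug_pow n" using p by (simp add: Cauchy_def)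
      then show "p (Suc n) ^ k - p n ^ k \<in> aug_pow n"
        unfolding power_diff_sumr2 by (rule aug_pow_mult_right)
    qed
    finally show "s (Suc n) - s n \<in> aug_pow n" .
  qed
  have "val (\<lambda>n. (1 - p n) * s n) = val (\<lambda>n. 1)"
  proof (rule val_eqI)
    fix n
    have "(1 - p n) * s n = 1 - p n ^ n"
      unfolding s_def by (simp add: one_diff_power_eq)
    then show "(1 - p n) * s n - 1 \<in> aug_pow n" using aug_pow_uminus[OF aug_pow_power[OF p1, of n n]] by simp
  qed (use p s in \<open>auto intro!: Cauchy_mult Cauchy_diff\<close>)
  then have "(1 - val p) * val s = 1"
    using p s by (simp add: val_mult Cauchy_diff val_diff)
  moreover have "val p = - (x l * H l m)"
    unfolding p_def by (simp add: val_uminus val_mult Cauchy_mult x_val H_def)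
  ultimately have 1: "(1 + x l * H l m) * val s = 1" by simp
  then have "inverse (1 + x l * H l m) = val s" by (rule inverse_unique)
  then show ?thesis using 1 s by (auto simp: S_unit_def S_add S_mult)
qed

lemma S_unit_cancel: "S_unit u \<Longrightarrow> a * u \<in> S \<Longrightarrow> a \<in> S"
  using S_mult[of "a * u" "inverse u"] by (simp add: S_unit_def mult.assoc)

subsection \<open>The action of lattice automorphisms\<close>

definition lattice_aut :: "('l \<Rightarrow> 'l) \<Rightarrow> bool" where "lattice_aut w \<longleftrightarrow> bij w \<and> Modules.additive w"

lemma fga_act_val: "lattice_aut w \<Longrightarrow> Cauchy p \<Longrightarrow> \<iota> (fga_act w (proj F p)) = val (\<lambda>n. poly_act w (p n))"
  by (simp add: lattice_aut_def fga_act_proj val_def)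

lemma lattice_aut_inv: "lattice_aut w \<Longrightarrow> lattice_aut (inv_into UNIV w)"
  by (simp add: lattice_aut_def bij_imp_bij_inv additive_inv)

lemma val_act_eq_0_iff:
  assumes "lattice_aut w" "Cauchy p"
  shows "val (\<lambda>n. poly_act w (p n)) = 0 \<longleftrightarrow> val p = 0"
proof -
  have imp: "val (\<lambda>n. poly_act w (p n)) = 0" if "lattice_aut w" "Cauchy p" "val p = 0" for w p
  proof -
    have "cl p \<in> fga_ideal F" using that by (simp add: val_eq_0_iff)
    then have "hat_act w (cl p) \<in> fga_ideal F" using that by (intro fga_ideal_act) (auto simp: lattice_aut_def)
    then show ?thesis using that by (simp add: val_eq_0_iff poly_act_Cauchy hat_act_cl lattice_aut_def)
  qed
  have "poly_act (inv_into UNIV w) (poly_act w q) = q" for q :: "('l, 'r) mpoly"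
    using assms(1) by (simp only: poly_act_comp bij_comp_inv lattice_aut_def poly_act_id)
  then show ?thesis using imp[OF assms] imp[OF lattice_aut_inv[OF assms(1)] poly_act_Cauchy[OF assms(2), of w]] by auto
qed

text \<open>The action on fractions does not depend on the chosen numerator and denominator, because a series has value
  \<open>0\<close> exactly if its transform has.\<close>

lemma act_frac:
  assumes w: "lattice_aut w" and p: "Cauchy p" and q: "Cauchy q" "val q \<noteq> 0"
  shows "act w (val p / val q) = val (\<lambda>n. poly_act w (p n)) / val (\<lambda>n. poly_act w (q n))"
  unfolding act_def
proof (rule the_equality)
  show "\<exists>a\<in>carrier (FGA F). \<exists>b\<in>carrier (FGA F). \<iota> b \<noteq> 0 \<and> val p / val q = \<iota> a / \<iota> b \<and>
      val (\<lambda>n. poly_act w (p n)) / val (\<lambda>n. poly_act w (q n)) = \<iota> (fga_act w a) / \<iota> (fga_act w b)"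
    by (rule bexI[of _ "proj F p"], rule bexI[of _ "proj F q"])
      (use assms in \<open>auto simp: FGA_carrier fga_act_val simp flip: val_def\<close>)
next
  fix r
  assume "\<exists>a\<in>carrier (FGA F). \<exists>b\<in>carrier (FGA F). \<iota> b \<noteq> 0 \<and> val p / val q = \<iota> a / \<iota> b \<and>
      r = \<iota> (fga_act w a) / \<iota> (fga_act w b)"
  then obtain a b where ab: "Cauchy a" "Cauchy b" "val b \<noteq> 0" "val p / val q = val a / val b"
    "r = val (\<lambda>n. poly_act w (a n)) / val (\<lambda>n. poly_act w (b n))"
    using w by (auto simp: FGA_carrier fga_act_val simp flip: val_def)
  have "val p * val b - val a * val q = 0" using ab q by (simp add: field_simps)
  then have "val (\<lambda>n. p n * b n - a n * q n) = 0"
    using p q ab by (simp add: val_diff val_mult Cauchy_mult)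
  then have "val (\<lambda>n. poly_act w (p n * b n - a n * q n)) = 0"
    using p q ab w by (simp add: val_act_eq_0_iff Cauchy_diff Cauchy_mult)
  then have "val (\<lambda>n. poly_act w (p n)) * val (\<lambda>n. poly_act w (b n)) = val (\<lambda>n. poly_act w (a n)) * val (\<lambda>n. poly_act w (q n))"
    using p q ab by (simp add: poly_act_diff poly_act_mult val_diff val_mult Cauchy_mult poly_act_Cauchy)
  moreover have "val (\<lambda>n. poly_act w (b n)) \<noteq> 0" "val (\<lambda>n. poly_act w (q n)) \<noteq> 0"
    using w q ab by (auto simp: val_act_eq_0_iff)
  ultimately show "r = val (\<lambda>n. poly_act w (p n)) / val (\<lambda>n. poly_act w (q n))"
    by (simp add: ab(5) field_simps)
qed

lemma act_val: "lattice_aut w \<Longrightarrow> Cauchy p \<Longrightarrow> act w (val p) = val (\<lambda>n. poly_act w (p n))"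
  using act_frac[of w p "\<lambda>n. 1"] by simp

lemma fraction_cases: obtains p q where "Cauchy p" "Cauchy q" "val q \<noteq> 0" "a = val p / val q"
  using iota_frac[of a] by (auto simp: FGA_carrier simp flip: val_def)

lemma act_hom:
  assumes w: "lattice_aut w"
  shows "act w (a + b) = act w a + act w b" "act w (a * b) = act w a * act w b"
proof -
  obtain p q where a: "Cauchy p" "Cauchy q" "val q \<noteq> 0" "a = val p / val q" by (rule fraction_cases)
  obtain r s where b: "Cauchy r" "Cauchy s" "val s \<noteq> 0" "b = val r / val s" by (rule fraction_cases)
  have nz: "val (\<lambda>n. poly_act w (q n)) \<noteq> 0" "val (\<lambda>n. poly_act w (s n)) \<noteq> 0"
    using a b w by (auto simp: val_act_eq_0_iff)
  have s: "a + b = val (\<lambda>n. p n * s n + r n * q n) / val (\<lambda>n. q n * s n)"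
    unfolding a(4) b(4) using a(1-3) b(1-3) by (simp add: val_add val_mult Cauchy_mult add_frac_eq)
  have m: "a * b = val (\<lambda>n. p n * r n) / val (\<lambda>n. q n * s n)"
    using a b by (simp add: val_mult)
  have C: "Cauchy (\<lambda>n. q n * s n)" "val (\<lambda>n. q n * s n) \<noteq> 0" using a b by (auto simp: Cauchy_mult val_mult)
  note pa = poly_act_Cauchy[OF a(1), of w] poly_act_Cauchy[OF a(2), of w]
    poly_act_Cauchy[OF b(1), of w] poly_act_Cauchy[OF b(2), of w]
  have aw: "act w a = val (\<lambda>n. poly_act w (p n)) / val (\<lambda>n. poly_act w (q n))"
    unfolding a(4) by (rule act_frac[OF w a(1-3)])
  have bw: "act w b = val (\<lambda>n. poly_act w (r n)) / val (\<lambda>n. poly_act w (s n))"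
    unfolding b(4) by (rule act_frac[OF w b(1-3)])
  have "act w (a + b) = val (\<lambda>n. poly_act w (p n * s n + r n * q n)) / val (\<lambda>n. poly_act w (q n * s n))"
    unfolding s by (rule act_frac[OF w _ C]) (intro Cauchy_add Cauchy_mult a b)
  then show "act w (a + b) = act w a + act w b"
    unfolding aw bw using pa nz
    by (simp add: poly_act_add poly_act_mult val_add val_mult Cauchy_mult add_frac_eq)
  have "act w (a * b) = val (\<lambda>n. poly_act w (p n * r n)) / val (\<lambda>n. poly_act w (q n * s n))"
    unfolding m by (rule act_frac[OF w _ C]) (intro Cauchy_add Cauchy_mult a b)
  then show "act w (a * b) = act w a * act w b"
    unfolding aw bw using pa nz by (simp add: poly_act_mult val_mult)
qed

lemma act_0: "lattice_aut w \<Longrightarrow> act w 0 = 0" and act_1: "lattice_aut w \<Longrightarrow> act w 1 = 1"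
  using act_val[of w "\<lambda>n. 0"] act_val[of w "\<lambda>n. 1"] by auto

lemma act_x: "lattice_aut w \<Longrightarrow> act w (x l) = x (w l)"
  by (simp add: x_val act_val)

lemma act_scalar: "lattice_aut w \<Longrightarrow> act w (scalar r) = scalar r"
  by (simp add: scalar_val act_val)

lemma act_S: "lattice_aut w \<Longrightarrow> a \<in> S \<Longrightarrow> act w a \<in> S"
  by (auto simp: S_eq act_val poly_act_Cauchy)

lemma lattice_aut_id: "lattice_aut id"
  by (simp add: lattice_aut_def Modules.additive_def)

lemma lattice_aut_comp: "lattice_aut v \<Longrightarrow> lattice_aut w \<Longrightarrow> lattice_aut (v \<circ> w)"
  by (simp add: lattice_aut_def Modules.additive_def bij_comp)

lemma act_id: "act id a = a"
proof -
  obtain p q where "Cauchy p" "Cauchy q" "val q \<noteq> 0" "a = val p / val q" by (rule fraction_cases)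
  then show ?thesis by (simp add: act_frac lattice_aut_id)
qed

lemma act_comp:
  assumes "lattice_aut v" "lattice_aut w"
  shows "act v (act w a) = act (v \<circ> w) a"
proof -
  obtain p q where pq: "Cauchy p" "Cauchy q" "val q \<noteq> 0" "a = val p / val q" by (rule fraction_cases)
  moreover have "val (\<lambda>n. poly_act w (q n)) \<noteq> 0" using pq assms by (simp add: val_act_eq_0_iff)
  ultimately show ?thesis using assms by (simp add: act_frac lattice_aut_comp poly_act_Cauchy poly_act_comp)
qed


subsection \<open>Divided differences\<close>

text \<open>Adding \<open>a\<close> once changes \<open>x\<^sub>m\<close> by \<open>x\<^sub>a (1 + x\<^sub>m H)\<close>; the rest
  is telescoping. For \<open>n < 0\<close> the roles of the two arguments are exchanged.\<close>

lemma x_diff_multiple: "\<exists>g\<in>S. x (l + zsmul n a) - x l = x a * g"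
proof -
  have step: "\<exists>g\<in>S. x (m + a) - x m = x a * g" for m
  proof -
    have "x (m + a) - x m = x a * (1 + x m * H m a)" unfolding x_add[of m a] by (simp add: algebra_simps)
    then show ?thesis by (blast intro: S_add S_mult S_1 x_S H_S)
  qed
  have nat: "\<exists>g\<in>S. x (m + zsmul (int k) a) - x m = x a * g" for m k
  proof (induction k)
    case 0
    then show ?case by (auto simp: zsmul_def intro!: bexI[of _ 0])
  next
    case (Suc k)
    obtain g where g: "g \<in> S" "x (m + zsmul (int k) a) - x m = x a * g" using Suc by blast
    have eq: "m + zsmul (int (Suc k)) a = (m + zsmul (int k) a) + a"
      using zsmul_add[of "int k" 1 a] by (simp add: algebra_simps)
    obtain h where h: "h \<in> S" "x (m + zsmul (int k) a + a) - x (m + zsmul (int k) a) = x a * h" using step by blast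
    show ?case unfolding eq using g h by (intro bexI[of _ "g + h"]) (auto simp: S_add algebra_simps)
  qed
  show ?thesis
  proof (cases "n \<ge> 0")
    case True
    then show ?thesis using nat[of l "nat n"] by simp
  next
    case False
    then have "zsmul n a = - zsmul (int (nat (- n))) a" by (simp add: zsmul_def)
    then have eq: "(l + zsmul n a) + zsmul (int (nat (- n))) a = l" by simp
    obtain g where "g \<in> S" "x l - x (l + zsmul n a) = x a * g"
      using nat[of "l + zsmul n a" "nat (- n)"] unfolding eq by blast
    then show ?thesis by (intro bexI[of _ "- g"]) (auto simp: S_uminus algebra_simps)
  qed
qed

text \<open>The series represented by \<open>r\<close> has order at least \<open>k\<close>: its representatives vanish modulo the
  \<open>n\<close>-th power for all \<open>n \<le> k\<close>.\<close>

definition small :: "nat \<Rightarrow> (nat \<Rightarrow> ('l, 'r) mpoly) \<Rightarrow> bool" where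
  "small k r \<longleftrightarrow> Cauchy r \<and> (\<forall>n\<le>k. r n \<in> aug_pow n)"

lemma poly_induct [case_names const var add mult]:
  fixes p :: "('v, 'r) mpoly"
  assumes "\<And>c. P (poly_const c)" "\<And>v. P (poly_var v)" "\<And>p q. P p \<Longrightarrow> P q \<Longrightarrow> P (p + q)"
    "\<And>p q. P p \<Longrightarrow> P q \<Longrightarrow> P (p * q)"
  shows "P p"
proof -
  have c1: "poly_const 1 = (1 :: ('v, 'r) mpoly)" "poly_const 0 = (0 :: ('v, 'r) mpoly)"
    by (simp_all add: poly_const_def)
  have pow: "P (Poly_Mapping.single (Poly_Mapping.single v k) 1)" for v k
  proof (induction k)
    case 0
    then show ?case using assms(1)[of 1] by (simp add: poly_const_def)
  next
    case (Suc k)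
    have "Poly_Mapping.single (Poly_Mapping.single v (Suc k)) 1 =
        poly_var v * (Poly_Mapping.single (Poly_Mapping.single v k) 1 :: ('v, 'r) mpoly)"
      by (simp add: poly_var_def mult_single flip: single_add)
    then show ?case using assms(4)[OF assms(2) Suc] by simp
  qed
  have mon: "P (Poly_Mapping.single m 1)" for m
  proof -
    have "P (Poly_Mapping.single (\<Sum>v\<in>A. Poly_Mapping.single v (Poly_Mapping.lookup m v)) 1)" for A
    proof (induction A rule: infinite_finite_induct)
      case (insert v A)
      then show ?case using assms(4)[OF pow insert.IH] by (simp add: mult_single)
    qed (use assms(1)[of 1] in \<open>simp_all add: poly_const_def\<close>)
    from this[of "Poly_Mapping.keys m"] show ?thesis by (simp flip: single_expansion)
  qed
  have "P (Poly_Mapping.single m c)" for m c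
    using assms(4)[OF assms(1) mon, of c m] by (simp add: poly_const_def mult_single)
  then have "P (\<Sum>m\<in>A. Poly_Mapping.single m (Poly_Mapping.lookup p m))" for A
    by (induction A rule: infinite_finite_induct) (use assms(1)[of 0] in \<open>auto simp: c1 intro: assms(3)\<close>)
  from this[of "Poly_Mapping.keys p"] show ?thesis by (simp flip: single_expansion)
qed

lemma small_add: "small k r \<Longrightarrow> small k s \<Longrightarrow> small k (\<lambda>n. r n + s n)"
  by (auto simp: small_def Cauchy_add aug_pow_add)

lemma small_mult:
  assumes "small k r" "q \<in> aug_pow j"
  shows "small (k + j) (\<lambda>n. r n * q)"
  unfolding small_def
proof (intro conjI allI impI)
  show "Cauchy (\<lambda>n. r n * q)" using assms by (auto simp: small_def intro: Cauchy_mult)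
  fix n assume n: "n \<le> k + j"
  show "r n * q \<in> aug_pow n"
  proof (cases "n \<le> k")
    case True
    then show ?thesis using assms by (auto simp: small_def intro: aug_pow_mult_right)
  next
    case False
    have "r n - r k \<in> aug_pow k" using False assms by (intro Cauchy_diff_le) (auto simp: small_def)
    then have "r n \<in> aug_pow k" using assms(1) aug_pow_add[of "r n - r k" k "r k"] by (simp add: small_def)
    then have "r n * q \<in> aug_pow (k + j)" by (rule aug_pow_mult_add[OF _ assms(2)])
    then show ?thesis using aug_pow_mono[OF n] by blast
  qed
qed

text \<open>The map \<open>p \<mapsto> p - s(p)\<close> is a twisted derivation, so divisibility by \<open>x\<^sub>a\<close>
  passes from the variables to all polynomials. The quotient of a polynomial of order \<open>n\<close> has order at least \<open>n -
  1\<close>; without this bound the quotients of the terms of a series could not be summed.\<close>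

lemma poly_divided_difference:
  assumes a: "\<And>l. \<exists>g\<in>S. x l - x (s l) = x a * g" and p: "p \<in> aug_pow n"
  shows "\<exists>r. small (n - 1) r \<and> val (\<lambda>n. p) - val (\<lambda>n. poly_act s p) = x a * val r"
proof -
  have prod_diff: "\<exists>t. small (i + j) t \<and> val (\<lambda>n. p * q) - val (\<lambda>n. poly_act s (p * q)) = x a * val t"
    if r: "small i r" "val (\<lambda>n. p) - val (\<lambda>n. poly_act s p) = x a * val r" and q: "q \<in> aug_pow j"
      and u: "small k u" "val (\<lambda>n. q) - val (\<lambda>n. poly_act s q) = x a * val u" and p: "p \<in> aug_pow m" and "k + m = i + j"
    for p q r u i j k m
  proof -
    have sp: "poly_act s p \<in> aug_pow m" using p by (rule poly_act_aug_pow)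
    have sm: "small (i + j) (\<lambda>n. r n * q)" "small (i + j) (\<lambda>n. u n * poly_act s p)"
      using small_mult[OF r(1) q] small_mult[OF u(1) sp] \<open>k + m = i + j\<close> by auto
    have cc: "Cauchy r" "Cauchy u" using r u by (auto simp: small_def)
    have e: "val (\<lambda>n. p * q) = val (\<lambda>n. p) * val (\<lambda>n. q)"
      "val (\<lambda>n. poly_act s (p * q)) = val (\<lambda>n. poly_act s p) * val (\<lambda>n. poly_act s q)"
      "val (\<lambda>n. r n * q + u n * poly_act s p) = val r * val (\<lambda>n. q) + val u * val (\<lambda>n. poly_act s p)"
      using cc by (simp_all add: val_mult val_add poly_act_mult Cauchy_mult)
    have "val (\<lambda>n. p) * val (\<lambda>n. q) - val (\<lambda>n. poly_act s p) * val (\<lambda>n. poly_act s q) =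
        (val (\<lambda>n. p) - val (\<lambda>n. poly_act s p)) * val (\<lambda>n. q) + (val (\<lambda>n. q) - val (\<lambda>n. poly_act s q)) * val (\<lambda>n. poly_act s p)"
      by (simp add: algebra_simps)
    then have "val (\<lambda>n. p * q) - val (\<lambda>n. poly_act s (p * q)) = x a * val (\<lambda>n. r n * q + u n * poly_act s p)"
      unfolding e r(2) u(2) by (simp add: algebra_simps)
    then show ?thesis using small_add[OF sm] by blast
  qed
  have sum_diff: "\<exists>t. small i t \<and> val (\<lambda>n. p + q) - val (\<lambda>n. poly_act s (p + q)) = x a * val t"
    if r: "small i r" "val (\<lambda>n. p) - val (\<lambda>n. poly_act s p) = x a * val r"
      and u: "small i u" "val (\<lambda>n. q) - val (\<lambda>n. poly_act s q) = x a * val u" for p q r u i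
  proof -
    have e: "val (\<lambda>n. p + q) = val (\<lambda>n. p) + val (\<lambda>n. q)"
      "val (\<lambda>n. poly_act s (p + q)) = val (\<lambda>n. poly_act s p) + val (\<lambda>n. poly_act s q)"
      "val (\<lambda>n. r n + u n) = val r + val u"
      using r u by (simp_all add: val_add poly_act_add small_def)
    have "val (\<lambda>n. p + q) - val (\<lambda>n. poly_act s (p + q)) = x a * val (\<lambda>n. r n + u n)"
      using r(2) u(2) unfolding e by (simp add: algebra_simps)
    then show ?thesis using small_add[OF r(1) u(1)] by blast
  qed
  have base: "\<exists>r. small 0 r \<and> val (\<lambda>n. p) - val (\<lambda>n. poly_act s p) = x a * val r" for p
  proof (induction p rule: poly_induct)
    case (const c)
    then show ?case by (intro exI[of _ "\<lambda>n. 0"]) (simp add: small_def)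
  next
    case (var v)
    then show ?case using a[of v] by (auto simp: small_def x_val S_eq)
  next
    case (add p q)
    then show ?case using sum_diff by blast
  next
    case (mult p q)
    then show ?case using prod_diff[of 0 _ p q 0 0 _ 0] by auto
  qed
  show ?thesis using p
  proof (induction n arbitrary: p)
    case 0
    then show ?case using base by simp
  next
    case (Suc n)
    from Suc.prems show ?case
    proof (induction rule: aug_pow_Suc_induct)
      case (prod p q)
      obtain u where u: "small 0 u" "val (\<lambda>n. q) - val (\<lambda>n. poly_act s q) = x a * val u" using base by blast
      obtain r where r: "small (n - 1) r" "val (\<lambda>n. p) - val (\<lambda>n. poly_act s p) = x a * val r" using Suc.IH prod by blast
      have q1: "q \<in> aug_pow (Suc 0)" using prod(2) by (simp only: aug_pow_1)
      show ?case
      proof (cases n)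
        case 0
        then show ?thesis using base by simp
      next
        case (Suc m)
        then show ?thesis using prod_diff[OF r q1 u prod(1)] by simp
      qed
    next
      case (sum p q)
      then show ?case using sum_diff by blast
    qed
  qed
qed

text \<open>A series is the sum of the differences of consecutive representatives. Their quotients \<open>r k\<close> have order
  at least \<open>k\<close>, so the diagonal of their partial sums represents a series \<open>R\<close>; that \<open>R\<close> is
  the quotient holds to every order, and therefore holds since the ideal is closed.\<close>

lemma divided_difference:
  assumes a: "\<And>l. \<exists>g\<in>S. x l - x (s l) = x a * g" and s: "lattice_aut s" and q: "q \<in> S"
  shows "\<exists>g\<in>S. q - act s q = x a * g"
proof -
  obtain p where p: "Cauchy p" "q = val p" using q by (auto simp: S_eq)
  have "\<exists>r. small k r \<and> val (\<lambda>n. p (Suc (Suc k)) - p (Suc k)) - val (\<lambda>n. poly_act s (p (Suc (Suc k)) - p (Suc k))) = x a * val r" for k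
  proof -
    have "p (Suc (Suc k)) - p (Suc k) \<in> aug_pow (Suc k)" using p unfolding Cauchy_def by blast
    from poly_divided_difference[OF a this] show ?thesis by simp
  qed
  then obtain r where r: "\<And>k. small k (r k)"
    "\<And>k. val (\<lambda>n. p (Suc (Suc k)) - p (Suc k)) - val (\<lambda>n. poly_act s (p (Suc (Suc k)) - p (Suc k))) = x a * val (r k)"
    by metis
  obtain r0 where r0: "Cauchy r0" "val (\<lambda>n. p 1) - val (\<lambda>n. poly_act s (p 1)) = x a * val r0"
    using poly_divided_difference[OF a aug_pow_0, of "p 1"] by (auto simp: small_def)
  have rC: "Cauchy (r k)" for k using r(1) by (simp add: small_def)
  define t where "t N n = r0 n + (\<Sum>k<N. r k n)" for N n
  have tC: "Cauchy (t N)" for N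
    unfolding t_def using val_sum[of "{..<N}" r] rC r0 by (auto intro: Cauchy_add)
  have tv: "val (\<lambda>n. p (Suc N)) - val (\<lambda>n. poly_act s (p (Suc N))) = x a * val (t N)" for N
  proof (induction N)
    case 0
    then show ?case using r0 by (simp add: t_def)
  next
    case (Suc N)
    have "t (Suc N) = (\<lambda>n. t N n + r N n)" by (simp add: t_def fun_eq_iff add.assoc)
    then have "val (t (Suc N)) = val (\<lambda>n. t N n + r N n)" by simp
    also have "\<dots> = val (t N) + val (r N)" using tC rC by (simp add: val_add)
    finally show ?case using Suc r(2)[of N] by (simp add: poly_act_diff val_diff algebra_simps)
  qed
  define R where "R n = t n n" for n
  have RC: "Cauchy R"
    unfolding Cauchy_def
  proof
    fix n
    have "R (Suc n) - R n = (t n (Suc n) - t n n) + r n (Suc n)"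
      by (simp add: R_def t_def)
    moreover have "t n (Suc n) - t n n \<in> aug_pow n" using tC by (simp add: Cauchy_def)
    moreover have "r n (Suc n) \<in> aug_pow n"
      using aug_pow_add[of "r n (Suc n) - r n n" n "r n n"] r(1)[of n] by (simp add: small_def Cauchy_def)
    ultimately show "R (Suc n) - R n \<in> aug_pow n" by (simp add: aug_pow_add)
  qed
  let ?s = "poly_act s" and ?a = "poly_var a :: ('l, 'r) mpoly"
  have sp: "Cauchy (\<lambda>n. ?s (p n))" using p(1) by (rule poly_act_Cauchy)
  have "val (\<lambda>n. p n - ?s (p n) - ?a * R n) = 0"
  proof (rule val_closed)
    show "Cauchy (\<lambda>n. p n - ?s (p n) - ?a * R n)" using p RC sp by (intro Cauchy_diff Cauchy_mult Cauchy_const)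
    fix n
    let ?q = "\<lambda>k. p (Suc n) - ?s (p (Suc n)) - ?a * t n k"
    have "Cauchy ?q" using tC by (intro Cauchy_diff Cauchy_mult Cauchy_const)
    moreover have "val ?q = 0" using tC tv[of n] by (simp add: val_diff val_mult Cauchy_diff Cauchy_mult x_val)
    moreover have "p n - ?s (p n) - ?a * R n - ?q n \<in> aug_pow n"
    proof -
      have d: "p (Suc n) - p n \<in> aug_pow n" using p by (simp add: Cauchy_def)
      have "?s (p (Suc n) - p n) - (p (Suc n) - p n) \<in> aug_pow n"
        by (rule aug_pow_diff[OF poly_act_aug_pow[OF d] d])
      then show ?thesis by (simp add: R_def poly_act_diff algebra_simps)
    qed
    ultimately show "\<exists>q. Cauchy q \<and> val q = 0 \<and> p n - ?s (p n) - ?a * R n - q n \<in> aug_pow n" by blast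
  qed
  then have "q - act s q = x a * val R"
    using p sp RC s by (simp add: act_val val_diff val_mult Cauchy_diff Cauchy_mult x_val)
  then show ?thesis using RC by (intro bexI[of _ "val R"]) auto
qed

end

section \<open>Simple roots, lengths and words\<close>

locale simple_root_datum = demazure F \<iota> Phi cr I al
  for F :: "'r::idom fps fps" and \<iota> :: "('l::ab_group_add, 'r) fga \<Rightarrow> 'k::field"
    and Phi :: "'l set" and cr :: "'l \<Rightarrow> 'l \<Rightarrow> int" and I :: "'i set" and al :: "'i \<Rightarrow> 'l" +
  assumes lattice: "\<exists>B :: 'l set. finite B \<and> z_basis B"
    and roots: "reduced_root_datum Phi cr"
    and simple: "simple_roots Phi I al"
begin

abbreviation refl :: "'l \<Rightarrow> 'l \<Rightarrow> 'l" where "refl \<equiv> reflection cr"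

lemma torsion_free:
  assumes "zsmul n (a :: 'l) = 0" "n \<noteq> 0"
  shows "a = 0"
proof -
  obtain B :: "'l set" where B: "finite B" "\<not> zmod.dependent B" "zmod.span B = UNIV"
    using lattice by (auto simp: z_basis_def)
  have "a \<in> zmod.span B" using B by simp
  then obtain r where r: "a = (\<Sum>b\<in>B. zsmul (r b) b)" unfolding zmod.span_finite[OF B(1)] by auto
  then have "(\<Sum>b\<in>B. zsmul (n * r b) b) = 0"
    using assms(1) by (simp add: zsmul_sum_right zsmul_assoc)
  moreover have "\<forall>u. (\<Sum>b\<in>B. zsmul (u b) b) = 0 \<longrightarrow> (\<forall>b\<in>B. u b = 0)"
    using B(2) unfolding zmod.dependent_finite[OF B(1)] by metis
  ultimately have "\<forall>b\<in>B. n * r b = 0" by (elim allE[of _ "\<lambda>b. n * r b"]) (erule mp)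
  then show ?thesis using assms(2) r by simp
qed

lemma finite_Phi: "finite Phi"
  and cr_additive: "a \<in> Phi \<Longrightarrow> Modules.additive (cr a)"
  and cr_self: "a \<in> Phi \<Longrightarrow> cr a a = 2"
  and refl_Phi: "a \<in> Phi \<Longrightarrow> b \<in> Phi \<Longrightarrow> refl a b \<in> Phi"
  and corefl: "a \<in> Phi \<Longrightarrow> b \<in> Phi \<Longrightarrow> (\<lambda>l. cr b l - cr b a * cr a l) \<in> cr ` Phi"
  and reduced: "a \<in> Phi \<Longrightarrow> a + a \<notin> Phi"
  using roots unfolding reduced_root_datum_def by blast+

lemma cr_simps:
  assumes "a \<in> Phi"
  shows "cr a (l + m) = cr a l + cr a m" "cr a (l - m) = cr a l - cr a m" "cr a (- l) = - cr a l"
    "cr a 0 = 0" "cr a (zsmul n l) = n * cr a l" "cr a (sum g A) = (\<Sum>k\<in>A. cr a (g k))"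
  using additive.add[OF cr_additive[OF assms]] additive.diff[OF cr_additive[OF assms]]
    additive.minus[OF cr_additive[OF assms]] additive.zero[OF cr_additive[OF assms]]
    additive_int_zsmul[OF cr_additive[OF assms]] additive.sum[OF cr_additive[OF assms]] by auto

lemma refl_additive: "a \<in> Phi \<Longrightarrow> Modules.additive (refl a)"
  by standard (simp add: reflection_def cr_simps zsmul_add)

lemma refl_simps:
  assumes "a \<in> Phi"
  shows "refl a (l + m) = refl a l + refl a m" "refl a (l - m) = refl a l - refl a m" "refl a (- l) = - refl a l"
    "refl a 0 = 0" "refl a (zsmul n l) = zsmul n (refl a l)"
  using additive.add[OF refl_additive[OF assms]] additive.diff[OF refl_additive[OF assms]]
    additive.minus[OF refl_additive[OF assms]] additive.zero[OF refl_additive[OF assms]]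
    zsmul_additive[OF refl_additive[OF assms]] by auto

lemma refl_invol: "a \<in> Phi \<Longrightarrow> refl a (refl a l) = l"
proof -
  assume a: "a \<in> Phi"
  have "cr a (l - zsmul (cr a l) a) = - cr a l" by (simp add: cr_simps[OF a] cr_self[OF a])
  then show ?thesis by (simp add: reflection_def zsmul_minus_left)
qed

lemma refl_self: "a \<in> Phi \<Longrightarrow> refl a a = - a"
  using zsmul_add[of 1 1 a] by (simp add: reflection_def cr_self)

lemma uminus_Phi: "a \<in> Phi \<Longrightarrow> - a \<in> Phi"
  using refl_Phi[of a a] refl_self by simp

lemma Phi_nonzero: "a \<in> Phi \<Longrightarrow> a \<noteq> 0"
  using cr_self[of a] cr_simps(4)[of a] by auto

lemma zsmul_eq_0_iff: "zsmul n (a :: 'l) = 0 \<longleftrightarrow> n = 0 \<or> a = 0"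
  using torsion_free by auto

text \<open>A unipotent translation that preserves the finite set of roots is trivial.\<close>

lemma no_infinite_string:
  assumes "b \<in> Phi" "\<And>c. c \<in> Phi \<Longrightarrow> t c \<in> Phi" "\<And>n::nat. t (b + zsmul (int n) v) = b + zsmul (int (Suc n)) v"
  shows "v = 0"
proof (rule ccontr)
  assume "v \<noteq> 0"
  have "b + zsmul (int n) v \<in> Phi" for n
    by (induction n) (use assms(1,2) in \<open>auto simp del: of_nat_Suc simp flip: assms(3)\<close>)
  then have "range (\<lambda>n::nat. b + zsmul (int n) v) \<subseteq> Phi" by auto
  moreover have "inj (\<lambda>n::nat. b + zsmul (int n) v)"
  proof (rule injI)
    fix m n :: nat assume "b + zsmul (int m) v = b + zsmul (int n) v"
    then have "zsmul (int m - int n) v = 0" by (simp add: zsmul_diff_left)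
    then show "m = n" using \<open>v \<noteq> 0\<close> by (simp add: zsmul_eq_0_iff)
  qed
  ultimately show False using finite_Phi by (meson finite_subset finite_imageD infinite_UNIV_nat)
qed

text \<open>The coroot of a reflected root is the reflected coroot: otherwise two different roots would have reflections with the
  same linear form, and the product of their reflections would be a nontrivial unipotent transformation preserving the
  roots.\<close>

lemma coroot_reflection:
  assumes a: "a \<in> Phi" and b: "b \<in> Phi"
  shows "cr (refl a b) l = cr b (refl a l)"
proof -
  obtain c where c: "c \<in> Phi" "cr c = (\<lambda>l. cr b l - cr b a * cr a l)" using corefl[OF a b] by (elim imageE) simp
  define d where "d = refl a b"
  have crc: "cr c l = cr b (refl a l)" for l
    using b by (simp add: c reflection_def cr_simps algebra_simps)
  have d: "d \<in> Phi" "cr c d = 2" using a b by (simp_all add: d_def refl_Phi crc refl_invol cr_self)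
  define t where "t l = refl c (refl a (refl b (refl a l)))" for l
  have conj: "refl a (refl b (refl a l)) = l - zsmul (cr c l) d" for l
    unfolding reflection_def[of cr b] using a by (simp add: refl_simps refl_invol crc d_def)
  have tl: "t l = l + zsmul (cr c l) (c - d)" for l
  proof -
    have "zsmul 2 c = c + c" using zsmul_add[of 1 1 c] by simp
    then have rd: "refl c d = d - (c + c)" unfolding reflection_def d(2) by simp
    show ?thesis unfolding t_def conj refl_simps[OF c(1)] rd
      by (simp add: reflection_def zsmul_right zsmul_diff_right algebra_simps)
  qed
  have t: "t (c + zsmul (int n) (zsmul 2 (c - d))) = c + zsmul (int (Suc n)) (zsmul 2 (c - d))" for n
  proof -
    have "cr c (c + zsmul (int n) (zsmul 2 (c - d))) = 2"
      using c(1) d cr_self[OF c(1)] by (simp add: cr_simps)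
    then show ?thesis unfolding tl by (simp add: zsmul_add add_ac)
  qed
  have "zsmul 2 (c - d) = 0"
    by (rule no_infinite_string[OF c(1) _ t]) (use a b c in \<open>auto simp: t_def refl_Phi\<close>)
  then have "c = d" using torsion_free[of 2 "c - d"] by simp
  then show ?thesis using crc by (simp add: d_def)
qed

lemma refl_conj: "a \<in> Phi \<Longrightarrow> b \<in> Phi \<Longrightarrow> refl (refl a b) = refl a \<circ> refl b \<circ> refl a"
  by (rule ext, simp, subst (1 2) reflection_def, simp add: coroot_reflection refl_simps refl_invol)

subsection \<open>The Weyl group\<close>

lemma W_props:
  assumes "w \<in> W"
  shows "bij w \<and> Modules.additive w \<and> w ` Phi \<subseteq> Phi \<and> (\<forall>b\<in>Phi. refl (w b) \<circ> w = w \<circ> refl b)"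
  using assms
proof induction
  case id_W
  then show ?case by (simp add: Modules.additive_def bij_id[unfolded id_def])
next
  case (refl_W a w)
  have "bij (refl a)"
    by (rule o_bij[of "refl a"]) (use refl_W in \<open>auto simp: fun_eq_iff refl_invol\<close>)
  moreover have "refl ((refl a \<circ> w) b) \<circ> (refl a \<circ> w) = (refl a \<circ> w) \<circ> refl b" if "b \<in> Phi" for b
  proof -
    have "w b \<in> Phi" using refl_W that by auto
    then have "refl ((refl a \<circ> w) b) \<circ> (refl a \<circ> w) = refl a \<circ> (refl (w b) \<circ> w)"
      using refl_W by (simp add: refl_conj fun_eq_iff refl_invol)
    also have "refl (w b) \<circ> w = w \<circ> refl b" using refl_W that by blast
    finally show ?thesis by (simp only: o_assoc)
  qed
  moreover have "Modules.additive (refl a \<circ> w)"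
    using refl_W refl_additive[of a] by (simp add: Modules.additive_def)
  moreover have "(refl a \<circ> w) ` Phi \<subseteq> Phi" using refl_W by (auto simp: refl_Phi)
  ultimately show ?case using refl_W bij_comp by blast
qed

lemma W_bij: "w \<in> W \<Longrightarrow> bij w" and W_additive: "w \<in> W \<Longrightarrow> Modules.additive w"
  and W_Phi: "w \<in> W \<Longrightarrow> b \<in> Phi \<Longrightarrow> w b \<in> Phi"
  and W_refl: "w \<in> W \<Longrightarrow> b \<in> Phi \<Longrightarrow> refl (w b) \<circ> w = w \<circ> refl b"
  using W_props by blast+

lemma refl_in_W: "a \<in> Phi \<Longrightarrow> refl a \<in> W"
  using W.refl_W[OF _ W.id_W] by simp

lemma W_comp: "v \<in> W \<Longrightarrow> w \<in> W \<Longrightarrow> v \<circ> w \<in> W"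
  by (induction rule: W.induct) (auto simp: o_assoc[symmetric] intro: W.refl_W)

lemma W_inv: "w \<in> W \<Longrightarrow> inv_into UNIV w \<in> W"
proof (induction rule: W.induct)
  case (refl_W a w)
  have "inv_into UNIV (refl a \<circ> w) = inv_into UNIV w \<circ> inv_into UNIV (refl a)"
    using refl_W by (intro o_inv_distrib W_bij refl_in_W)
  moreover have "inv_into UNIV (refl a) = refl a"
    using refl_W by (intro inv_unique_comp) (auto simp: fun_eq_iff refl_invol)
  ultimately show ?case using refl_W refl_in_W W_comp by metis
qed (metis W.id_W inv_id)

lemma W_simps:
  assumes "w \<in> W"
  shows "w (l + m) = w l + w m" "w (l - m) = w l - w m" "w (- l) = - w l" "w 0 = 0"
    "w (zsmul n l) = zsmul n (w l)" "w (sum g A) = (\<Sum>k\<in>A. w (g k))"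
  using additive.add[OF W_additive[OF assms]] additive.diff[OF W_additive[OF assms]]
    additive.minus[OF W_additive[OF assms]] additive.zero[OF W_additive[OF assms]]
    zsmul_additive[OF W_additive[OF assms]] additive.sum[OF W_additive[OF assms]] by auto

subsection \<open>Positive roots\<close>

definition comb :: "('i \<Rightarrow> int) \<Rightarrow> 'l" where "comb c = (\<Sum>i\<in>I. zsmul (c i) (al i))"

definition pos :: "'l \<Rightarrow> bool" where "pos b \<longleftrightarrow> b \<in> Phi \<and> (\<exists>c. (\<forall>i\<in>I. c i \<ge> 0) \<and> b = comb c)"

lemma al_Phi [simp]: "i \<in> I \<Longrightarrow> al i \<in> Phi" and inj_al: "inj_on al I"
  using simple by (auto simp: simple_roots_def)

lemma finite_I: "finite I"
  using inj_al finite_Phi al_Phi by (meson finite_imageD finite_subset image_subsetI)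

lemma comb_add: "comb (\<lambda>i. c i + d i) = comb c + comb d"
  and comb_diff: "comb (\<lambda>i. c i - d i) = comb c - comb d"
  and comb_uminus: "comb (\<lambda>i. - c i) = - comb c"
  by (simp_all add: comb_def zsmul_add zsmul_diff_left zsmul_minus_left sum.distrib sum_subtractf sum_negf)

lemma comb_zsmul: "comb (\<lambda>i. n * c i) = zsmul n (comb c)"
  by (simp add: comb_def zsmul_sum_right zsmul_assoc)

lemma comb_single: "i \<in> I \<Longrightarrow> comb (\<lambda>k. if k = i then n else 0) = zsmul n (al i)"
  by (simp add: comb_def finite_I if_distrib[of "\<lambda>n. zsmul n _"] sum.delta cong: if_cong)

lemma comb_eq_0:
  assumes "comb c = 0" "i \<in> I"
  shows "c i = 0"
proof (rule ccontr)
  assume "c i \<noteq> 0"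
  let ?u = "\<lambda>b. c (inv_into I al b)"
  have "(\<Sum>b\<in>al ` I. zsmul (?u b) b) = comb c"
    using inj_al by (simp add: sum.reindex comb_def)
  then have "zmod.dependent (al ` I)"
    using assms \<open>c i \<noteq> 0\<close> inj_al finite_I
    by (subst zmod.dependent_finite) (auto intro!: exI[of _ ?u] bexI[of _ i])
  then show False using simple by (simp add: simple_roots_def)
qed

lemma comb_eq_iff: "comb c = comb d \<longleftrightarrow> (\<forall>i\<in>I. c i = d i)"
  using comb_eq_0[of "\<lambda>i. c i - d i"] by (auto simp: comb_diff) (simp add: comb_def)

lemma root_cases: "b \<in> Phi \<Longrightarrow> pos b \<or> pos (- b)"
proof -
  assume b: "b \<in> Phi"
  then obtain c :: "'i \<Rightarrow> nat" where "b = comb (\<lambda>i. int (c i)) \<or> b = - comb (\<lambda>i. int (c i))"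
    using simple unfolding simple_roots_def comb_def by blast
  then show ?thesis using b uminus_Phi unfolding pos_def
    by (metis minus_minus of_nat_0_le_iff)
qed

lemma pos_not_neg: "pos b \<Longrightarrow> \<not> pos (- b)"
proof
  assume "pos b" "pos (- b)"
  then obtain c d where c: "\<forall>i\<in>I. c i \<ge> 0" "b = comb c" and d: "\<forall>i\<in>I. d i \<ge> 0" "- b = comb d" and b: "b \<in> Phi"
    by (auto simp: pos_def)
  then have "comb (\<lambda>i. c i + d i) = 0" by (simp add: comb_add flip: c(2) d(2))
  then have "c i + d i = 0" if "i \<in> I" for i using comb_eq_0 that by auto
  then have "c i = 0" if "i \<in> I" for i using c d that by (metis add_nonneg_eq_0_iff)
  then have "b = 0" by (simp add: c(2) comb_def)
  then show False using b Phi_nonzero by auto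
qed

lemma pos_al [simp]: "i \<in> I \<Longrightarrow> pos (al i)"
  unfolding pos_def using comb_single[of i 1] by (intro conjI exI[of _ "\<lambda>k. if k = i then 1 else 0"]) auto

lemma pos_coeff:
  assumes "comb c \<in> Phi" "k \<in> I" "c k > 0"
  shows "pos (comb c)"
proof (rule ccontr)
  assume "\<not> pos (comb c)"
  then have "pos (- comb c)" using assms root_cases by blast
  then obtain d where "\<forall>i\<in>I. d i \<ge> 0" "comb (\<lambda>i. - c i) = comb d" by (auto simp: pos_def comb_uminus)
  then show False using assms by (force simp: comb_eq_iff)
qed

lemma refl_comb: "i \<in> I \<Longrightarrow> refl (al i) (comb c) = comb (\<lambda>k. c k - (if k = i then cr (al i) (comb c) else 0))"
  by (simp add: comb_diff comb_single reflection_def)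

text \<open>The reflection changes the coefficient of \<open>al i\<close> only. A positive root other than \<open>al i\<close> has
  another positive coefficient, because the root system is reduced, and a root with one positive coefficient is positive.\<close>

lemma refl_pos:
  assumes i: "i \<in> I" and b: "pos b" "b \<noteq> al i"
  shows "pos (refl (al i) b)"
proof -
  obtain c where c: "\<forall>k\<in>I. c k \<ge> 0" "b = comb c" "b \<in> Phi" using b by (auto simp: pos_def)
  have "\<exists>k\<in>I. k \<noteq> i \<and> c k > 0"
  proof (rule ccontr)
    assume "\<not> (\<exists>k\<in>I. k \<noteq> i \<and> c k > 0)"
    then have "comb c = comb (\<lambda>k. if k = i then c i else 0)" using c(1) by (subst comb_eq_iff) force
    then have bi: "b = zsmul (c i) (al i)" using i c(2) by (simp add: comb_single)
    have "c i * cr b (al i) = 2" using cr_self[OF c(3)] cr_simps(5)[OF c(3), of "c i" "al i"] bi by simp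
    then have "c i dvd 2" by (metis dvd_triv_left)
    then have "c i = 1 \<or> c i = 2"
      using c(1) i zdvd_imp_le[of "c i" 2] by (cases "c i = 0") force+
    then show False
    proof
      assume "c i = 2"
      then have "b = al i + al i" using bi zsmul_add[of 1 1 "al i"] by simp
      then show False using reduced[of "al i"] c(3) i by auto
    qed (use bi b in auto)
  qed
  then obtain k where "k \<in> I" "k \<noteq> i" "c k > 0" by blast
  then show ?thesis
    unfolding c(2) refl_comb[OF i]
    by (intro pos_coeff[of _ k]) (use refl_Phi[of "al i" b] i c in \<open>auto simp flip: refl_comb\<close>)
qed

subsection \<open>An invariant form\<close>

text \<open>The canonical \<open>W\<close>-invariant form. Its positivity bounds the Cartan integers and drives the induction on
  the height of a root.\<close>

definition form :: "'l \<Rightarrow> 'l \<Rightarrow> int" where "form l m = (\<Sum>g\<in>Phi. cr g l * cr g m)"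

lemma form_simps:
  "form (l + l') m = form l m + form l' m" "form l (m + m') = form l m + form l m'"
  "form (l - l') m = form l m - form l' m" "form l (m - m') = form l m - form l m'"
  "form (zsmul n l) m = n * form l m" "form l (zsmul n m) = n * form l m"
  "form (- l) m = - form l m" "form l (- m) = - form l m" 
  by (simp_all add: form_def cr_simps distrib_left distrib_right left_diff_distrib right_diff_distrib
      sum.distrib sum_subtractf sum_negf sum_distrib_left ac_simps)

lemma form_comb: "form (comb c) m = (\<Sum>i\<in>I. c i * form (al i) m)"
proof -
  have "form (sum g A) m = (\<Sum>k\<in>A. form (g k) m)" for g :: "'i \<Rightarrow> 'l" and A
    by (induction A rule: infinite_finite_induct) (simp_all add: form_simps, simp_all add: form_def cr_simps)
  then show ?thesis by (simp add: comb_def form_simps)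
qed

lemma form_commute: "form l m = form m l"
  by (simp add: form_def mult.commute)

lemma form_refl:
  assumes "a \<in> Phi"
  shows "form (refl a l) (refl a m) = form l m"
proof -
  have "bij_betw (refl a) Phi Phi"
    by (rule bij_betwI[of _ _ _ "refl a"]) (use assms in \<open>auto simp: refl_Phi refl_invol\<close>)
  then have "form l m = (\<Sum>g\<in>Phi. cr (refl a g) l * cr (refl a g) m)"
    unfolding form_def by (rule sum.reindex_bij_betw[symmetric])
  also have "\<dots> = form (refl a l) (refl a m)"
    unfolding form_def using assms by (intro sum.cong) (auto simp: coroot_reflection)
  finally show ?thesis by simp
qed

lemma form_cr:
  assumes "a \<in> Phi"
  shows "2 * form a m = cr a m * form a a"
proof -
  have "form a m = form (- a) (m - zsmul (cr a m) a)"
    using form_refl[OF assms, of a m] assms by (simp add: refl_self) (simp add: reflection_def)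
  then show ?thesis by (simp add: form_simps)
qed

lemma form_nonneg: "form l l \<ge> 0"
  unfolding form_def by (rule sum_nonneg) simp

lemma form_pos:
  assumes "a \<in> Phi"
  shows "form a a > 0"
proof -
  have "cr a a * cr a a \<le> form a a"
    unfolding form_def by (rule member_le_sum) (use assms finite_Phi in auto)
  then show ?thesis using assms by (simp add: cr_self)
qed

subsection \<open>Words\<close>

definition wd :: "'i list \<Rightarrow> 'l \<Rightarrow> 'l" where "wd ks = foldr (\<lambda>k w. refl (al k) \<circ> w) ks id"

lemma wd_simps [simp]: "wd [] = id" "wd (k # ks) = refl (al k) \<circ> wd ks"
  by (simp_all add: wd_def)

lemma wd_append: "wd (js @ ks) = wd js \<circ> wd ks"
  by (induction js) auto

lemma wd_W: "set ks \<subseteq> I \<Longrightarrow> wd ks \<in> W"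
  by (induction ks) (auto intro: W.intros)

lemma refl_refl_comp: "a \<in> Phi \<Longrightarrow> refl a \<circ> (refl a \<circ> w) = w"
  by (simp add: fun_eq_iff refl_invol)

lemma inv_refl_comp:
  assumes "a \<in> Phi" "w \<in> W"
  shows "inv_into UNIV (refl a \<circ> w) = inv_into UNIV w \<circ> refl a"
proof -
  have "inv_into UNIV (refl a) = refl a"
    using assms by (intro inv_unique_comp) (auto simp: fun_eq_iff refl_invol)
  then show ?thesis using assms by (simp add: o_inv_distrib W_bij refl_in_W)
qed

text \<open>The exchange condition. Following the root \<open>b\<close> through the word, there is a letter \<open>k\<close> at
  which it turns negative. A simple reflection makes only its own root negative, so \<open>b\<close> has become \<open>al k\<close>
  at that point and the reflection in \<open>b\<close> deletes this letter.\<close>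

lemma exchange:
  assumes "set ks \<subseteq> I" "pos b" "\<not> pos (inv_into UNIV (wd ks) b)"
  shows "\<exists>us k vs. ks = us @ k # vs \<and> refl b \<circ> wd ks = wd (us @ vs)"
  using assms
proof (induction ks arbitrary: b)
  case Nil
  then show ?case by simp
next
  case (Cons k ks)
  have k: "k \<in> I" and b: "b \<in> Phi" using Cons.prems by (auto simp: pos_def)
  show ?case
  proof (cases "b = al k")
    case True
    then have "refl b \<circ> wd (k # ks) = wd ks" using k by (simp add: refl_refl_comp)
    then show ?thesis by (metis append_Nil)
  next
    case False
    have eq: "inv_into UNIV (wd (k # ks)) b = inv_into UNIV (wd ks) (refl (al k) b)"
      using Cons.prems k by (simp add: inv_refl_comp wd_W)
    have "\<exists>us j vs. ks = us @ j # vs \<and> refl (refl (al k) b) \<circ> wd ks = wd (us @ vs)"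
    proof (rule Cons.IH)
      show "pos (refl (al k) b)" by (rule refl_pos[OF k Cons.prems(2) False])
      show "\<not> pos (inv_into UNIV (wd ks) (refl (al k) b))" using Cons.prems(3) unfolding eq .
    qed (use Cons.prems(1) in simp)
    then obtain us j vs where "ks = us @ j # vs" "refl (refl (al k) b) \<circ> wd ks = wd (us @ vs)" by blast
    moreover have "refl b \<circ> wd (k # ks) = refl (al k) \<circ> (refl (refl (al k) b) \<circ> wd ks)"
      using k b by (simp add: refl_conj fun_eq_iff refl_invol)
    ultimately have "k # ks = (k # us) @ j # vs \<and> refl b \<circ> wd (k # ks) = wd ((k # us) @ vs)" by simp
    then show ?thesis by blast
  qed
qed

text \<open>Every positive root is conjugate to a simple one, by induction on the height: as the form is positive on
  \<open>b\<close>, some simple root has a positive product with \<open>b\<close>, and reflecting in it lowers the height.\<close>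

lemma root_conj_simple:
  assumes "pos b"
  shows "\<exists>ks k. set ks \<subseteq> I \<and> k \<in> I \<and> b = wd ks (al k)"
proof -
  obtain c where c: "\<forall>i\<in>I. c i \<ge> 0" "b = comb c" using assms by (auto simp: pos_def)
  have main: "\<forall>b c. pos b \<and> (\<forall>i\<in>I. c i \<ge> 0) \<and> b = comb c \<and> nat (sum c I) = h \<longrightarrow>
      (\<exists>ks k. set ks \<subseteq> I \<and> k \<in> I \<and> b = wd ks (al k))" for h
  proof (induction h rule: less_induct)
    case (less h)
    show ?case
    proof (intro allI impI, elim conjE)
      fix b c assume b: "pos b" and c: "\<forall>i\<in>I. c i \<ge> 0" "b = comb c" and h: "nat (sum c I) = h"
      have bP: "b \<in> Phi" using b by (simp add: pos_def)
      show "\<exists>ks k. set ks \<subseteq> I \<and> k \<in> I \<and> b = wd ks (al k)"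
      proof (cases "b \<in> al ` I")
        case True
        then obtain k where "k \<in> I" "b = al k" by blast
        then show ?thesis by (intro exI[of _ "[]"] exI[of _ k]) simp
      next
        case False
        have "form b b = (\<Sum>i\<in>I. c i * form (al i) b)"
          using form_comb[of c b] by (simp only: c(2)[symmetric])
        moreover have "(\<Sum>i\<in>I. c i * form (al i) b) \<le> 0" if "\<forall>i\<in>I. c i * form (al i) b \<le> 0"
          using that by (intro sum_nonpos) blast
        ultimately obtain i where i: "i \<in> I" "c i * form (al i) b > 0"
          using form_pos[OF bP] by fastforce
        moreover have "c i \<ge> 0" using c(1) i(1) by blast
        ultimately have f: "form (al i) b > 0" by (auto simp: zero_less_mult_iff)
        have n: "cr (al i) b > 0"
        proof (rule ccontr)
          assume "\<not> cr (al i) b > 0"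
          then have "cr (al i) b * form (al i) (al i) \<le> 0"
            using form_nonneg[of "al i"] by (intro mult_nonpos_nonneg) auto
          then show False using f form_cr[of "al i" b] i(1) by simp
        qed
        let ?d = "\<lambda>k. c k - (if k = i then cr (al i) b else 0)"
        have b': "pos (refl (al i) b)" using refl_pos[OF i(1) b] False i(1) by blast
        have eq: "refl (al i) b = comb ?d" using refl_comb[OF i(1), of c] unfolding c(2)[symmetric] .
        have d: "\<forall>k\<in>I. ?d k \<ge> 0"
        proof -
          obtain e where "\<forall>k\<in>I. e k \<ge> 0" "comb ?d = comb e" using b' eq by (auto simp: pos_def)
          then show ?thesis by (simp add: comb_eq_iff)
        qed
        have "sum ?d I = sum c I - cr (al i) b"
          using i(1) finite_I by (simp add: sum_subtractf)
        then have "nat (sum ?d I) < h"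
          unfolding h[symmetric] zless_nat_conj using n sum_nonneg[of I ?d] d by auto
        then obtain ks k where ks: "set ks \<subseteq> I" "k \<in> I" "refl (al i) b = wd ks (al k)"
          using less.IH[rule_format, of "nat (sum ?d I)" "refl (al i) b" ?d] b' d eq by metis
        have "wd (i # ks) (al k) = refl (al i) (refl (al i) b)" unfolding ks(3) by simp
        then have "b = wd (i # ks) (al k)" using i(1) by (simp only: refl_invol al_Phi)
        then show ?thesis using ks(1,2) i(1) by (intro exI[of _ "i # ks"] exI[of _ k]) simp
      qed
    qed
  qed
  show ?thesis
    by (rule main[of "nat (sum c I)", THEN spec[of _ b], THEN spec[of _ c], THEN mp]) (intro conjI assms c refl)
qed

lemma wd_rev: "set ks \<subseteq> I \<Longrightarrow> wd (rev ks) \<circ> wd ks = id"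
  by (induction ks) (auto simp: wd_append fun_eq_iff refl_invol)

lemma refl_uminus: "a \<in> Phi \<Longrightarrow> refl (- a) = refl a"
  using refl_conj[of a a] by (simp add: refl_self fun_eq_iff refl_invol)

lemma refl_word:
  assumes "b \<in> Phi"
  shows "\<exists>ks. set ks \<subseteq> I \<and> refl b = wd ks"
proof -
  have "\<exists>ks. set ks \<subseteq> I \<and> refl b = wd ks" if b: "pos b" for b
  proof -
    obtain ks k where ks: "set ks \<subseteq> I" "k \<in> I" "b = wd ks (al k)" using root_conj_simple[OF b] by blast
    have "refl b \<circ> wd ks = wd ks \<circ> refl (al k)" using ks W_refl[OF wd_W, of ks "al k"] by simp
    then have "refl b \<circ> (wd ks \<circ> wd (rev ks)) = wd ks \<circ> refl (al k) \<circ> wd (rev ks)"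
      by (simp add: o_assoc)
    moreover have "wd ks \<circ> wd (rev ks) = id" using wd_rev[of "rev ks"] ks(1) by simp
    ultimately have "refl b = wd (ks @ k # rev ks)"
      by (simp only: wd_append wd_simps o_assoc comp_id)
    then show ?thesis using ks by (intro exI[of _ "ks @ k # rev ks"]) auto
  qed
  then show ?thesis using root_cases[OF assms] refl_uminus[OF assms] by metis
qed

lemma W_word: "w \<in> W \<Longrightarrow> \<exists>ks. set ks \<subseteq> I \<and> w = wd ks"
proof (induction rule: W.induct)
  case id_W
  then show ?case by (intro exI[of _ "[]"]) simp
next
  case (refl_W a w)
  obtain js ks where "set js \<subseteq> I" "refl a = wd js" "set ks \<subseteq> I" "w = wd ks" using refl_W refl_word by metis
  then show ?case by (intro exI[of _ "js @ ks"]) (auto simp: wd_append)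
qed

definition len :: "('l \<Rightarrow> 'l) \<Rightarrow> nat" where
  "len w = (LEAST n. \<exists>ks. set ks \<subseteq> I \<and> length ks = n \<and> wd ks = w)"

text \<open>A reduced word, chosen once for all: the standard monomials of the twisted algebra are those of the words \<open>rw
  w\<close>.\<close>

definition rw :: "('l \<Rightarrow> 'l) \<Rightarrow> 'i list" where
  "rw w = (SOME ks. set ks \<subseteq> I \<and> length ks = len w \<and> wd ks = w)"

lemma len_le: "set ks \<subseteq> I \<Longrightarrow> len (wd ks) \<le> length ks"
  unfolding len_def by (rule Least_le) auto

lemma rw_props: "w \<in> W \<Longrightarrow> set (rw w) \<subseteq> I \<and> length (rw w) = len w \<and> wd (rw w) = w"
proof -
  assume "w \<in> W"
  then obtain ks where "set ks \<subseteq> I" "w = wd ks" using W_word by blast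
  then have "\<exists>ks. set ks \<subseteq> I \<and> length ks = len w \<and> wd ks = w"
    unfolding len_def by (rule_tac LeastI_ex) auto
  then show ?thesis unfolding rw_def by (rule someI_ex)
qed

lemma len_refl_le: "i \<in> I \<Longrightarrow> w \<in> W \<Longrightarrow> len (refl (al i) \<circ> w) \<le> Suc (len w)"
  using rw_props[of w] len_le[of "i # rw w"] by simp

lemma len_descent:
  assumes i: "i \<in> I" and w: "w \<in> W" and neg: "\<not> pos (inv_into UNIV w (al i))"
  shows "len w = Suc (len (refl (al i) \<circ> w))"
proof -
  obtain us k vs where *: "rw w = us @ k # vs" "refl (al i) \<circ> w = wd (us @ vs)"
    using exchange[of "rw w" "al i"] rw_props[OF w] i neg by auto
  have "len (refl (al i) \<circ> w) < len w"
    using len_le[of "us @ vs"] rw_props[OF w] *(1) by (auto simp: *(2))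
  moreover have "len w \<le> Suc (len (refl (al i) \<circ> w))"
    using len_refl_le[OF i, of "refl (al i) \<circ> w"] i w by (simp add: refl_refl_comp W.refl_W)
  ultimately show ?thesis by simp
qed

lemma W_inv_Phi: "w \<in> W \<Longrightarrow> b \<in> Phi \<Longrightarrow> inv_into UNIV w b \<in> Phi"
  using W_Phi W_inv by blast

lemma len_ascent:
  assumes i: "i \<in> I" and w: "w \<in> W" and p: "pos (inv_into UNIV w (al i))"
  shows "len (refl (al i) \<circ> w) = Suc (len w)"
proof -
  have "inv_into UNIV (refl (al i) \<circ> w) (al i) = - inv_into UNIV w (al i)"
    using i w W_simps(3)[OF W_inv[OF w]] by (simp add: inv_refl_comp refl_self)
  then show ?thesis
    using len_descent[OF i, of "refl (al i) \<circ> w"] pos_not_neg[OF p] i w by (simp add: refl_refl_comp W.refl_W)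
qed

text \<open>The inverse of an element other than the identity sends the simple root of the first letter of a reduced word to a
  negative root, so only the identity fixes all roots.\<close>

lemma W_faithful:
  assumes "v \<in> W" "w \<in> W" "\<And>b. b \<in> Phi \<Longrightarrow> v b = w b"
  shows "v = w"
proof -
  define u where "u = inv_into UNIV v \<circ> w"
  have u: "u \<in> W" using assms by (simp add: u_def W_comp W_inv)
  have fixed: "u b = b" if "b \<in> Phi" for b
    using assms that W_bij[of v] by (simp add: u_def flip: assms(3)) (simp add: bij_is_inj)
  have "u = id"
  proof (cases "rw u")
    case Nil
    then show ?thesis using rw_props[OF u] by simp
  next
    case (Cons i js)
    then have i: "i \<in> I" "set js \<subseteq> I" "u = refl (al i) \<circ> wd js" "len u = Suc (length js)"
      using rw_props[OF u] by auto
    have "inv_into UNIV u (al i) = al i"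
      using fixed[of "al i"] i(1) W_bij[OF u] by (metis al_Phi bij_is_inj inv_f_f)
    then have "len (refl (al i) \<circ> u) = Suc (len u)" using len_ascent[OF i(1) u] i(1) by simp
    moreover have "refl (al i) \<circ> u = wd js" using i by (simp add: refl_refl_comp)
    ultimately show ?thesis using len_le[OF i(2)] i(4) by simp
  qed
  then have "v \<circ> u = v" by simp
  then show ?thesis using W_bij[OF assms(1)] by (simp add: u_def o_assoc bij_comp_inv)
qed

lemma finite_W: "finite W"
proof (rule inj_on_finite)
  show "inj_on (\<lambda>w. restrict w Phi) W"
    by (rule inj_onI, rule W_faithful) (auto simp: fun_eq_iff restrict_def, metis)
  show "(\<lambda>w. restrict w Phi) ` W \<subseteq> (Phi \<rightarrow>\<^sub>E Phi)" using W_Phi by auto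
  show "finite (Phi \<rightarrow>\<^sub>E Phi)" using finite_Phi by (intro finite_PiE) auto
qed

end

context simple_root_datum
begin

subsection \<open>Pairs of simple roots\<close>

lemma al_rt: "al i = rt i j 1 0" "al j = rt i j 0 1"
  by (simp_all add: rt_def)

lemma refl_rt:
  assumes "i \<in> I" "j \<in> I"
  shows "refl (al i) (rt i j n m) = rt i j (- n - cr (al i) (al j) * m) m"
    "refl (al j) (rt i j n m) = rt i j n (- m - cr (al j) (al i) * n)"
  using assms
  by (simp_all add: rt_def refl_simps refl_self)
    (simp_all add: reflection_def zsmul_diff_right zsmul_diff_left zsmul_assoc zsmul_minus_right zsmul_minus_left mult.commute)

lemma rt_comb:
  "i \<in> I \<Longrightarrow> j \<in> I \<Longrightarrow> rt i j n m = comb (\<lambda>k. (if k = i then n else 0) + (if k = j then m else 0))"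
  by (simp add: comb_add comb_single rt_def)

lemma rt_pos_coeffs:
  assumes "i \<in> I" "j \<in> I" "i \<noteq> j" "pos (rt i j n m)"
  shows "n \<ge> 0" "m \<ge> 0"
proof -
  obtain c where c: "\<forall>k\<in>I. c k \<ge> 0" "rt i j n m = comb c" using assms(4) by (auto simp: pos_def)
  then have "\<forall>k\<in>I. (if k = i then n else 0) + (if k = j then m else 0) = c k"
    using assms by (simp add: rt_comb comb_eq_iff)
  then show "n \<ge> 0" "m \<ge> 0" using c(1) assms(1-3) by force+
qed

lemma rt_zero: "i \<in> I \<Longrightarrow> j \<in> I \<Longrightarrow> i \<noteq> j \<Longrightarrow> rt i j n m = 0 \<Longrightarrow> n = 0 \<and> m = 0"
  using comb_eq_0[of "\<lambda>k. (if k = i then n else 0) + (if k = j then m else 0)" i]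
    comb_eq_0[of "\<lambda>k. (if k = i then n else 0) + (if k = j then m else 0)" j]
  by (simp add: rt_comb)

text \<open>The Cauchy-Schwarz inequality for the invariant form gives \<open>a b \<le> 4\<close> for the product of the two
  Cartan integers. If \<open>a b = 4\<close>, then \<open>s\<^sub>i s\<^sub>j\<close> translates \<open>al i\<close> along a fixed
  vector and produces infinitely many roots.\<close>

lemma cartan_cases:
  assumes ij: "i \<in> I" "j \<in> I" "i \<noteq> j"
  shows "(cr (al i) (al j), cr (al j) (al i)) \<in> {(0, 0), (-1, -1), (-1, -2), (-1, -3), (-2, -1), (-3, -1)}"
proof -
  define a b where "a = cr (al i) (al j)" and "b = cr (al j) (al i)"
  define p A B where "p = form (al i) (al j)" and "A = form (al i) (al i)" and "B = form (al j) (al j)"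
  have ne: "al i \<noteq> al j" using ij inj_al by (auto dest: inj_onD)
  have "pos (refl (al i) (rt i j 0 1))"
    using refl_pos[OF ij(1) pos_al[OF ij(2)]] ne by (simp flip: al_rt)
  then have a0: "a \<le> 0" using rt_pos_coeffs(1)[OF ij, of "- cr (al i) (al j)" 1] by (simp add: refl_rt ij a_def)
  have "pos (refl (al j) (rt i j 1 0))"
    using refl_pos[OF ij(2) pos_al[OF ij(1)]] ne by (simp flip: al_rt)
  then have b0: "b \<le> 0" using rt_pos_coeffs(2)[OF ij, of 1 "- cr (al j) (al i)"] by (simp add: refl_rt ij b_def)
  have AB: "A > 0" "B > 0" using ij by (simp_all add: A_def B_def form_pos)
  have pa: "2 * p = a * A" using form_cr[of "al i" "al j"] ij by (simp add: p_def a_def A_def)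
  have pb: "2 * p = b * B"
    using form_cr[of "al j" "al i"] ij by (simp add: p_def b_def B_def form_commute[of "al j" "al i"])
  have zero: "a = 0 \<longleftrightarrow> b = 0"
  proof
    assume "a = 0"
    then have "p = 0" using pa by simp
    then have "b * B = 0" using pb by simp
    then show "b = 0" using AB by simp
  next
    assume "b = 0"
    then have "p = 0" using pb by simp
    then have "a * A = 0" using pa by simp
    then show "a = 0" using AB by simp
  qed
  have "0 \<le> form (zsmul B (al i) - zsmul p (al j)) (zsmul B (al i) - zsmul p (al j))"
    by (rule form_nonneg)
  also have "\<dots> = B * (A * B - p * p)"
    by (simp add: form_simps form_commute[of "al j" "al i"] algebra_simps flip: p_def A_def B_def)
  finally have "p * p \<le> A * B" using AB by (simp add: zero_le_mult_iff)
  moreover have "4 * (p * p) = (a * b) * (A * B)"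
  proof -
    have "4 * (p * p) = (2 * p) * (2 * p)" by simp
    also have "\<dots> = (a * A) * (b * B)" using pa pb by simp
    finally show ?thesis by simp
  qed
  ultimately have "(a * b) * (A * B) \<le> 4 * (A * B)" by linarith
  then have le4: "a * b \<le> 4" using AB by (simp add: mult_le_cancel_right)
  have ne4: "a * b \<noteq> 4"
  proof
    assume ab: "a * b = 4"
    define v where "v = rt i j 2 (- b)"
    define t where "t l = refl (al i) (refl (al j) l)" for l
    have str: "al i + zsmul (int n) v = rt i j (1 + 2 * int n) (- b * int n)" for n
      by (simp add: v_def rt_def zsmul_right zsmul_add zsmul_assoc zsmul_minus_left zsmul_minus_right zsmul_diff_right mult.commute)
    have tt: "t (rt i j n m) = rt i j (- n + a * (m + b * n)) (- m - b * n)" for n m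
      using ij by (simp add: t_def refl_rt algebra_simps flip: a_def b_def)
    have "t (al i + zsmul (int n) v) = al i + zsmul (int (Suc n)) v" for n
    proof -
      have "t (al i + zsmul (int n) v) = rt i j (- (1 + 2 * int n) + a * (- b * int n + b * (1 + 2 * int n)))
          (- (- b * int n) - b * (1 + 2 * int n))"
        unfolding str tt ..
      moreover have "- (1 + 2 * int n) + a * (- b * int n + b * (1 + 2 * int n)) =
          - (1 + 2 * int n) + (a * b) * (1 + int n)" by (simp add: algebra_simps)
      ultimately show ?thesis unfolding str ab by (simp add: algebra_simps)
    qed
    then have "v = 0"
      by (intro no_infinite_string[of "al i" t]) (use ij in \<open>auto simp: t_def refl_Phi\<close>)
    then show False using rt_zero[OF ij, of 2 "- b"] by (simp add: v_def)
  qed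
  have "a * b \<le> 3" using le4 ne4 by linarith
  show ?thesis
  proof (cases "a = 0")
    case True
    then show ?thesis using zero by (simp add: a_def b_def)
  next
    case False
    then have "a \<le> -1" "b \<le> -1" using a0 b0 zero by auto
    moreover have "- a \<le> a * b" "- b \<le> a * b"
      using mult_mono[of 1 "- b" "- a" "- a"] mult_mono[of 1 "- a" "- b" "- b"] calculation by (auto simp: mult.commute)
    ultimately have "a \<in> {-3..-1}" "b \<in> {-3..-1}" using \<open>a * b \<le> 3\<close> by auto
    then have "a = -1 \<or> a = -2 \<or> a = -3" "b = -1 \<or> b = -2 \<or> b = -3" by auto
    then show ?thesis using \<open>a * b \<le> 3\<close> by (auto simp flip: a_def b_def)
  qed
qed

text \<open>The words whose monomials are exchanged by the relations, in the order in which they occur there.\<close>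

definition braids :: "('i list \<times> 'i list) set" where
  "braids = {([i, j], [j, i]) | i j. i \<in> I \<and> j \<in> I \<and> cr (al i) (al j) = 0} \<union>
    {([j, i, j], [i, j, i]) | i j. i \<in> I \<and> j \<in> I \<and> i \<noteq> j \<and> cr (al i) (al j) = -1 \<and> cr (al j) (al i) = -1} \<union>
    {([j, i, j, i], [i, j, i, j]) | i j. i \<in> I \<and> j \<in> I \<and> i \<noteq> j \<and> cr (al i) (al j) = -1 \<and> cr (al j) (al i) = -2} \<union>
    {([j, i, j, i, j, i], [i, j, i, j, i, j]) | i j. i \<in> I \<and> j \<in> I \<and> i \<noteq> j \<and>
       cr (al i) (al j) = -1 \<and> cr (al j) (al i) = -3}"

lemma refl_commute:
  assumes "i \<in> I" "g \<in> Phi" "refl (al i) g = g"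
  shows "refl (al i) \<circ> refl g = refl g \<circ> refl (al i)"
proof -
  have "refl g = refl (al i) \<circ> refl g \<circ> refl (al i)" using refl_conj[of "al i" g] assms by simp
  then have "refl (al i) (refl g l) = refl g (refl (al i) l)" for l
    using assms(1) by (metis comp_apply refl_invol al_Phi)
  then show ?thesis by (simp add: fun_eq_iff)
qed

lemma cartan_zero:
  assumes "i \<in> I" "j \<in> I" "cr (al i) (al j) = 0"
  shows "i \<noteq> j" "cr (al j) (al i) = 0"
proof -
  show "i \<noteq> j" using assms cr_self[of "al i"] by auto
  then show "cr (al j) (al i) = 0" using cartan_cases[of i j] assms by auto
qed

text \<open>If \<open>s\<^sub>i\<close> fixes \<open>al j\<close>, it commutes with the reflection in it. For the types B2 and G2
  all letters of \<open>p\<close> but the last form a palindrome, which is the reflection in a root \<open>g\<close> fixed by the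
  remaining reflection \<open>s\<^sub>i\<close>, so the two commute. For A2 both words are palindromes and are reflections in the
  same root.\<close>

lemma braid_wd:
  assumes "(p, q) \<in> braids"
  shows "wd p = wd q"
proof -
  note conj = refl_conj[unfolded o_assoc[symmetric], symmetric]
  from assms consider
    i j where "p = [i, j]" "q = [j, i]" "i \<in> I" "j \<in> I" "cr (al i) (al j) = 0"
  | i j where "p = [j, i, j]" "q = [i, j, i]" "i \<in> I" "j \<in> I" "i \<noteq> j" "cr (al i) (al j) = -1" "cr (al j) (al i) = -1"
  | i j where "p = [j, i, j, i]" "q = [i, j, i, j]" "i \<in> I" "j \<in> I" "i \<noteq> j" "cr (al i) (al j) = -1" "cr (al j) (al i) = -2"
  | i j where "p = [j, i, j, i, j, i]" "q = [i, j, i, j, i, j]" "i \<in> I" "j \<in> I" "i \<noteq> j"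
      "cr (al i) (al j) = -1" "cr (al j) (al i) = -3"
    unfolding braids_def by blast
  then show ?thesis
  proof cases
    case 1
    then have "refl (al i) (al j) = al j" by (simp add: reflection_def)
    then show ?thesis using refl_commute[of i "al j"] 1 by simp
  next
    case 2
    have "refl (al j) (al i) = refl (al i) (al j)"
      using 2 by (simp add: al_rt[of i j] refl_rt[of i j, folded al_rt[of i j]] del: One_nat_def)
        (simp add: reflection_def rt_def algebra_simps zsmul_minus_left)
    then show ?thesis using conj[of "al j" "al i"] conj[of "al i" "al j"] 2 by simp
  next
    case 3
    define g where "g = refl (al j) (al i)"
    have g: "g = rt i j 1 2" using refl_rt(2)[of i j 1 0] 3 by (simp add: g_def flip: al_rt)
    have "refl (al i) g = g" using refl_rt(1)[of i j 1 2] 3 by (simp add: g)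
    moreover have "refl (al j) \<circ> (refl (al i) \<circ> refl (al j)) = refl g" unfolding g_def by (rule conj) (use 3 in auto)
    ultimately show ?thesis
      using refl_commute[of i g] 3 refl_Phi[of "al j" "al i"] by (simp add: o_assoc flip: g_def)
  next
    case 4
    define g where "g = refl (al j) (refl (al i) (al j))"
    have h: "refl (al i) (al j) = rt i j 1 1" using refl_rt(1)[of i j 0 1] 4 by (simp flip: al_rt)
    have g: "g = rt i j 1 2" using refl_rt(2)[of i j 1 1] 4 by (simp add: g_def h)
    have "refl (al i) g = g" using refl_rt(1)[of i j 1 2] 4 by (simp add: g)
    moreover have "refl (al j) \<circ> ((refl (al i) \<circ> (refl (al j) \<circ> refl (al i))) \<circ> refl (al j)) = refl g"
      using conj[of "al i" "al j"] conj[of "al j" "refl (al i) (al j)"] 4 refl_Phi[of "al i" "al j"] by (simp add: g_def)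
    ultimately show ?thesis
      using refl_commute[of i g] 4 refl_Phi by (simp add: o_assoc g_def)
  qed
qed

lemma braid_set: "(p, q) \<in> braids \<Longrightarrow> set p \<subseteq> I \<and> set q \<subseteq> I \<and> length p = length q \<and> p \<noteq> [] \<and> q \<noteq> []"
  by (auto simp: braids_def)

text \<open>The second clause lists the roots that the longest element of the dihedral group sends to negative ones: they are
  non-negative combinations of the two simple roots.\<close>

lemma braid_for_pair:
  assumes ij: "i \<in> I" "j \<in> I" "i \<noteq> j"
  shows "\<exists>p q. (p, q) \<in> braids \<and> ((hd p = i \<and> hd q = j) \<or> (hd p = j \<and> hd q = i)) \<and>
    (\<forall>k<length p. \<exists>n m. n \<ge> 0 \<and> m \<ge> 0 \<and> wd (take k p) (al (p ! k)) = rt i j n m)"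
proof -
  have sym: "rt i j n m = rt j i m n" for i j n m by (simp add: rt_def add.commute)
  have main: "\<exists>p q. (p, q) \<in> braids \<and> hd p = j \<and> hd q = i \<and>
    (\<forall>k<length p. \<exists>n m. n \<ge> 0 \<and> m \<ge> 0 \<and> wd (take k p) (al (p ! k)) = rt i j n m)"
    if ij: "i \<in> I" "j \<in> I" "i \<noteq> j" and c: "(cr (al i) (al j), cr (al j) (al i)) \<in> {(0, 0), (-1, -1), (-1, -2), (-1, -3)}"
    for i j
  proof -
    have al1: "\<exists>n\<ge>0. \<exists>m\<ge>0. al i = rt i j n m"
      by (rule exI[of _ 1], intro conjI exI[of _ 0] al_rt) simp_all
    have al2: "\<exists>n\<ge>0. \<exists>m\<ge>0. al j = rt i j n m"
      by (rule exI[of _ 0], intro conjI exI[of _ 1] al_rt) simp_all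
    have ri: "refl (al i) (al j) = rt i j (- cr (al i) (al j)) 1" "refl (al j) (al i) = rt i j 1 (- cr (al j) (al i))"
      using refl_rt(1)[of i j 0 1] refl_rt(2)[of i j 1 0] ij by (simp_all flip: al_rt)
    have ex: "\<exists>n'\<ge>0. \<exists>m'\<ge>0. rt i j n m = rt i j n' m'" if "n \<ge> 0" "m \<ge> 0" for n m using that by blast
    note [simp] = al1 al2 ri refl_rt[OF ij(1,2)] All_less_Suc
    from c consider "cr (al i) (al j) = 0" "cr (al j) (al i) = 0" | "cr (al i) (al j) = -1" "cr (al j) (al i) = -1"
      | "cr (al i) (al j) = -1" "cr (al j) (al i) = -2" | "cr (al i) (al j) = -1" "cr (al j) (al i) = -3" by auto
    then show ?thesis
    proof cases
      case 1
      have "([j, i], [i, j]) \<in> braids" using 1 ij by (simp add: braids_def)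
      then show ?thesis using 1 by (intro exI conjI) (assumption, auto intro!: ex)
    next
      case 2
      have "([j, i, j], [i, j, i]) \<in> braids" using 2 ij by (simp add: braids_def)
      then show ?thesis using 2 by (intro exI conjI) (assumption, auto intro!: ex)
    next
      case 3
      have "([j, i, j, i], [i, j, i, j]) \<in> braids" using 3 ij by (simp add: braids_def)
      then show ?thesis using 3 by (intro exI conjI) (assumption, auto intro!: ex)
    next
      case 4
      have "([j, i, j, i, j, i], [i, j, i, j, i, j]) \<in> braids" using 4 ij by (simp add: braids_def)
      then show ?thesis using 4 by (intro exI conjI) (assumption, auto intro!: ex)
    qed
  qed
  consider "(cr (al i) (al j), cr (al j) (al i)) \<in> {(0, 0), (-1, -1), (-1, -2), (-1, -3)}"
    | "(cr (al j) (al i), cr (al i) (al j)) \<in> {(0, 0), (-1, -1), (-1, -2), (-1, -3)}"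
    using cartan_cases[OF ij] by auto
  then show ?thesis
  proof cases
    case 1
    then show ?thesis using main[OF ij] by blast
  next
    case 2
    obtain p q where pq: "(p, q) \<in> braids" "hd p = i" "hd q = j"
      "\<forall>k<length p. \<exists>n m. n \<ge> 0 \<and> m \<ge> 0 \<and> wd (take k p) (al (p ! k)) = rt j i n m"
      using main[OF ij(2,1) ij(3)[symmetric] 2] by blast
    have "\<forall>k<length p. \<exists>n m. n \<ge> 0 \<and> m \<ge> 0 \<and> wd (take k p) (al (p ! k)) = rt i j n m"
      using pq(4) sym[of i j] by metis
    then show ?thesis using pq(1-3) by blast
  qed
qed

lemma wd_rev_inv:
  assumes "set p \<subseteq> I" "w \<in> W"
  shows "inv_into UNIV (wd (rev p) \<circ> w) = inv_into UNIV w \<circ> wd p"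
proof -
  have "wd p \<circ> wd (rev p) = id" "wd (rev p) \<circ> wd p = id"
    using wd_rev[of "rev p"] wd_rev[of p] assms by auto
  then have "inv_into UNIV (wd (rev p)) = wd p" by (intro inv_unique_comp)
  then show ?thesis using assms by (simp add: o_inv_distrib W_bij wd_W)
qed

text \<open>If left multiplication by \<open>s\<^sub>i\<close> and by \<open>s\<^sub>j\<close> both shorten \<open>w\<close>, then
  the inverse of \<open>w\<close> sends every non-negative combination of them that is a root to a negative root. Thus each letter
  of the longest dihedral word can be split off from \<open>w\<close>, and each one lowers the length.\<close>

lemma peel:
  assumes ij: "i \<in> I" "j \<in> I" and w: "w \<in> W" and p: "set p \<subseteq> I"
    and neg: "\<not> pos (inv_into UNIV w (al i))" "\<not> pos (inv_into UNIV w (al j))"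
    and rts: "\<forall>k<length p. \<exists>n m. n \<ge> 0 \<and> m \<ge> 0 \<and> wd (take k p) (al (p ! k)) = rt i j n m"
  shows "n \<le> length p \<Longrightarrow> len w = n + len (wd (rev (take n p)) \<circ> w)"
proof (induction n)
  case 0
  then show ?case by simp
next
  case (Suc n)
  let ?v = "wd (rev (take n p)) \<circ> w" and ?k = "p ! n"
  have k: "?k \<in> I" using Suc.prems p by auto
  have tp: "set (take n p) \<subseteq> I" using p set_take_subset by fastforce
  have v: "?v \<in> W" using w tp by (simp add: W_comp wd_W)
  obtain a b where ab: "a \<ge> 0" "b \<ge> 0" "wd (take n p) (al ?k) = rt i j a b" using rts Suc.prems by (metis Suc_le_lessD)
  have "pos (- inv_into UNIV w (al i))" "pos (- inv_into UNIV w (al j))"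
    using neg root_cases W_inv_Phi[OF w] al_Phi ij by blast+
  then obtain c d where c: "\<forall>k\<in>I. c k \<ge> 0" "- inv_into UNIV w (al i) = comb c"
    and d: "\<forall>k\<in>I. d k \<ge> 0" "- inv_into UNIV w (al j) = comb d" by (auto simp: pos_def)
  have "inv_into UNIV ?v (al ?k) = inv_into UNIV w (rt i j a b)"
    using wd_rev_inv[OF tp w] ab(3) by simp
  also have "\<dots> = - comb (\<lambda>k. a * c k + b * d k)"
    using W_inv[OF w] by (simp add: rt_def W_simps comb_add comb_zsmul zsmul_minus_right flip: c(2) d(2))
  finally have e: "- inv_into UNIV ?v (al ?k) = comb (\<lambda>k. a * c k + b * d k)" by simp
  have "- inv_into UNIV ?v (al ?k) \<in> Phi" using W_inv_Phi[OF v] k uminus_Phi by simp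
  then have "pos (- inv_into UNIV ?v (al ?k))"
    unfolding pos_def using e ab c d by (intro conjI exI[of _ "\<lambda>k. a * c k + b * d k"]) auto
  then have "\<not> pos (inv_into UNIV ?v (al ?k))" using pos_not_neg by blast
  then have "len ?v = Suc (len (refl (al ?k) \<circ> ?v))" by (rule len_descent[OF k v])
  moreover have "wd (rev (take (Suc n) p)) = refl (al ?k) \<circ> wd (rev (take n p))"
    using Suc.prems by (simp add: take_Suc_conv_app_nth)
  then have "wd (rev (take (Suc n) p)) \<circ> w = refl (al ?k) \<circ> ?v" by (simp only: o_assoc)
  ultimately show ?case using Suc.IH Suc.prems by (metis Suc_leD add_Suc_shift)
qed

subsection \<open>Matsumoto's theorem\<close>

text \<open>A congruence on words that is invariant under left multiplication and contains the braid moves identifies any two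
  reduced words of the same element. By induction on the length words with the same first letter are related. If the first letters
  are \<open>i \<noteq> j\<close>, both shorten \<open>w\<close>, so \<open>w\<close> has reduced words that begin with either side
  of the braid move for \<open>i\<close> and \<open>j\<close>; these link the two given words.\<close>

theorem word_property:
  assumes refl: "\<And>u. set u \<subseteq> I \<Longrightarrow> R u u" and sym: "\<And>u v. R u v \<Longrightarrow> R v u"
    and trans: "\<And>u v w. R u v \<Longrightarrow> R v w \<Longrightarrow> R u w"
    and Cons: "\<And>i u v. i \<in> I \<Longrightarrow> R u v \<Longrightarrow> R (i # u) (i # v)"
    and braid: "\<And>p q vs. (p, q) \<in> braids \<Longrightarrow> set vs \<subseteq> I \<Longrightarrow> R (p @ vs) (q @ vs)"
    and u: "set u \<subseteq> I" "length u = len (wd u)" and v: "set v \<subseteq> I" "length v = len (wd v)" and uv: "wd u = wd v"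
  shows "R u v"
proof -
  have red: "len (wd u) = length u \<and> \<not> pos (inv_into UNIV (wd (i # u)) (al i))"
    if "set (i # u) \<subseteq> I" "len (wd (i # u)) = Suc (length u)" for i u
  proof -
    have i: "i \<in> I" "set u \<subseteq> I" using that by auto
    have l: "len (wd u) = length u"
      using len_le[OF i(2)] len_refl_le[OF i(1) wd_W[OF i(2)]] that(2) by simp
    have "\<not> pos (inv_into UNIV (wd (i # u)) (al i))"
    proof
      assume "pos (inv_into UNIV (wd (i # u)) (al i))"
      then have "len (refl (al i) \<circ> wd (i # u)) = Suc (len (wd (i # u)))"
        using that wd_W by (intro len_ascent i) blast
      moreover have "refl (al i) \<circ> wd (i # u) = wd u" using i by (simp add: refl_refl_comp)
      ultimately show False using l that(2) by simp
    qed
    then show ?thesis using l by blast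
  qed
  have "\<forall>u v. set u \<subseteq> I \<and> set v \<subseteq> I \<and> length u = n \<and> length v = n \<and> len (wd u) = n \<and> wd u = wd v \<longrightarrow> R u v" for n
  proof (induction n)
    case 0
    then show ?case using refl by simp
  next
    case (Suc n)
    have same: "R (i # u) (i # v)"
      if "set (i # u) \<subseteq> I" "set (i # v) \<subseteq> I" "length u = n" "length v = n" "len (wd (i # u)) = Suc n"
        "wd (i # u) = wd (i # v)" for i u v
    proof -
      have "wd u = wd v" using that refl_refl_comp[of "al i"] by (metis wd_simps(2) al_Phi list.set_intros(1) subsetD)
      then show ?thesis using Suc.IH Cons[of i u v] red[of i u] that by auto
    qed
    show ?case
    proof (intro allI impI, elim conjE)
      fix u v assume u: "set u \<subseteq> I" "length u = Suc n" and v: "set v \<subseteq> I" "length v = Suc n"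
        and len: "len (wd u) = Suc n" and uv: "wd u = wd v"
      obtain i u' where u': "u = i # u'" using u by (cases u) auto
      obtain j v' where v': "v = j # v'" using v by (cases v) auto
      have ij: "i \<in> I" "j \<in> I" using u v u' v' by auto
      show "R u v"
      proof (cases "i = j")
        case True
        then show ?thesis using same[of j u' v'] u v len uv u' v' by simp
      next
        case False
        let ?w = "wd u"
        have w: "?w \<in> W" using u wd_W by blast
        have neg: "\<not> pos (inv_into UNIV ?w (al i))" "\<not> pos (inv_into UNIV ?w (al j))"
          using red[of i u'] red[of j v'] u v len uv u' v' by auto
        obtain p q where pq: "(p, q) \<in> braids" "(hd p = i \<and> hd q = j) \<or> (hd p = j \<and> hd q = i)"
          and rts: "\<forall>k<length p. \<exists>n m. n \<ge> 0 \<and> m \<ge> 0 \<and> wd (take k p) (al (p ! k)) = rt i j n m"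
          using braid_for_pair[OF ij False] by blast
        have sp: "set p \<subseteq> I" "set q \<subseteq> I" "length p = length q" "p \<noteq> []" "q \<noteq> []" using braid_set[OF pq(1)] by auto
        define w' where "w' = wd (rev p) \<circ> ?w"
        have w': "w' \<in> W" using w sp by (simp add: w'_def W_comp wd_W)
        have l: "Suc n = length p + len w'"
          using peel[OF ij w sp(1) neg rts, of "length p"] len by (simp add: w'_def)
        have rw: "set (rw w') \<subseteq> I" "length (rw w') = len w'" "wd (rw w') = w'" using rw_props[OF w'] by auto
        have wp: "wd (p @ rw w') = ?w"
        proof -
          have "wd p \<circ> wd (rev p) = id" using wd_rev[of "rev p"] sp(1) by simp
          moreover have "wd (p @ rw w') = (wd p \<circ> wd (rev p)) \<circ> ?w" unfolding wd_append rw(3) by (simp only: w'_def o_assoc)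
          ultimately show ?thesis by (simp only: id_comp)
        qed
        have wq: "wd (q @ rw w') = ?w" using wp braid_wd[OF pq(1)] by (simp add: wd_append)
        have conn: "R (k # y) (s @ rw w')"
          if "k # y = u \<or> k # y = v" "hd s = k" "s \<noteq> []" "set s \<subseteq> I" "length s = length p" "wd (s @ rw w') = ?w" for k y s
        proof -
          have e: "s @ rw w' = k # (tl s @ rw w')" using that by (cases s) auto
          have "wd (k # (tl s @ rw w')) = ?w" unfolding e[symmetric] by (rule that(6))
          moreover have "length (tl s @ rw w') = n" using that l rw by (cases s) auto
          moreover have "set (k # (tl s @ rw w')) \<subseteq> I"
            using that rw(1) unfolding e[symmetric] by simp
          ultimately show ?thesis unfolding e using same[of k y "tl s @ rw w'"] that(1) u v len uv by auto
        qed
        have b: "R (p @ rw w') (q @ rw w')" using braid[OF pq(1) rw(1)] .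
        from pq(2) show ?thesis
        proof
          assume h: "hd p = i \<and> hd q = j"
          have "R u (p @ rw w')" unfolding u' by (rule conn) (use h sp u' wp in auto)
          moreover have "R v (q @ rw w')" unfolding v' by (rule conn) (use h sp v' wq in auto)
          ultimately show ?thesis using b trans sym by blast
        next
          assume h: "hd p = j \<and> hd q = i"
          have "R u (q @ rw w')" unfolding u' by (rule conn) (use h sp u' wq in auto)
          moreover have "R v (p @ rw w')" unfolding v' by (rule conn) (use h sp v' wp in auto)
          ultimately show ?thesis using b trans sym by blast
        qed
      qed
    qed
  qed
  then show ?thesis using u v uv by metis
qed

end

section \<open>The twisted formal group algebra\<close>

text \<open>An element \<open>\<Sum> \<delta>\<^sub>w f(w)\<close> of the twisted algebra is the function \<open>f\<close>,
  extended by \<open>0\<close> to all maps of the lattice. The zero extension is what the predicate \<open>supp\<close> below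
  records.\<close>

locale formal_demazure = formal_group_data F \<iota> Phi cr I al + simple_root_datum F \<iota> Phi cr I al
  for F :: "'r::idom fps fps" and \<iota> :: "('l::ab_group_add, 'r) fga \<Rightarrow> 'k::field"
    and Phi :: "'l set" and cr :: "'l \<Rightarrow> 'l \<Rightarrow> int" and I :: "'i set" and al :: "'i \<Rightarrow> 'l"
begin

abbreviation Inv :: "('l \<Rightarrow> 'l) \<Rightarrow> 'l \<Rightarrow> 'l" where "Inv w \<equiv> inv_into UNIV w"

text \<open>The inverse of \<open>x\<^sub>l\<close>, in which all relations become polynomial; it is \<open>0\<close> for \<open>l
  = 0\<close>.\<close>

definition z :: "'l \<Rightarrow> 'k" where "z l = inverse (x l)"

lemma W_aut: "w \<in> W \<Longrightarrow> lattice_aut w"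
  by (simp add: lattice_aut_def W_bij W_additive)

lemma Inv_W [simp]: "w \<in> W \<Longrightarrow> Inv w \<in> W"
  by (rule W_inv)

lemma Inv_comp: "v \<in> W \<Longrightarrow> w \<in> W \<Longrightarrow> Inv (v \<circ> w) = Inv w \<circ> Inv v"
  by (simp add: o_inv_distrib W_bij)

lemma Inv_cancel: "w \<in> W \<Longrightarrow> w \<circ> Inv w = id" "w \<in> W \<Longrightarrow> Inv w \<circ> w = id"
  by (simp_all add: bij_comp_inv W_bij)

lemma W_act:
  assumes "w \<in> W"
  shows "act w (a + b) = act w a + act w b" "act w (a * b) = act w a * act w b" "act w 0 = 0" "act w 1 = 1"
    "act w (- a) = - act w a" "act w (a - b) = act w a - act w b" "act w (inverse a) = inverse (act w a)"
    "act w (a / b) = act w a / act w b"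
    "act w (z l) = z (w l)" "act w (x l) = x (w l)" "act w (scalar r) = scalar r" "a \<in> S \<Longrightarrow> act w a \<in> S"
proof -
  note w = W_aut[OF assms]
  show 1: "act w (a + b) = act w a + act w b" and 2: "act w (a * b) = act w a * act w b"
    and 3: "act w 0 = 0" and 4: "act w 1 = 1" for a b by (simp_all add: act_hom act_0 act_1 w)
  show 5: "act w (- a) = - act w a" for a
    using 1[of a "- a"] 3 by (simp add: eq_neg_iff_add_eq_0 add.commute)
  show "act w (a - b) = act w a - act w b" using 1[of a "- b"] 5[of b] by simp
  show 6: "act w (inverse a) = inverse (act w a)" for a
  proof (cases "a = 0")
    case False
    then have "act w a * act w (inverse a) = 1" using 2[of a "inverse a"] 4 by simp
    then show ?thesis by (rule inverse_unique[symmetric])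
  qed (simp add: 3)
  show "act w (a / b) = act w a / act w b" by (simp add: divide_inverse 2 6)
  show "act w (x l) = x (w l)" by (rule act_x[OF w])
  then show "act w (z l) = z (w l)" by (simp add: z_def 6)
  show "act w (scalar r) = scalar r" by (rule act_scalar[OF w])
  show "act w a \<in> S" if "a \<in> S" by (rule act_S[OF w that])
qed

lemma W_act_comp: "v \<in> W \<Longrightarrow> w \<in> W \<Longrightarrow> act v (act w a) = act (v \<circ> w) a"
  by (simp add: act_comp W_aut)

lemma W_act_sum: "w \<in> W \<Longrightarrow> act w (sum g A) = (\<Sum>k\<in>A. act w (g k))"
  by (induction A rule: infinite_finite_induct) (auto simp: W_act)

lemma Q_S: "a \<in> S \<Longrightarrow> a \<in> Q"
  unfolding Q_def by (rule generate_ring.incl) simp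

lemma Q_add: "a \<in> Q \<Longrightarrow> b \<in> Q \<Longrightarrow> a + b \<in> Q"
  and Q_mult: "a \<in> Q \<Longrightarrow> b \<in> Q \<Longrightarrow> a * b \<in> Q"
  and Q_uminus: "a \<in> Q \<Longrightarrow> - a \<in> Q"
  using generate_ring.eng_add[of a ring_of_type_algebra "S \<union> {inverse (x l) | l. l \<noteq> 0}" b]
    generate_ring.eng_mult[of a ring_of_type_algebra "S \<union> {inverse (x l) | l. l \<noteq> 0}" b]
    generate_ring.a_inv[of a ring_of_type_algebra "S \<union> {inverse (x l) | l. l \<noteq> 0}"]
  unfolding Q_def by simp_all

lemma Q_diff: "a \<in> Q \<Longrightarrow> b \<in> Q \<Longrightarrow> a - b \<in> Q"
  using Q_add[OF _ Q_uminus] by fastforce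

lemma Q_0 [simp]: "0 \<in> Q" and Q_1 [simp]: "1 \<in> Q"
  by (simp_all add: Q_S)

lemma Q_z [simp]: "z l \<in> Q"
proof (cases "l = 0")
  case False
  then show ?thesis unfolding Q_def z_def by (intro generate_ring.incl) blast
qed (simp add: z_def)

lemma Q_sum: "(\<And>k. k \<in> A \<Longrightarrow> g k \<in> Q) \<Longrightarrow> sum g A \<in> Q"
  by (induction A rule: infinite_finite_induct) (auto intro: Q_add)

lemma Q_act:
  assumes "w \<in> W" "a \<in> Q"
  shows "act w a \<in> Q"
  using assms(2) unfolding Q_def
proof (induction rule: generate_ring.induct)
  case (incl h)
  then consider "h \<in> S" | l where "h = z l" by (auto simp: z_def)
  then show ?case using W_act(9,12)[OF assms(1)] Q_S Q_z by cases (auto simp: Q_def)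
qed (use assms(1) Q_0 Q_1 Q_add Q_mult Q_uminus in \<open>simp_all add: W_act flip: Q_def\<close>)

definition supp :: "(('l \<Rightarrow> 'l) \<Rightarrow> 'k) \<Rightarrow> bool" where "supp f \<longleftrightarrow> (\<forall>w. w \<notin> W \<longrightarrow> f w = 0)"

lemma QW_carrier: "f \<in> carrier QW \<longleftrightarrow> (\<forall>w\<in>W. f w \<in> Q) \<and> supp f"
  by (auto simp: QW_def supp_def)

lemma QW_supp: "f \<in> carrier QW \<Longrightarrow> supp f"
  by (simp add: QW_carrier)

lemma QW_add: "f \<oplus>\<^bsub>QW\<^esub> g = (\<lambda>u. f u + g u)" and QW_zero: "\<zero>\<^bsub>QW\<^esub> = (\<lambda>u. 0)"
  and QW_one: "\<one>\<^bsub>QW\<^esub> = coef 1"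
  by (simp_all add: QW_def coef_def)

lemma QW_mult_outside: "u \<notin> W \<Longrightarrow> (f \<otimes>\<^bsub>QW\<^esub> g) u = 0"
  by (auto simp: QW_def W_comp intro!: sum.neutral)

lemma QW_mult: "u \<in> W \<Longrightarrow> (f \<otimes>\<^bsub>QW\<^esub> g) u = (\<Sum>w\<in>W. act (Inv w) (f (u \<circ> Inv w)) * g w)"
proof -
  assume u: "u \<in> W"
  have eq: "{(v, w). v \<in> W \<and> w \<in> W \<and> v \<circ> w = u} = (\<lambda>w. (u \<circ> Inv w, w)) ` W"
  proof (intro equalityI subsetI)
    fix p assume "p \<in> {(v, w). v \<in> W \<and> w \<in> W \<and> v \<circ> w = u}"
    then obtain v w where "p = (v, w)" "v \<in> W" "w \<in> W" "u = v \<circ> w" by auto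
    moreover from this have "v = u \<circ> Inv w" by (simp only: Inv_cancel comp_assoc comp_id)
    ultimately show "p \<in> (\<lambda>w. (u \<circ> Inv w, w)) ` W" by blast
  next
    fix p assume "p \<in> (\<lambda>w. (u \<circ> Inv w, w)) ` W"
    then obtain w where w: "p = (u \<circ> Inv w, w)" "w \<in> W" by auto
    then have "(u \<circ> Inv w) \<circ> w = u" by (simp only: Inv_cancel comp_assoc comp_id)
    then show "p \<in> {(v, w). v \<in> W \<and> w \<in> W \<and> v \<circ> w = u}" using w u W_comp by auto
  qed
  have "inj_on (\<lambda>w. (u \<circ> Inv w, w)) W" by (auto simp: inj_on_def)
  then show ?thesis by (simp add: QW_def eq sum.reindex)
qed

lemma QW_mult_supp: "supp (f \<otimes>\<^bsub>QW\<^esub> g)"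
  by (simp add: supp_def QW_mult_outside)

lemma coef_mult: "u \<in> W \<Longrightarrow> (coef q \<otimes>\<^bsub>QW\<^esub> f) u = act (Inv u) q * f u"
proof -
  assume u: "u \<in> W"
  have eq: "u \<circ> Inv w = id \<longleftrightarrow> w = u" if "w \<in> W" for w
    using that Inv_cancel by (metis comp_assoc comp_id id_comp)
  have "(coef q \<otimes>\<^bsub>QW\<^esub> f) u = (\<Sum>w\<in>W. if w = u then act (Inv u) q * f u else 0)"
    unfolding QW_mult[OF u] by (intro sum.cong refl) (auto simp: coef_def eq W_act)
  then show ?thesis using u finite_W by simp
qed

lemma id_in_W [simp]: "id \<in> W"
  by (rule W.id_W)

lemma mult_coef: "supp f \<Longrightarrow> f \<otimes>\<^bsub>QW\<^esub> coef q = (\<lambda>u. f u * q)"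
proof
  fix u assume f: "supp f"
  show "(f \<otimes>\<^bsub>QW\<^esub> coef q) u = f u * q"
  proof (cases "u \<in> W")
    case True
    have "(f \<otimes>\<^bsub>QW\<^esub> coef q) u = (\<Sum>w\<in>W. if w = id then f u * q else 0)"
      unfolding QW_mult[OF True] by (intro sum.cong refl) (auto simp: coef_def act_id inv_id)
    then show ?thesis using finite_W by simp
  next
    case False
    then show ?thesis using f by (simp add: QW_mult_outside supp_def)
  qed
qed

lemma delta_mult: "u \<in> W \<Longrightarrow> v \<in> W \<Longrightarrow> (delta v \<otimes>\<^bsub>QW\<^esub> f) u = f (Inv v \<circ> u)"
proof -
  assume u: "u \<in> W" and v: "v \<in> W"
  have eq: "u \<circ> Inv w = v \<longleftrightarrow> w = Inv v \<circ> u" if "w \<in> W" for w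
  proof
    assume "u \<circ> Inv w = v"
    then have "u = v \<circ> w" using that Inv_cancel(2) by (metis comp_assoc comp_id)
    then show "w = Inv v \<circ> u" using v Inv_cancel(2) by (metis comp_assoc id_comp)
  next
    assume "w = Inv v \<circ> u"
    then have "u = v \<circ> w" using v Inv_cancel(1) by (metis comp_assoc id_comp)
    then show "u \<circ> Inv w = v" using that Inv_cancel(1) by (metis comp_assoc comp_id)
  qed
  have "(delta v \<otimes>\<^bsub>QW\<^esub> f) u = (\<Sum>w\<in>W. if w = Inv v \<circ> u then f (Inv v \<circ> u) else 0)"
    unfolding QW_mult[OF u] by (intro sum.cong refl) (auto simp: delta_def eq W_act)
  then show ?thesis using u v finite_W by (simp add: W_comp)
qed

lemma QW_assoc: "(f \<otimes>\<^bsub>QW\<^esub> g) \<otimes>\<^bsub>QW\<^esub> h = f \<otimes>\<^bsub>QW\<^esub> (g \<otimes>\<^bsub>QW\<^esub> h)"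
proof
  fix u
  show "((f \<otimes>\<^bsub>QW\<^esub> g) \<otimes>\<^bsub>QW\<^esub> h) u = (f \<otimes>\<^bsub>QW\<^esub> (g \<otimes>\<^bsub>QW\<^esub> h)) u"
  proof (cases "u \<in> W")
    case u: True
    have "((f \<otimes>\<^bsub>QW\<^esub> g) \<otimes>\<^bsub>QW\<^esub> h) u =
        (\<Sum>w\<in>W. \<Sum>v\<in>W. act (Inv w \<circ> Inv v) (f (u \<circ> Inv w \<circ> Inv v)) * act (Inv w) (g v) * h w)"
      using u by (simp add: QW_mult W_comp W_act_sum W_act W_act_comp sum_distrib_right)
    also have "\<dots> = (\<Sum>w\<in>W. \<Sum>t\<in>W. act (Inv t) (f (u \<circ> Inv t)) * act (Inv w) (g (t \<circ> Inv w)) * h w)"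
    proof (rule sum.cong[OF refl])
      fix w assume w: "w \<in> W"
      have c: "(v \<circ> w) \<circ> Inv w = v" "(v \<circ> Inv w) \<circ> w = v" for v
        using w by (simp_all only: Inv_cancel comp_assoc comp_id)
      have "bij_betw (\<lambda>v. v \<circ> w) W W"
        by (rule bij_betwI[where g = "\<lambda>t. t \<circ> Inv w"]) (use w c in \<open>auto simp: W_comp\<close>)
      then have "(\<Sum>t\<in>W. act (Inv t) (f (u \<circ> Inv t)) * act (Inv w) (g (t \<circ> Inv w)) * h w) =
          (\<Sum>v\<in>W. act (Inv (v \<circ> w)) (f (u \<circ> Inv (v \<circ> w))) * act (Inv w) (g ((v \<circ> w) \<circ> Inv w)) * h w)"
        by (rule sum.reindex_bij_betw[symmetric])
      also have "\<dots> = (\<Sum>v\<in>W. act (Inv w \<circ> Inv v) (f (u \<circ> Inv w \<circ> Inv v)) * act (Inv w) (g v) * h w)"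
        using w by (intro sum.cong refl) (simp only: c Inv_comp o_assoc)
      finally show "(\<Sum>v\<in>W. act (Inv w \<circ> Inv v) (f (u \<circ> Inv w \<circ> Inv v)) * act (Inv w) (g v) * h w) =
          (\<Sum>t\<in>W. act (Inv t) (f (u \<circ> Inv t)) * act (Inv w) (g (t \<circ> Inv w)) * h w)" by simp
    qed
    also have "\<dots> = (\<Sum>t\<in>W. \<Sum>w\<in>W. act (Inv t) (f (u \<circ> Inv t)) * act (Inv w) (g (t \<circ> Inv w)) * h w)"
      by (rule sum.swap)
    also have "\<dots> = (f \<otimes>\<^bsub>QW\<^esub> (g \<otimes>\<^bsub>QW\<^esub> h)) u"
      using u by (simp add: QW_mult sum_distrib_left mult.assoc)
    finally show ?thesis .
  qed (simp add: QW_mult_outside)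
qed

lemma QW_distrib:
  "(\<lambda>u. f u + g u) \<otimes>\<^bsub>QW\<^esub> h = (\<lambda>u. (f \<otimes>\<^bsub>QW\<^esub> h) u + (g \<otimes>\<^bsub>QW\<^esub> h) u)"
  "h \<otimes>\<^bsub>QW\<^esub> (\<lambda>u. f u + g u) = (\<lambda>u. (h \<otimes>\<^bsub>QW\<^esub> f) u + (h \<otimes>\<^bsub>QW\<^esub> g) u)"
proof -
  show "(\<lambda>u. f u + g u) \<otimes>\<^bsub>QW\<^esub> h = (\<lambda>u. (f \<otimes>\<^bsub>QW\<^esub> h) u + (g \<otimes>\<^bsub>QW\<^esub> h) u)"
  proof
    fix u show "((\<lambda>u. f u + g u) \<otimes>\<^bsub>QW\<^esub> h) u = (f \<otimes>\<^bsub>QW\<^esub> h) u + (g \<otimes>\<^bsub>QW\<^esub> h) u"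
      by (cases "u \<in> W") (simp_all add: QW_mult QW_mult_outside W_act distrib_right sum.distrib)
  qed
  show "h \<otimes>\<^bsub>QW\<^esub> (\<lambda>u. f u + g u) = (\<lambda>u. (h \<otimes>\<^bsub>QW\<^esub> f) u + (h \<otimes>\<^bsub>QW\<^esub> g) u)"
  proof
    fix u show "(h \<otimes>\<^bsub>QW\<^esub> (\<lambda>u. f u + g u)) u = (h \<otimes>\<^bsub>QW\<^esub> f) u + (h \<otimes>\<^bsub>QW\<^esub> g) u"
      by (cases "u \<in> W") (simp_all add: QW_mult QW_mult_outside W_act distrib_left sum.distrib)
  qed
qed

lemma coef_supp [simp]: "supp (coef q)"
  by (auto simp: supp_def coef_def)

lemma coef_carrier [simp]: "q \<in> Q \<Longrightarrow> coef q \<in> carrier QW"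
  by (auto simp: QW_carrier) (auto simp: coef_def)

lemma QW_closed:
  assumes "f \<in> carrier QW" "g \<in> carrier QW"
  shows "(\<lambda>u. f u + g u) \<in> carrier QW" "(\<lambda>u. f u - g u) \<in> carrier QW" "(\<lambda>u. - f u) \<in> carrier QW"
    "f \<otimes>\<^bsub>QW\<^esub> g \<in> carrier QW"
proof -
  show "(\<lambda>u. f u + g u) \<in> carrier QW" "(\<lambda>u. f u - g u) \<in> carrier QW" "(\<lambda>u. - f u) \<in> carrier QW"
    using assms by (auto simp: QW_carrier supp_def Q_add Q_diff Q_uminus)
  show "f \<otimes>\<^bsub>QW\<^esub> g \<in> carrier QW"
    using assms QW_mult_supp[of f g] by (auto simp: QW_carrier QW_mult W_comp intro!: Q_sum Q_mult Q_act)
qed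

lemma QW_ring: "ring QW"
proof (rule ringI)
  show "abelian_group QW"
  proof (rule abelian_groupI)
    fix f assume "f \<in> carrier QW"
    then show "\<exists>g\<in>carrier QW. g \<oplus>\<^bsub>QW\<^esub> f = \<zero>\<^bsub>QW\<^esub>"
      by (intro bexI[of _ "\<lambda>u. - f u"]) (auto simp: QW_add QW_zero QW_closed)
  qed (auto simp: QW_add QW_zero QW_closed add_ac, simp add: QW_carrier supp_def)
  show "Group.monoid QW"
  proof (rule monoidI)
    fix f assume f: "f \<in> carrier QW"
    show "\<one>\<^bsub>QW\<^esub> \<otimes>\<^bsub>QW\<^esub> f = f"
    proof
      fix u show "(\<one>\<^bsub>QW\<^esub> \<otimes>\<^bsub>QW\<^esub> f) u = f u"
        using QW_supp[OF f] by (cases "u \<in> W") (simp_all add: QW_one coef_mult W_act QW_mult_outside supp_def)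
    qed
    show "f \<otimes>\<^bsub>QW\<^esub> \<one>\<^bsub>QW\<^esub> = f" using QW_supp[OF f] by (simp add: QW_one mult_coef)
  qed (auto simp: QW_closed QW_assoc QW_one)
qed (simp_all add: QW_add QW_distrib)

sublocale QW: ring QW by (rule QW_ring)

lemma QW_minus: "f \<in> carrier QW \<Longrightarrow> \<ominus>\<^bsub>QW\<^esub> f = (\<lambda>u. - f u)"
  by (rule QW.minus_equality) (auto simp: QW_add QW_zero QW_closed)

lemma QW_diff: "g \<in> carrier QW \<Longrightarrow> f \<ominus>\<^bsub>QW\<^esub> g = (\<lambda>u. f u - g u)"
  by (simp add: a_minus_def QW_minus QW_add)

lemma coef_hom: "coef (a + b) = coef a \<oplus>\<^bsub>QW\<^esub> coef b" "coef (a * b) = coef a \<otimes>\<^bsub>QW\<^esub> coef b"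
  by (auto simp: QW_add mult_coef) (auto simp: coef_def)

lemma scalar_central: "supp f \<Longrightarrow> coef (scalar r) \<otimes>\<^bsub>QW\<^esub> f = f \<otimes>\<^bsub>QW\<^esub> coef (scalar r)"
proof
  fix u assume f: "supp f"
  then show "(coef (scalar r) \<otimes>\<^bsub>QW\<^esub> f) u = (f \<otimes>\<^bsub>QW\<^esub> coef (scalar r)) u"
    by (cases "u \<in> W") (simp_all add: mult_coef coef_mult QW_mult_outside W_act, simp add: supp_def)
qed

abbreviation s :: "'i \<Rightarrow> 'l \<Rightarrow> 'l" where "s i \<equiv> reflection cr (al i)"

lemma s_W [simp]: "i \<in> I \<Longrightarrow> s i \<in> W"
  by (simp add: refl_in_W)

lemma s_invol: "i \<in> I \<Longrightarrow> s i \<circ> (s i \<circ> v) = v"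
  by (simp add: refl_refl_comp)

lemma Inv_s: "i \<in> I \<Longrightarrow> Inv (s i) = s i"
  by (intro inv_unique_comp) (auto simp: fun_eq_iff refl_invol)

lemma delta_carrier: "w \<in> W \<Longrightarrow> delta w \<in> carrier QW"
  by (auto simp: QW_carrier delta_def supp_def)

lemma Xel_carrier [simp]: "i \<in> I \<Longrightarrow> Xel i \<in> carrier QW"
  using Q_z[of "al i"] delta_carrier[of "s i"]
  by (simp add: Xel_def Xroot_def z_def inverse_eq_divide)

text \<open>Left multiplication by \<open>X\<^sub>i\<close> is a divided difference of functions on \<open>W\<close>. Products of
  the \<open>X\<^sub>i\<close> are computed with this formula only.\<close>

lemma X_mult:
  assumes "i \<in> I" "f \<in> carrier QW" "u \<in> W"
  shows "(Xel i \<otimes>\<^bsub>QW\<^esub> f) u = (f u - f (s i \<circ> u)) * z (Inv u (al i))"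
proof -
  have "Xel i \<otimes>\<^bsub>QW\<^esub> f = coef (z (al i)) \<otimes>\<^bsub>QW\<^esub> ((\<one>\<^bsub>QW\<^esub> \<ominus>\<^bsub>QW\<^esub> delta (s i)) \<otimes>\<^bsub>QW\<^esub> f)"
    by (simp add: Xel_def Xroot_def z_def inverse_eq_divide QW_assoc)
  also have "(\<one>\<^bsub>QW\<^esub> \<ominus>\<^bsub>QW\<^esub> delta (s i)) \<otimes>\<^bsub>QW\<^esub> f = f \<ominus>\<^bsub>QW\<^esub> (delta (s i) \<otimes>\<^bsub>QW\<^esub> f)"
    using assms delta_carrier[of "s i"] by (simp add: a_minus_def QW.l_distr QW.l_minus)
  also have "\<dots> = (\<lambda>u. f u - (delta (s i) \<otimes>\<^bsub>QW\<^esub> f) u)"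
    using assms delta_carrier[of "s i"] by (intro QW_diff) (simp add: QW_closed)
  finally show ?thesis
    using assms by (simp add: coef_mult delta_mult Inv_s W_act)
qed

end

section \<open>The braid relations as polynomial identities\<close>

text \<open>The divided difference for an involution \<open>s\<close> on a set of points, with \<open>t\<close> in the place of
  the inverse of the root.\<close>

definition divdiff :: "('u \<Rightarrow> 'u) \<Rightarrow> ('u \<Rightarrow> 'a) \<Rightarrow> ('u \<Rightarrow> 'a) \<Rightarrow> 'u \<Rightarrow> 'a::comm_ring_1" where
  "divdiff s t f = (\<lambda>v. (f v - f (s v)) * t v)"

text \<open>The element \<open>\<kappa>\<close> for \<open>a \<alpha>\<^sub>i + b \<alpha>\<^sub>j\<close> and \<open>c
  \<alpha>\<^sub>i + d \<alpha>\<^sub>j\<close>, as a polynomial in the inverses \<open>y\<close>.\<close>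

definition kap :: "('u \<Rightarrow> int \<Rightarrow> int \<Rightarrow> 'a::comm_ring_1) \<Rightarrow> int \<Rightarrow> int \<Rightarrow> int \<Rightarrow> int \<Rightarrow> 'u \<Rightarrow> 'a" where
  "kap y a b c d = (\<lambda>v. y v (a + c) (b + d) * y v c d - y v (a + c) (b + d) * y v (- a) (- b) - y v a b * y v c d)"

text \<open>A dihedral group acts on a set of points, and \<open>y v n m\<close> plays the role of the value at the point
  \<open>v\<close> of the inverse of \<open>x\<close> at \<open>n \<alpha>\<^sub>i + m \<alpha>\<^sub>j\<close>. Apart from their
  equivariance these values are independent; the parameter \<open>c\<close> is \<open>- \<langle>\<alpha>\<^sub>j\<^sup>\<or>,
  \<alpha>\<^sub>i\<rangle>\<close>, while \<open>\<langle>\<alpha>\<^sub>i\<^sup>\<or>, \<alpha>\<^sub>j\<rangle> = -1\<close>. The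
  braid relations are identities between polynomials in the values \<open>y v n m\<close> and the \<open>2 m\<^sub>i\<^sub>j\<close>
  values of \<open>f\<close> on an orbit.\<close>

locale dihedral_identity =
  fixes si sj :: "'u \<Rightarrow> 'u" and y :: "'u \<Rightarrow> int \<Rightarrow> int \<Rightarrow> 'a::field" and c :: int
  assumes invol [simp]: "\<And>v. si (si v) = v" "\<And>v. sj (sj v) = v"
    and y_si [simp]: "\<And>v n m. y (si v) n m = y v (m - n) m"
    and y_sj [simp]: "\<And>v n m. y (sj v) n m = y v n (c * n - m)"
begin

abbreviation DI :: "('u \<Rightarrow> 'a) \<Rightarrow> 'u \<Rightarrow> 'a" where "DI \<equiv> divdiff si (\<lambda>v. y v 1 0)"
abbreviation DJ :: "('u \<Rightarrow> 'a) \<Rightarrow> 'u \<Rightarrow> 'a" where "DJ \<equiv> divdiff sj (\<lambda>v. y v 0 1)"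

lemma braid_A2:
  assumes [simp]: "c = 1" "\<And>v. sj (si (sj v)) = si (sj (si v))"
  shows "DJ (DI (DJ f)) v - DI (DJ (DI f)) v = DI (\<lambda>v. kap y 1 0 0 1 v * f v) v - DJ (\<lambda>v. kap y 0 1 1 0 v * f v) v"
  unfolding divdiff_def kap_def by simp Groebner_Basis.algebra

lemma braid_B2:
  assumes [simp]: "c = 2" "\<And>v. sj (si (sj (si v))) = si (sj (si (sj v)))"
  defines "A \<equiv> \<lambda>v. kap y 1 2 0 (-1) v + kap y 0 1 1 0 v" and "B \<equiv> \<lambda>v. kap y 1 1 0 1 v + kap y 1 0 0 1 v"
  shows "DJ (DI (DJ (DI f))) v - DI (DJ (DI (DJ f))) v =
    DI (DJ (\<lambda>v. A v * f v)) v - DJ (DI (\<lambda>v. B v * f v)) v + DJ (\<lambda>v. DI B v * f v) v - DI (\<lambda>v. DJ A v * f v) v"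
  unfolding divdiff_def kap_def A_def B_def by simp Groebner_Basis.algebra

text \<open>The elements \<open>\<xi>\<^sub>i\<^sub>j\<close> and \<open>\<xi>\<^sub>j\<^sub>i\<close> as polynomials in the
  inverses \<open>y\<close>.\<close>

definition xij :: "'u \<Rightarrow> 'a" where
  "xij = (\<lambda>v. y v 1 0 * y v 1 1 * y v 1 2 * y v 2 3
    + y v 1 0 * y v 0 1 * y v 1 2 * y v (-2) (-3)
    + y v 1 0 * y v 0 1 * y v 2 3 * y v (-1) (-1)
    - y v 1 0 * y v 1 1 * y v 1 2 * y v (-1) (-3)
    - y v 1 0 * y v 1 1 * y v 1 3 * y v 0 (-1)
    + y v 1 1 * y v 1 3 * y v 0 (-1) * y v (-2) (-3)
    + y v 1 3 * y v 2 3 * y v 0 (-1) * y v (-1) (-2)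
    + y v 1 1 * y v 1 2 * y v (-1) (-3) * y v (-2) (-3)
    - y v 1 0 * y v 0 1 * y v 1 2 * y v 1 3)"

definition xji :: "'u \<Rightarrow> 'a" where
  "xji = (\<lambda>v. y v 1 0 * y v 0 1 * y v 2 3 * y v (-1) (-2)
    + y v 1 0 * y v 0 1 * y v 1 2 * y v (-1) (-3)
    + y v 0 1 * y v 1 2 * y v 1 3 * y v 2 3
    - y v 1 0 * y v 0 1 * y v 1 1 * y v 2 3
    + y v 1 1 * y v 1 2 * y v (-1) 0 * y v (-2) (-3)
    + y v 1 3 * y v 2 3 * y v (-1) (-1) * y v (-1) (-2)
    + y v 1 1 * y v 1 3 * y v (-1) 0 * y v (-1) (-2)
    - y v 0 1 * y v 1 3 * y v 2 3 * y v (-1) (-1)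
    - y v 0 1 * y v 1 1 * y v 1 3 * y v (-1) 0)"

lemma braid_G2:
  assumes [simp]: "c = 3" "\<And>v. sj (si (sj (si (sj (si v))))) = si (sj (si (sj (si (sj v)))))"
  defines "A \<equiv> \<lambda>v. kap y 0 1 1 0 v + kap y 2 3 (-1) (-2) v + kap y (-1) (-3) 1 2 v + kap y 1 2 0 (-1) v"
    and "B \<equiv> \<lambda>v. kap y 1 0 0 1 v + kap y (-2) (-3) 1 2 v + kap y (-1) (-2) 1 3 v + kap y 1 1 0 1 v"
  shows "DJ (DI (DJ (DI (DJ (DI f))))) v - DI (DJ (DI (DJ (DI (DJ f))))) v =
    DI (DJ (DI (DJ (\<lambda>v. A v * f v)))) v - DJ (DI (DJ (DI (\<lambda>v. B v * f v)))) v
    + DJ (DI (DJ (\<lambda>v. DI B v * f v))) v - DI (DJ (DI (\<lambda>v. DJ A v * f v))) v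
    + DI (DJ (\<lambda>v. xij v * f v)) v - DJ (DI (\<lambda>v. xji v * f v)) v
    + DJ (\<lambda>v. DI xji v * f v) v - DI (\<lambda>v. DJ xij v * f v) v"
  unfolding divdiff_def kap_def A_def B_def xij_def xji_def by simp Groebner_Basis.algebra

end

section \<open>The relations in the twisted algebra\<close>

context formal_demazure
begin

lemma z_div: "1 / x l = z l" "1 / (x l * x m) = z l * z m" "1 / (a * x m) = (1 / a) * z m"
  by (simp_all add: z_def divide_inverse)

text \<open>The function \<open>v \<mapsto> v\<^sup>-\<^sup>1(q)\<close>. Left multiplication by a coefficient is pointwise
  multiplication by such a function, and left multiplication by \<open>X\<^sub>i\<close> is a divided difference.\<close>

definition tw :: "'k \<Rightarrow> ('l \<Rightarrow> 'l) \<Rightarrow> 'k" where "tw q v = (if v \<in> W then act (Inv v) q else 0)"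

definition Xop :: "'i \<Rightarrow> (('l \<Rightarrow> 'l) \<Rightarrow> 'k) \<Rightarrow> ('l \<Rightarrow> 'l) \<Rightarrow> 'k" where
  "Xop i = divdiff (\<lambda>v. s i \<circ> v) (tw (z (al i)))"

lemma tw_hom: "tw (a + b) v = tw a v + tw b v" "tw (a - b) v = tw a v - tw b v" "tw (a * b) v = tw a v * tw b v"
  "tw 0 v = 0"
  by (simp_all add: tw_def W_act)

lemma s_comp_W: "i \<in> I \<Longrightarrow> s i \<circ> v \<in> W \<longleftrightarrow> v \<in> W"
  using s_invol[of i v] W_comp[of "s i" v] W_comp[of "s i" "s i \<circ> v"] by auto

lemma tw_s: "i \<in> I \<Longrightarrow> tw q (s i \<circ> v) = tw (act (s i) q) v"
  by (auto simp: tw_def s_comp_W Inv_comp Inv_s W_act_comp)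

lemma Xop_tw: "i \<in> I \<Longrightarrow> Xop i (tw q) = tw (Dlt i q)"
  by (rule ext) (simp add: Xop_def divdiff_def Dlt_def Dop_def tw_s divide_inverse tw_hom flip: z_def)

lemma X_mult_Xop: "i \<in> I \<Longrightarrow> f \<in> carrier QW \<Longrightarrow> Xel i \<otimes>\<^bsub>QW\<^esub> f = Xop i f"
proof
  fix v assume "i \<in> I" "f \<in> carrier QW"
  then show "(Xel i \<otimes>\<^bsub>QW\<^esub> f) v = Xop i f v"
    by (cases "v \<in> W") (simp_all add: X_mult Xop_def divdiff_def tw_def W_act QW_mult_outside)
qed

lemma coef_mult_tw: "coef q \<otimes>\<^bsub>QW\<^esub> f = (\<lambda>v. tw q v * f v)"
proof
  fix v show "(coef q \<otimes>\<^bsub>QW\<^esub> f) v = tw q v * f v"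
    by (cases "v \<in> W") (simp_all add: coef_mult tw_def QW_mult_outside)
qed

abbreviation E :: "('l \<Rightarrow> 'l) \<Rightarrow> 'k" where "E \<equiv> coef 1"

lemma coef_tw: "coef q = (\<lambda>v. tw q v * E v)"
  by (auto simp: coef_def tw_def act_id inv_id)

lemma mono_simps [simp]:
  "monomial QW Xel [] = E" "monomial QW Xel (k # ks) = Xel k \<otimes>\<^bsub>QW\<^esub> monomial QW Xel ks"
  by (simp_all add: monomial_def QW_one)

lemma mono_carrier: "set ks \<subseteq> I \<Longrightarrow> monomial QW Xel ks \<in> carrier QW"
  by (induction ks) auto

lemma mono_coef: "set ks \<subseteq> I \<Longrightarrow> q \<in> Q \<Longrightarrow> monomial QW Xel ks \<otimes>\<^bsub>QW\<^esub> coef q = foldr Xop ks (coef q)"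
proof (induction ks)
  case Nil
  then show ?case using QW.l_one[of "coef q"] by (simp add: QW_one)
next
  case (Cons k ks)
  have c: "monomial QW Xel ks \<otimes>\<^bsub>QW\<^esub> coef q \<in> carrier QW"
    using Cons.prems mono_carrier[of ks] by simp
  have "monomial QW Xel (k # ks) \<otimes>\<^bsub>QW\<^esub> coef q = Xop k (monomial QW Xel ks \<otimes>\<^bsub>QW\<^esub> coef q)"
    using X_mult_Xop[OF _ c, of k] Cons.prems by (simp add: QW_assoc)
  then show ?case using Cons by simp
qed

lemma mono_Xop: "set ks \<subseteq> I \<Longrightarrow> monomial QW Xel ks = foldr Xop ks E"
  using mono_coef[of ks 1] mono_carrier[of ks] QW_supp by (simp add: mult_coef)

lemma kappa_z: "kappa l n = z (l + n) * z n - z (l + n) * z (- l) - z l * z n"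
  by (simp add: kappa_def z_div)

lemma kappa_Q [simp]: "kappa l n \<in> Q"
  unfolding kappa_z by (intro Q_diff Q_mult Q_z)

definition ys :: "'i \<Rightarrow> 'i \<Rightarrow> ('l \<Rightarrow> 'l) \<Rightarrow> int \<Rightarrow> int \<Rightarrow> 'k" where
  "ys i j v n m = tw (z (rt i j n m)) v"

text \<open>The points are the elements of \<open>W\<close>, on which the simple reflections act by left multiplication.\<close>

lemma dihedral:
  assumes "i \<in> I" "j \<in> I" "cr (al i) (al j) = -1" "cr (al j) (al i) = - c"
  shows "dihedral_identity (\<lambda>v. s i \<circ> v) (\<lambda>v. s j \<circ> v) (ys i j) c"
  using assms by unfold_locales (simp_all add: s_invol ys_def tw_s W_act refl_rt algebra_simps)

lemma rt_simps: "rt i j n m + rt i j n' m' = rt i j (n + n') (m + m')" "- rt i j n m = rt i j (- n) (- m)"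
  by (simp_all add: rt_def zsmul_add zsmul_minus_left)

lemma kap_ys: "kap (ys i j) a b c d = tw (kappa (rt i j a b) (rt i j c d))"
  by (rule ext) (simp add: kap_def ys_def kappa_z tw_hom rt_simps)

lemma kappa_al: "kappa (al i) (al j) = kappa (rt i j 1 0) (rt i j 0 1)" "kappa (al j) (al i) = kappa (rt i j 0 1) (rt i j 1 0)"
  by (simp_all flip: al_rt)

lemma Xop_ys: "Xop i = divdiff (\<lambda>v. s i \<circ> v) (\<lambda>v. ys i j v 1 0)" "Xop j = divdiff (\<lambda>v. s j \<circ> v) (\<lambda>v. ys i j v 0 1)"
  by (simp_all add: Xop_def ys_def[abs_def] flip: al_rt)

lemma wd_braid_comp: "(p, q) \<in> braids \<Longrightarrow> wd p \<circ> v = wd q \<circ> v"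
  by (simp add: braid_wd)

text \<open>The coefficients of the leading terms on the right of the braid relations with \<open>m\<^sub>i\<^sub>j = 4,
  6\<close>.\<close>

abbreviation B2A :: "'i \<Rightarrow> 'i \<Rightarrow> 'k" where
  "B2A i j \<equiv> kappa (rt i j 1 2) (rt i j 0 (-1)) + kappa (al j) (al i)"

abbreviation B2B :: "'i \<Rightarrow> 'i \<Rightarrow> 'k" where
  "B2B i j \<equiv> kappa (rt i j 1 1) (rt i j 0 1) + kappa (al i) (al j)"

abbreviation G2A :: "'i \<Rightarrow> 'i \<Rightarrow> 'k" where
  "G2A i j \<equiv> kappa (al j) (al i) + kappa (rt i j 2 3) (rt i j (-1) (-2)) + kappa (rt i j (-1) (-3)) (rt i j 1 2) + kappa (rt i j 1 2) (rt i j 0 (-1))"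

abbreviation G2B :: "'i \<Rightarrow> 'i \<Rightarrow> 'k" where
  "G2B i j \<equiv> kappa (al i) (al j) + kappa (rt i j (-2) (-3)) (rt i j 1 2) + kappa (rt i j (-1) (-2)) (rt i j 1 3) + kappa (rt i j 1 1) (rt i j 0 1)"

lemma Xop_A2:
  assumes "i \<in> I" "j \<in> I" "i \<noteq> j" "cr (al i) (al j) = -1" "cr (al j) (al i) = -1"
  shows "Xop j (Xop i (Xop j f)) v - Xop i (Xop j (Xop i f)) v =
    Xop i (\<lambda>v. tw (kappa (al i) (al j)) v * f v) v - Xop j (\<lambda>v. tw (kappa (al j) (al i)) v * f v) v"
proof -
  interpret dihedral_identity "\<lambda>v. s i \<circ> v" "\<lambda>v. s j \<circ> v" "ys i j" 1
    by (rule dihedral) (use assms in auto)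
  have "([j, i, j], [i, j, i]) \<in> braids" using assms by (auto simp: braids_def)
  from wd_braid_comp[OF this] show ?thesis
    unfolding Xop_ys(1)[of i j] Xop_ys(2)[of j i] kappa_al(1)[of i j] kappa_al(2)[of j i] kap_ys[symmetric]
    by (intro braid_A2) (simp_all add: comp_assoc)
qed

lemma Xop_B2:
  assumes "i \<in> I" "j \<in> I" "i \<noteq> j" "cr (al i) (al j) = -1" "cr (al j) (al i) = -2"
  defines "A \<equiv> B2A i j"
    and "B \<equiv> B2B i j"
  shows "Xop j (Xop i (Xop j (Xop i f))) v - Xop i (Xop j (Xop i (Xop j f))) v =
    Xop i (Xop j (\<lambda>v. tw A v * f v)) v - Xop j (Xop i (\<lambda>v. tw B v * f v)) v +
    Xop j (\<lambda>v. tw (Dlt i B) v * f v) v - Xop i (\<lambda>v. tw (Dlt j A) v * f v) v"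
proof -
  interpret dihedral_identity "\<lambda>v. s i \<circ> v" "\<lambda>v. s j \<circ> v" "ys i j" 2
    by (rule dihedral) (use assms in auto)
  have "([j, i, j, i], [i, j, i, j]) \<in> braids" using assms by (auto simp: braids_def)
  note b = wd_braid_comp[OF this]
  have tA: "tw A = (\<lambda>v. kap (ys i j) 1 2 0 (-1) v + kap (ys i j) 0 1 1 0 v)"
    and tB: "tw B = (\<lambda>v. kap (ys i j) 1 1 0 1 v + kap (ys i j) 1 0 0 1 v)"
    by (simp_all add: A_def B_def kap_ys kappa_al(1)[of i j] kappa_al(2)[of j i] fun_eq_iff tw_hom)
  show ?thesis
    unfolding Xop_tw[OF assms(1), symmetric] Xop_tw[OF assms(2), symmetric] Xop_ys(1)[of i j] Xop_ys(2)[of j i] tA tB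
    by (intro braid_B2) (use b in \<open>simp_all add: comp_assoc\<close>)
qed

lemma xi_ys:
  assumes "i \<in> I" "j \<in> I" "cr (al i) (al j) = -1" "cr (al j) (al i) = -3"
  shows "tw (xi_ij i j) = dihedral_identity.xij (ys i j)" "tw (xi_ji i j) = dihedral_identity.xji (ys i j)"
proof -
  interpret dihedral_identity "\<lambda>v. s i \<circ> v" "\<lambda>v. s j \<circ> v" "ys i j" 3
    by (rule dihedral) (use assms in auto)
  show "tw (xi_ij i j) = xij" "tw (xi_ji i j) = xji"
    by (simp_all add: fun_eq_iff xi_ij_def xi_ji_def xij_def xji_def Let_def ys_def z_div tw_hom)
qed

lemma Xop_G2:
  assumes "i \<in> I" "j \<in> I" "i \<noteq> j" "cr (al i) (al j) = -1" "cr (al j) (al i) = -3"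
  defines "A \<equiv> G2A i j"
    and "B \<equiv> G2B i j"
  shows "Xop j (Xop i (Xop j (Xop i (Xop j (Xop i f))))) v - Xop i (Xop j (Xop i (Xop j (Xop i (Xop j f))))) v =
    Xop i (Xop j (Xop i (Xop j (\<lambda>v. tw A v * f v)))) v - Xop j (Xop i (Xop j (Xop i (\<lambda>v. tw B v * f v)))) v
    + Xop j (Xop i (Xop j (\<lambda>v. tw (Dlt i B) v * f v))) v - Xop i (Xop j (Xop i (\<lambda>v. tw (Dlt j A) v * f v))) v
    + Xop i (Xop j (\<lambda>v. tw (xi_ij i j) v * f v)) v - Xop j (Xop i (\<lambda>v. tw (xi_ji i j) v * f v)) v
    + Xop j (\<lambda>v. tw (Dlt i (xi_ji i j)) v * f v) v - Xop i (\<lambda>v. tw (Dlt j (xi_ij i j)) v * f v) v"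
proof -
  interpret dihedral_identity "\<lambda>v. s i \<circ> v" "\<lambda>v. s j \<circ> v" "ys i j" 3
    by (rule dihedral) (use assms in auto)
  have "([j, i, j, i, j, i], [i, j, i, j, i, j]) \<in> braids" using assms by (auto simp: braids_def)
  note b = wd_braid_comp[OF this]
  have tA: "tw A = (\<lambda>v. kap (ys i j) 0 1 1 0 v + kap (ys i j) 2 3 (-1) (-2) v + kap (ys i j) (-1) (-3) 1 2 v + kap (ys i j) 1 2 0 (-1) v)"
    and tB: "tw B = (\<lambda>v. kap (ys i j) 1 0 0 1 v + kap (ys i j) (-2) (-3) 1 2 v + kap (ys i j) (-1) (-2) 1 3 v + kap (ys i j) 1 1 0 1 v)"
    by (simp_all add: A_def B_def kap_ys kappa_al(1)[of i j] kappa_al(2)[of j i] fun_eq_iff tw_hom)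
  show ?thesis
    unfolding Xop_tw[OF assms(1), symmetric] Xop_tw[OF assms(2), symmetric] Xop_ys(1)[of i j] Xop_ys(2)[of j i] tA tB
      xi_ys[OF assms(1,2,4,5)]
    by (intro braid_G2) (use b in \<open>simp_all add: comp_assoc\<close>)
qed

lemma xi_Q [simp]: "xi_ij i j \<in> Q" "xi_ji i j \<in> Q"
  unfolding xi_ij_def xi_ji_def Let_def z_div by (intro Q_add Q_diff Q_mult Q_z)+

lemma Dlt_Q: "i \<in> I \<Longrightarrow> q \<in> Q \<Longrightarrow> Dlt i q \<in> Q"
  by (simp add: Dlt_def Dop_def divide_inverse Q_mult Q_diff Q_act flip: z_def)

lemma kappa1_z: "kappa1 i = z (al i) + z (- al i)"
  by (simp add: kappa1_def z_div)

lemma Q_kappa1 [simp]: "kappa1 i \<in> Q"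
  by (simp add: kappa1_z Q_add)

lemma relation_1:
  assumes "i \<in> I" "q \<in> Q"
  shows "coef q \<otimes>\<^bsub>QW\<^esub> Xel i = Xel i \<otimes>\<^bsub>QW\<^esub> coef (act (s i) q) \<oplus>\<^bsub>QW\<^esub> coef (Dlt i q)"
proof -
  have X: "Xel i = Xop i E" using mono_Xop[of "[i]"] assms mult_coef[OF QW_supp[OF Xel_carrier[of i]], of 1] by simp
  have "coef q \<otimes>\<^bsub>QW\<^esub> Xel i = (\<lambda>v. tw q v * Xop i E v)" unfolding X by (rule coef_mult_tw)
  moreover have "Xel i \<otimes>\<^bsub>QW\<^esub> coef (act (s i) q) = Xop i (coef (act (s i) q))"
    using assms by (intro X_mult_Xop) (simp_all add: Q_act)
  moreover have "coef (Dlt i q) = (\<lambda>v. Xop i (tw q) v * E v)"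
    unfolding Xop_tw[OF assms(1)] by (rule coef_tw)
  moreover have "tw (act (s i) q) (s i \<circ> v) = tw q v" for v
    using assms(1) tw_s[OF assms(1), of q "s i \<circ> v"] by (simp add: s_invol)
  ultimately show ?thesis
    using assms(1) by (simp add: QW_add coef_tw[of "act (s i) q"] Xop_def divdiff_def fun_eq_iff)
      (simp add: tw_s[symmetric] algebra_simps)
qed

lemma relation_2:
  assumes "i \<in> I"
  shows "Xel i \<otimes>\<^bsub>QW\<^esub> Xel i = Xel i \<otimes>\<^bsub>QW\<^esub> coef (kappa1 i)"
proof -
  have X: "Xel i = Xop i E" using mono_Xop[of "[i]"] assms mult_coef[OF QW_supp[OF Xel_carrier[of i]], of 1] by simp
  have XX: "Xel i \<otimes>\<^bsub>QW\<^esub> Xel i = Xop i (Xop i E)" using assms X_mult_Xop[of i "Xel i"] unfolding X[symmetric] by simp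
  have Xk: "Xel i \<otimes>\<^bsub>QW\<^esub> coef (kappa1 i) = Xop i (coef (kappa1 i))" using assms by (intro X_mult_Xop) auto
  have t1: "tw (z (al i)) (s i \<circ> v) = tw (z (- al i)) v" for v
    using assms by (simp add: tw_s W_act refl_self)
  have t2: "tw (z (- al i)) (s i \<circ> v) = tw (z (al i)) v" for v
    using assms by (simp add: tw_s W_act refl_self refl_simps)
  have Xk': "Xel i \<otimes>\<^bsub>QW\<^esub> coef (kappa1 i) = Xop i (\<lambda>v. tw (kappa1 i) v * E v)"
    unfolding coef_tw[of "kappa1 i", symmetric] by (rule Xk)
  show ?thesis
    unfolding XX Xk'
    using assms by (simp add: Xop_def divdiff_def fun_eq_iff kappa1_z tw_hom s_invol t1 t2 algebra_simps)
qed

lemma relation_3: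
  assumes "i \<in> I" "j \<in> I" "cr (al i) (al j) = 0"
  shows "Xel i \<otimes>\<^bsub>QW\<^esub> Xel j = Xel j \<otimes>\<^bsub>QW\<^esub> Xel i"
proof -
  have X: "Xel k = Xop k E" if "k \<in> I" for k
    using mono_Xop[of "[k]"] that mult_coef[OF QW_supp[OF Xel_carrier[of k]], of 1] by simp
  have ji: "cr (al j) (al i) = 0" by (rule cartan_zero(2)[OF assms])
  have "([i, j], [j, i]) \<in> braids" using assms by (auto simp: braids_def)
  from wd_braid_comp[OF this] have comm: "s i \<circ> (s j \<circ> v) = s j \<circ> (s i \<circ> v)" for v by (simp add: comp_assoc)
  have t: "tw (z (al i)) (s j \<circ> v) = tw (z (al i)) v" "tw (z (al j)) (s i \<circ> v) = tw (z (al j)) v" for v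
    using assms ji by (simp_all add: tw_s W_act reflection_def)
  have XX: "Xel i \<otimes>\<^bsub>QW\<^esub> Xel j = Xop i (Xop j E)" "Xel j \<otimes>\<^bsub>QW\<^esub> Xel i = Xop j (Xop i E)"
    using assms X_mult_Xop[of i "Xel j"] X_mult_Xop[of j "Xel i"]
    unfolding X[OF assms(1), symmetric] X[OF assms(2), symmetric] by simp_all
  show ?thesis unfolding XX by (simp add: Xop_def divdiff_def fun_eq_iff t comm algebra_simps)
qed

text \<open>The relations other than the braid relations are short computations with divided differences. The braid relations are
  the identities for \<open>Xop\<close> applied to the unit \<open>E\<close>.\<close>

theorem relations_hold: "\<forall>(lhs, rhs) \<in> relations QW coef Xel Q. lhs = rhs"
proof -
  have X: "Xel k \<otimes>\<^bsub>QW\<^esub> coef q = Xop k (coef q)" if "k \<in> I" "q \<in> Q" for k q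
    using that by (intro X_mult_Xop) auto
  have closed: "monomial QW Xel ks \<otimes>\<^bsub>QW\<^esub> coef q \<in> carrier QW" if "set ks \<subseteq> I" "q \<in> Q" for ks q
    using that mono_carrier by simp
  note side = list.set insert_subset empty_subsetI simp_thms
  note Q_intros = kappa_Q Q_add Dlt_Q xi_Q
  have Xclosed: "Xel k \<otimes>\<^bsub>QW\<^esub> coef q \<in> carrier QW" if "k \<in> I" "q \<in> Q" for k q
    using that by simp
  have r4a: "lhs = rhs" if "(lhs, rhs) \<in> rel4a QW coef Xel" for lhs rhs
  proof -
    from that obtain i j where ij: "i \<in> I" "j \<in> I" "i \<noteq> j" "cr (al i) (al j) = -1" "cr (al j) (al i) = -1"
      and e: "(lhs, rhs) = ((monomial QW Xel [j,i,j] \<ominus>\<^bsub>QW\<^esub> monomial QW Xel [i,j,i],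
        Xel i \<otimes>\<^bsub>QW\<^esub> coef (kappa (al i) (al j)) \<ominus>\<^bsub>QW\<^esub> Xel j \<otimes>\<^bsub>QW\<^esub> coef (kappa (al j) (al i))))"
      unfolding rel4a_def Let_def by blast
    have l: "lhs = (\<lambda>v. foldr Xop [j,i,j] E v - foldr Xop [i,j,i] E v)"
      using e ij by (simp only: prod.inject Let_def QW_diff[OF mono_carrier] side) (simp only: mono_Xop side)
    show ?thesis
      unfolding l using e ij Xop_A2[OF ij, of E]
      by (simp only: prod.inject Let_def QW_diff QW_add closed Xclosed side Q_intros)
        (simp only: mono_coef X side Q_intros foldr.simps comp_apply id_apply fun_eq_iff flip: coef_tw)
  qed
  have r4b: "lhs = rhs" if "(lhs, rhs) \<in> rel4b QW coef Xel" for lhs rhs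
  proof -
    from that obtain i j where ij: "i \<in> I" "j \<in> I" "i \<noteq> j" "cr (al i) (al j) = -1" "cr (al j) (al i) = -2"
      and e: "(lhs, rhs) = (let A = B2A i j; B = B2B i j in (monomial QW Xel [j,i,j,i] \<ominus>\<^bsub>QW\<^esub> monomial QW Xel [i,j,i,j],
        monomial QW Xel [i,j] \<otimes>\<^bsub>QW\<^esub> coef A \<ominus>\<^bsub>QW\<^esub> monomial QW Xel [j,i] \<otimes>\<^bsub>QW\<^esub> coef B \<oplus>\<^bsub>QW\<^esub> Xel j \<otimes>\<^bsub>QW\<^esub> coef (Dlt i B) \<ominus>\<^bsub>QW\<^esub> Xel i \<otimes>\<^bsub>QW\<^esub> coef (Dlt j A)))"
      unfolding rel4b_def Let_def by blast
    have l: "lhs = (\<lambda>v. foldr Xop [j,i,j,i] E v - foldr Xop [i,j,i,j] E v)"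
      using e ij by (simp only: prod.inject Let_def QW_diff[OF mono_carrier] side) (simp only: mono_Xop side)
    show ?thesis
      unfolding l using e ij Xop_B2[OF ij, of E]
      by (simp only: prod.inject Let_def QW_diff QW_add closed Xclosed side Q_intros)
        (simp only: mono_coef X side Q_intros foldr.simps comp_apply id_apply fun_eq_iff flip: coef_tw)
  qed
  have r4c: "lhs = rhs" if "(lhs, rhs) \<in> rel4c QW coef Xel" for lhs rhs
  proof -
    from that obtain i j where ij: "i \<in> I" "j \<in> I" "i \<noteq> j" "cr (al i) (al j) = -1" "cr (al j) (al i) = -3"
      and e: "(lhs, rhs) = (let A = G2A i j;
                 B = G2B i j in (monomial QW Xel [j,i,j,i,j,i] \<ominus>\<^bsub>QW\<^esub> monomial QW Xel [i,j,i,j,i,j],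
        monomial QW Xel [i,j,i,j] \<otimes>\<^bsub>QW\<^esub> coef A \<ominus>\<^bsub>QW\<^esub> monomial QW Xel [j,i,j,i] \<otimes>\<^bsub>QW\<^esub> coef B
          \<oplus>\<^bsub>QW\<^esub> monomial QW Xel [j,i,j] \<otimes>\<^bsub>QW\<^esub> coef (Dlt i B) \<ominus>\<^bsub>QW\<^esub> monomial QW Xel [i,j,i] \<otimes>\<^bsub>QW\<^esub> coef (Dlt j A)
          \<oplus>\<^bsub>QW\<^esub> monomial QW Xel [i,j] \<otimes>\<^bsub>QW\<^esub> coef (xi_ij i j) \<ominus>\<^bsub>QW\<^esub> monomial QW Xel [j,i] \<otimes>\<^bsub>QW\<^esub> coef (xi_ji i j)
          \<oplus>\<^bsub>QW\<^esub> Xel j \<otimes>\<^bsub>QW\<^esub> coef (Dlt i (xi_ji i j)) \<ominus>\<^bsub>QW\<^esub> Xel i \<otimes>\<^bsub>QW\<^esub> coef (Dlt j (xi_ij i j))))"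
      unfolding rel4c_def Let_def by blast
    have l: "lhs = (\<lambda>v. foldr Xop [j,i,j,i,j,i] E v - foldr Xop [i,j,i,j,i,j] E v)"
      using e ij by (simp only: prod.inject Let_def QW_diff[OF mono_carrier] side) (simp only: mono_Xop side)
    show ?thesis
      unfolding l using e ij Xop_G2[OF ij, of E]
      by (simp only: prod.inject Let_def QW_diff QW_add closed Xclosed side Q_intros)
        (simp only: mono_coef X side Q_intros foldr.simps comp_apply id_apply fun_eq_iff flip: coef_tw)
  qed
  have r1: "lhs = rhs" if "(lhs, rhs) \<in> rel1 QW coef Xel Q" for lhs rhs
    using that relation_1 unfolding rel1_def by blast
  have r2: "lhs = rhs" if "(lhs, rhs) \<in> rel2 QW coef Xel" for lhs rhs
    using that relation_2 unfolding rel2_def by blast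
  have r3: "lhs = rhs" if "(lhs, rhs) \<in> rel3 QW Xel" for lhs rhs
    using that relation_3 unfolding rel3_def by blast
  show ?thesis
    using r1 r2 r3 r4a r4b r4c unfolding relations_def by blast
qed

end

section \<open>Integrality of the structure coefficients\<close>

context formal_demazure
begin

text \<open>The reflection \<open>s\<^sub>i\<close> moves every lattice point by a multiple of \<open>al i\<close>.\<close>

lemma Dlt_S: "i \<in> I \<Longrightarrow> q \<in> S \<Longrightarrow> Dlt i q \<in> S"
proof -
  assume i: "i \<in> I" and q: "q \<in> S"
  have dx: "\<exists>g\<in>S. x l - x (s i l) = x (al i) * g" for l
  proof -
    have "s i l + zsmul (cr (al i) l) (al i) = l" by (simp add: reflection_def)
    then show ?thesis using x_diff_multiple[of "s i l" "cr (al i) l" "al i"] by simp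
  qed
  then obtain g where "g \<in> S" "q - act (s i) q = x (al i) * g"
    using divided_difference[OF dx W_aut[OF s_W[OF i]] q] by blast
  then show ?thesis using x_eq_0_iff[of "al i"] Phi_nonzero[of "al i"] i by (simp add: Dlt_def Dop_def)
qed

lemma z_minus: "l \<noteq> 0 \<Longrightarrow> z (- l) = - H l (- l) - z l"
proof -
  assume "l \<noteq> 0"
  then have nz: "x l \<noteq> 0" "x (- l) \<noteq> 0" by (simp_all add: x_eq_0_iff)
  have "x l + x (- l) + x l * x (- l) * H l (- l) = 0" using x_add[of l "- l"] by simp
  then show ?thesis using nz by (simp add: z_def field_simps) (simp add: algebra_simps eq_neg_iff_add_eq_0)
qed

lemma kappa1_S: "i \<in> I \<Longrightarrow> kappa1 i \<in> S"
  using z_minus[of "al i"] Phi_nonzero[of "al i"] by (simp add: kappa1_z S_uminus)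

text \<open>Using the expansion of the sum, \<open>\<kappa>\<close> is the quotient of \<open>H(l, -l) - H(l, n)\<close> by
  \<open>x\<close> at \<open>l + n\<close>. The numerator is divisible by the difference of \<open>x\<close> at \<open>-l\<close>
  and at \<open>n\<close>, which is divisible by \<open>x\<close> at \<open>l + n\<close> because \<open>n = (l + n) +
  (-l)\<close>.\<close>

lemma kappa_S:
  assumes "l \<noteq> 0" "n \<noteq> 0" "l + n \<noteq> 0"
  shows "kappa l n \<in> S"
proof -
  have nz: "x l \<noteq> 0" "x n \<noteq> 0" "x (l + n) \<noteq> 0" using assms by (simp_all add: x_eq_0_iff)
  obtain g where g: "g \<in> S" "H l (- l) - H l n = (x (- l) - x n) * g" using H_diff by blast
  have "x n = x ((l + n) + - l)" by simp
  also have "\<dots> = x (l + n) + x (- l) + x (l + n) * x (- l) * H (l + n) (- l)" by (rule x_add)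
  finally have d: "x (- l) - x n = x (l + n) * (- 1 - x (- l) * H (l + n) (- l))" by (simp add: algebra_simps)
  have a: "z l + z n - z l * z n * x (l + n) = - H l n"
    using nz x_add[of l n] by (simp add: z_def field_simps)
  have zx: "z (l + n) * x (l + n) = 1" using nz by (simp add: z_def)
  have "kappa l n = z (l + n) * (z n - z (- l)) - z l * z n * (z (l + n) * x (l + n))"
    unfolding zx by (simp add: kappa_z algebra_simps)
  also have "\<dots> = z (l + n) * (H l (- l) + (z l + z n - z l * z n * x (l + n)))"
    by (simp add: z_minus assms algebra_simps)
  also have "\<dots> = z (l + n) * (H l (- l) - H l n)" unfolding a by simp
  also have "\<dots> = (z (l + n) * x (l + n)) * ((- 1 - x (- l) * H (l + n) (- l)) * g)"
    unfolding g(2) d by (simp add: mult.assoc)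
  also have "\<dots> \<in> S" unfolding zx using g(1) by (auto intro!: S_mult S_diff S_uminus)
  finally show ?thesis .
qed

lemma kappa_rt_S:
  assumes "i \<in> I" "j \<in> I" "i \<noteq> j" "(n, m) \<noteq> (0, 0)" "(n', m') \<noteq> (0, 0)" "(n + n', m + m') \<noteq> (0, 0)"
  shows "kappa (rt i j n m) (rt i j n' m') \<in> S"
  using assms rt_zero[OF assms(1-3)] by (intro kappa_S) (auto simp: rt_simps)

lemma rel4b_coeffs:
  assumes "i \<in> I" "j \<in> I" "i \<noteq> j"
  shows "B2A i j \<in> S" "B2B i j \<in> S"
  unfolding kappa_al(1)[of i j] kappa_al(2)[of j i] using assms by (auto intro!: S_add kappa_rt_S)

lemma rel4c_coeffs:
  assumes "i \<in> I" "j \<in> I" "i \<noteq> j"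
  shows "G2A i j \<in> S" "G2B i j \<in> S"
  unfolding kappa_al(1)[of i j] kappa_al(2)[of j i] using assms by (auto intro!: S_add kappa_rt_S)

subsection \<open>The coefficients of the braid relation of type G2\<close>

lemma Dlt_mult: "i \<in> I \<Longrightarrow> Dlt i (f * g) = Dlt i f * g + act (s i) f * Dlt i g"
  by (simp add: Dlt_def Dop_def W_act divide_inverse algebra_simps)

lemma Dlt_invariant: "act (s i) f = f \<Longrightarrow> Dlt i f = 0"
  by (simp add: Dlt_def Dop_def)

lemma act_s_S: "i \<in> I \<Longrightarrow> act (s i) q \<in> S \<longleftrightarrow> q \<in> S"
proof
  assume i: "i \<in> I" and "act (s i) q \<in> S"
  then have "act (s i) (act (s i) q) \<in> S" by (simp add: W_act)
  moreover have "act (s i) (act (s i) q) = q"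
    using i s_invol[OF i, of id] by (simp add: W_act_comp act_id)
  ultimately show "q \<in> S" by simp
qed (simp add: W_act)

text \<open>For \<open>\<langle>\<alpha>\<^sub>i\<^sup>\<or>, l\<rangle> = 1\<close> the reflection subtracts \<open>al i\<close>
  exactly once, which leaves \<open>1 + u H\<close>.\<close>

lemma Dlt_x_unit:
  assumes i: "i \<in> I" and l: "cr (al i) l = 1"
  shows "S_unit (Dlt i (x l))"
proof -
  have nz: "x (al i) \<noteq> 0" using Phi_nonzero[of "al i"] i by (simp add: x_eq_0_iff)
  have sl: "s i l = l - al i" using l by (simp add: reflection_def)
  have "x l = x (s i l + al i)" using sl by simp
  also have "\<dots> = x (s i l) + x (al i) + x (s i l) * x (al i) * H (s i l) (al i)" by (rule x_add)
  finally have "x l - x (s i l) = x (al i) * (1 + x (s i l) * H (s i l) (al i))" by (simp add: algebra_simps)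
  then have "Dlt i (x l) = 1 + x (s i l) * H (s i l) (al i)"
    using i nz by (simp add: Dlt_def Dop_def W_act)
  then show ?thesis using S_unit_H by simp
qed

lemma tw_id: "tw q id = q"
  by (simp add: tw_def inv_id act_id)

text \<open>The braid relation of type G2, applied to functions coming from elements \<open>q\<close> of \<open>S\<close>, is an
  identity between compositions of the operators \<open>\<Delta>\<^sub>i\<close> and \<open>\<Delta>\<^sub>j\<close>. All its terms
  except those with \<open>\<xi>\<close> are known to lie in \<open>S\<close>. By the product rule the terms with
  \<open>\<xi>\<close> add up to \<open>T q = \<Delta>\<^sub>i (a \<Delta>\<^sub>j q) - \<Delta>\<^sub>j (b \<Delta>\<^sub>i
  q)\<close>, where \<open>a\<close> and \<open>b\<close> are the transforms of \<open>\<xi>\<^sub>i\<^sub>j\<close> and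
  \<open>\<xi>\<^sub>j\<^sub>i\<close>, so \<open>T\<close> maps \<open>S\<close> to itself. The lattice points
  \<open>\<alpha>\<^sub>i + 2\<alpha>\<^sub>j\<close> and \<open>2\<alpha>\<^sub>i + 3\<alpha>\<^sub>j\<close> are fundamental
  weights of G2: each is fixed by one of the reflections, and the other one lowers it by its simple root, with a unit as divided
  difference. Evaluating \<open>T\<close> on the corresponding elements \<open>y\<close>, \<open>y y\<close>, \<open>w\<close> and
  \<open>w y\<close> isolates first \<open>a\<close> and then \<open>b\<close>.\<close>

theorem xi_S:
  assumes ij: "i \<in> I" "j \<in> I" "i \<noteq> j" "cr (al i) (al j) = -1" "cr (al j) (al i) = -3"
  shows "xi_ij i j \<in> S" "xi_ji i j \<in> S"
proof -
  define a b where "a = act (s j) (xi_ij i j)" and "b = act (s i) (xi_ji i j)"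
  define T where "T q = Dlt i (a * Dlt j q) - Dlt j (b * Dlt i q)" for q
  have dd: "Dlt k (p - q) = Dlt k p - Dlt k q" if "k \<in> I" for k p q
    using that by (simp add: Dlt_def Dop_def W_act diff_divide_distrib)
  have mul: "(\<lambda>v. tw A v * tw q v) = tw (A * q)" for A q by (simp add: fun_eq_iff tw_hom)
  have T: "T q \<in> S" if q: "q \<in> S" for q
  proof -
    let ?A = "G2A i j"
    let ?B = "G2B i j"
    have AB: "?A \<in> S" "?B \<in> S"
      by (rule rel4c_coeffs[OF ij(1-3)])+
    have id: "Dlt j (Dlt i (Dlt j (Dlt i (Dlt j (Dlt i q))))) - Dlt i (Dlt j (Dlt i (Dlt j (Dlt i (Dlt j q))))) =
      Dlt i (Dlt j (Dlt i (Dlt j (?A * q)))) - Dlt j (Dlt i (Dlt j (Dlt i (?B * q))))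
      + Dlt j (Dlt i (Dlt j (Dlt i ?B * q))) - Dlt i (Dlt j (Dlt i (Dlt j ?A * q)))
      + Dlt i (Dlt j (xi_ij i j * q)) - Dlt j (Dlt i (xi_ji i j * q))
      + Dlt j (Dlt i (xi_ji i j) * q) - Dlt i (Dlt j (xi_ij i j) * q)"
      using Xop_G2[OF ij, of "tw q" id] unfolding mul Xop_tw[OF ij(1)] Xop_tw[OF ij(2)] tw_id .
    have "T q = Dlt i (Dlt j (xi_ij i j * q)) - Dlt i (Dlt j (xi_ij i j) * q)
        - (Dlt j (Dlt i (xi_ji i j * q)) - Dlt j (Dlt i (xi_ji i j) * q))"
    proof -
      have "a * Dlt j q = Dlt j (xi_ij i j * q) - Dlt j (xi_ij i j) * q"
        "b * Dlt i q = Dlt i (xi_ji i j * q) - Dlt i (xi_ji i j) * q"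
        using ij by (simp_all add: Dlt_mult a_def b_def)
      then show ?thesis unfolding T_def using ij by (simp add: dd)
    qed
    also have "\<dots> = Dlt j (Dlt i (Dlt j (Dlt i (Dlt j (Dlt i q))))) - Dlt i (Dlt j (Dlt i (Dlt j (Dlt i (Dlt j q)))))
       - (Dlt i (Dlt j (Dlt i (Dlt j (?A * q)))) - Dlt j (Dlt i (Dlt j (Dlt i (?B * q))))
      + Dlt j (Dlt i (Dlt j (Dlt i ?B * q))) - Dlt i (Dlt j (Dlt i (Dlt j ?A * q))))"
      unfolding id by simp
    also have "\<dots> \<in> S" using ij q AB by (intro S_diff S_add) (auto intro!: Dlt_S S_mult)
    finally show ?thesis .
  qed
  define y w where "y = x (rt i j 1 2)" and "w = x (rt i j 2 3)"
  have yS: "y \<in> S" and wS: "w \<in> S" by (simp_all add: y_def w_def)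
  have rr: "s i (rt i j n m) = rt i j (m - n) m" "s j (rt i j n m) = rt i j n (3 * n - m)" for n m
    using ij by (simp_all add: refl_rt)
  have cr_rt: "cr (al i) (rt i j n m) = 2 * n - m" "cr (al j) (rt i j n m) = 2 * m - 3 * n" for n m
    using ij by (simp_all add: rt_def cr_simps cr_self)
  have siy: "act (s i) y = y" and sjy: "act (s j) y = x (rt i j 1 1)" and sjw: "act (s j) w = w"
    using ij by (simp_all add: y_def w_def W_act rr)
  have eu: "S_unit (Dlt j y)" "S_unit (Dlt i w)" "S_unit (Dlt i (act (s j) y))"
    unfolding sjy unfolding y_def w_def using ij cr_rt by (auto intro!: Dlt_x_unit)
  have iy0: "Dlt i y = 0" "Dlt i (y * y) = 0" "Dlt j w = 0"
    using siy sjw ij by (simp_all add: Dlt_invariant W_act)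
  have Diy: "Dlt i (f * y) = Dlt i f * y" for f using ij iy0 by (simp add: Dlt_mult)
  \<comment> \<open>as \<open>y\<close> is fixed by \<open>s\<^sub>i\<close>, only the summand with \<open>a\<close> survives in \<open>T y\<close> and \<open>T (y y)\<close>\<close>
  define e where "e = Dlt j y"
  have 1: "Dlt i (a * e) \<in> S" using T[OF yS] ij by (simp add: T_def e_def iy0 Dlt_invariant W_act)
  have "Dlt i (a * Dlt j (y * y)) \<in> S" using T[OF S_mult[OF yS yS]] ij by (simp add: T_def iy0 Dlt_invariant W_act)
  moreover have "a * Dlt j (y * y) = (a * e) * y + (a * e) * act (s j) y"
    using ij by (simp add: Dlt_mult e_def algebra_simps)
  moreover have "Dlt i (p + q) = Dlt i p + Dlt i q" for p q
    using ij by (simp add: Dlt_def Dop_def W_act add_divide_distrib[symmetric])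
  ultimately have "Dlt i (a * e) * y + Dlt i ((a * e) * act (s j) y) \<in> S" by (simp add: Diy)
  then have 2: "Dlt i ((a * e) * act (s j) y) \<in> S" using S_diff[OF _ S_mult[OF 1 yS]] by fastforce
  have "Dlt i ((a * e) * act (s j) y) - Dlt i (a * e) * act (s j) y = act (s i) (a * e) * Dlt i (act (s j) y)"
    using ij by (simp add: Dlt_mult)
  moreover have "Dlt i ((a * e) * act (s j) y) - Dlt i (a * e) * act (s j) y \<in> S"
    using 1 2 yS ij by (intro S_diff S_mult) (auto simp: W_act)
  ultimately have "act (s i) (a * e) * Dlt i (act (s j) y) \<in> S" by simp
  then have "act (s i) (a * e) \<in> S" by (rule S_unit_cancel[OF eu(3)])
  then have "a * e \<in> S" using act_s_S ij by blast
  then have aS: "a \<in> S" unfolding e_def by (rule S_unit_cancel[OF eu(1)])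
  then show "xi_ij i j \<in> S" unfolding a_def using act_s_S ij by blast
  have b: "Dlt j (b * Dlt i q) \<in> S" if "q \<in> S" for q
  proof -
    have "Dlt j (b * Dlt i q) = Dlt i (a * Dlt j q) - T q" by (simp add: T_def)
    then show ?thesis using that aS ij T by (auto intro!: S_diff Dlt_S S_mult)
  qed
  \<comment> \<open>with \<open>a\<close> in \<open>S\<close>, the summand with \<open>b\<close> alone maps \<open>S\<close> to \<open>S\<close>; it is tested on \<open>w\<close> and \<open>w y\<close>\<close>
  let ?f = "b * Dlt i w"
  have 3: "Dlt j ?f \<in> S" using b[OF wS] .
  have "Dlt j (?f * y) \<in> S" using b[OF S_mult[OF wS yS]] by (simp add: Diy mult.assoc)
  moreover have "Dlt j (?f * y) - Dlt j ?f * y = act (s j) ?f * Dlt j y" using ij by (simp add: Dlt_mult)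
  ultimately have "act (s j) ?f * Dlt j y \<in> S" using S_diff S_mult[OF 3 yS] by metis
  then have "act (s j) ?f \<in> S" by (rule S_unit_cancel[OF eu(1)])
  then have "?f \<in> S" using act_s_S ij by blast
  then have "b \<in> S" by (rule S_unit_cancel[OF eu(2)])
  then show "xi_ji i j \<in> S" unfolding b_def using act_s_S ij by blast
qed

text \<open>Since the elements \<open>\<xi>\<close> already lie in \<open>S\<close>, adjoining them and their translates changes
  nothing.\<close>

theorem S_tilde_eq: "S_tilde = S"
proof -
  have gen: "generate_ring ring_of_type_algebra S = S"
  proof (intro equalityI subsetI)
    fix q assume "q \<in> generate_ring ring_of_type_algebra S"
    then show "q \<in> S" by induction (auto simp: S_add S_mult S_uminus)
  qed (rule generate_ring.incl)
  have "i \<noteq> j" if "i \<in> I" "cr (al i) (al j) = -1" for i j using that cr_self[of "al i"] by auto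
  then have "S \<union> xi_set = S" using xi_S by (auto simp: xi_set_def)
  moreover have "(\<Union>w\<in>W. act w ` S) = S"
    using act_id by (auto simp: W_act intro!: bexI[of _ id])
  ultimately show ?thesis by (simp add: S_tilde_def gen)
qed

end

section \<open>The free algebra and its evaluation in the twisted algebra\<close>

context formal_demazure
begin

abbreviation Gens :: "('k + 'i) set" where "Gens \<equiv> Inl ` S \<union> Inr ` I"

abbreviation fa :: "(('k + 'i) word \<Rightarrow>\<^sub>0 'r) set" where "fa \<equiv> carrier (FA S)"

lemma fa_iff: "p \<in> fa \<longleftrightarrow> (\<forall>w\<in>Poly_Mapping.keys p. set (letters w) \<subseteq> Gens)"
  by (simp add: free_algebra_def)

lemma FA_ops [simp]: "p \<otimes>\<^bsub>FA S\<^esub> q = p * q" "p \<oplus>\<^bsub>FA S\<^esub> q = p + q" "\<one>\<^bsub>FA S\<^esub> = 1" "\<zero>\<^bsub>FA S\<^esub> = 0"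
  by (simp_all add: free_algebra_def)

lemma letters_simps [simp]: "letters (v + w) = letters v @ letters w" "letters 0 = []"
  by (simp_all add: plus_word_def zero_word_def)

lemma fa_add: "p \<in> fa \<Longrightarrow> q \<in> fa \<Longrightarrow> p + q \<in> fa"
  using Poly_Mapping.keys_add[of p q] unfolding fa_iff by blast

lemma fa_uminus: "p \<in> fa \<Longrightarrow> - p \<in> fa"
  by (simp add: fa_iff)

lemma fa_diff: "p \<in> fa \<Longrightarrow> q \<in> fa \<Longrightarrow> p - q \<in> fa"
  using fa_add[OF _ fa_uminus, of p q] by simp

lemma fa_mult: "p \<in> fa \<Longrightarrow> q \<in> fa \<Longrightarrow> p * q \<in> fa"
  unfolding fa_iff
proof
  fix w assume pq: "\<forall>w\<in>Poly_Mapping.keys p. set (letters w) \<subseteq> Gens" "\<forall>w\<in>Poly_Mapping.keys q. set (letters w) \<subseteq> Gens"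
    and "w \<in> Poly_Mapping.keys (p * q)"
  then obtain a b where "w = a + b" "a \<in> Poly_Mapping.keys p" "b \<in> Poly_Mapping.keys q"
    using keys_mult[of p q] by blast
  then show "set (letters w) \<subseteq> Gens" using pq by simp
qed

lemma fa_0 [simp]: "0 \<in> fa" and fa_1 [simp]: "1 \<in> fa"
  by (simp_all add: fa_iff)

lemma fa_single: "set (letters w) \<subseteq> Gens \<Longrightarrow> Poly_Mapping.single w r \<in> fa"
  by (simp add: fa_iff)

lemma fa_scalar [simp]: "Poly_Mapping.single 0 r \<in> fa"
  by (rule fa_single) simp

lemma fa_genA [simp]: "a \<in> S \<Longrightarrow> genA a \<in> fa" and fa_genX [simp]: "i \<in> I \<Longrightarrow> genX i \<in> fa"
  by (auto simp: free_gen_def intro!: fa_single)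

lemma fa_sum: "(\<And>k. k \<in> A \<Longrightarrow> g k \<in> fa) \<Longrightarrow> sum g A \<in> fa"
  by (induction A rule: infinite_finite_induct) (auto intro: fa_add)

lemma FA_ring: "ring (FA S)"
proof -
  have "subring fa (ring_of_type_algebra :: (('k + 'i) word \<Rightarrow>\<^sub>0 'r) ring)"
    by (rule ring.subringI[OF ring_typering]) (auto intro: fa_add fa_uminus fa_mult)
  from ring.subring_is_ring[OF ring_typering this] show ?thesis
    by (simp add: free_algebra_def)
qed

sublocale FAr: ring "FA S" by (rule FA_ring)

lemma FA_inv: "p \<in> fa \<Longrightarrow> \<ominus>\<^bsub>FA S\<^esub> p = - p"
  by (rule FAr.minus_equality) (auto intro: fa_uminus)

lemma FA_minus: "q \<in> fa \<Longrightarrow> p \<ominus>\<^bsub>FA S\<^esub> q = p - q"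
  by (simp add: a_minus_def FA_inv)

lemma fa_induct [consumes 1, case_names zero single add]:
  assumes p: "p \<in> fa" and "P 0" "\<And>w r. set (letters w) \<subseteq> Gens \<Longrightarrow> P (Poly_Mapping.single w r)"
    "\<And>p q. p \<in> fa \<Longrightarrow> q \<in> fa \<Longrightarrow> P p \<Longrightarrow> P q \<Longrightarrow> P (p + q)"
  shows "P p"
proof -
  have "P (\<Sum>w\<in>A. Poly_Mapping.single w (Poly_Mapping.lookup p w))" if "A \<subseteq> Poly_Mapping.keys p" for A
  proof -
    have "finite A" using finite_subset[OF that] by simp
    then show ?thesis using that
    proof induction
      case (insert w A)
      then have "set (letters w) \<subseteq> Gens" using p by (auto simp: fa_iff)
      moreover have "(\<Sum>w\<in>A. Poly_Mapping.single w (Poly_Mapping.lookup p w)) \<in> fa"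
        using insert.prems p by (intro fa_sum fa_single) (auto simp: fa_iff)
      ultimately show ?case using insert assms(3,4) fa_single by simp
    qed (simp add: assms)
  qed
  from this[OF order_refl] show ?thesis by (simp only: single_expansion[symmetric])
qed

text \<open>The algebra homomorphism from the free algebra to the twisted algebra that sends the generators to the coefficients
  and to the \<open>X\<^sub>i\<close>: first on words, then extended linearly.\<close>

definition evw :: "('k + 'i) list \<Rightarrow> ('l \<Rightarrow> 'l) \<Rightarrow> 'k" where
  "evw gs = foldr (\<lambda>g f. (case g of Inl a \<Rightarrow> coef a | Inr i \<Rightarrow> Xel i) \<otimes>\<^bsub>QW\<^esub> f) gs E"

definition ev :: "(('k + 'i) word \<Rightarrow>\<^sub>0 'r) \<Rightarrow> ('l \<Rightarrow> 'l) \<Rightarrow> 'k" where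
  "ev p u = (\<Sum>w\<in>Poly_Mapping.keys p. scalar (Poly_Mapping.lookup p w) * evw (letters w) u)"

lemma evw_simps [simp]: "evw [] = E" "evw (Inl a # gs) = coef a \<otimes>\<^bsub>QW\<^esub> evw gs" "evw (Inr i # gs) = Xel i \<otimes>\<^bsub>QW\<^esub> evw gs"
  by (simp_all add: evw_def)

lemma evw_carrier: "set gs \<subseteq> Gens \<Longrightarrow> evw gs \<in> carrier QW"
  by (induction gs) (auto simp: Q_S)

lemma evw_append: "set gs \<subseteq> Gens \<Longrightarrow> set hs \<subseteq> Gens \<Longrightarrow> evw (gs @ hs) = evw gs \<otimes>\<^bsub>QW\<^esub> evw hs"
proof (induction gs)
  case Nil
  then show ?case using QW.l_one[OF evw_carrier[of hs]] by (simp add: QW_one)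
next
  case (Cons g gs)
  then show ?case by (auto simp: QW_assoc)
qed

lemma ev_add: "ev (p + q) = (\<lambda>u. ev p u + ev q u)"
  unfolding ev_def by (rule ext, rule setsum_keys_plus_distrib) (simp_all add: scalar_hom distrib_right)

lemma ev_single: "ev (Poly_Mapping.single w r) = (\<lambda>u. scalar r * evw (letters w) u)"
  by (cases "r = 0") (simp_all add: ev_def scalar_hom fun_eq_iff)

lemma ev_0: "ev 0 = (\<lambda>u. 0)"
  by (simp add: ev_def fun_eq_iff)

lemma scalar_Q [simp]: "scalar r \<in> Q"
  by (simp add: Q_S)

lemma scale_carrier: "f \<in> carrier QW \<Longrightarrow> (\<lambda>u. scalar r * f u) \<in> carrier QW"
  by (auto simp: QW_carrier supp_def Q_mult)

lemma ev_carrier: "p \<in> fa \<Longrightarrow> ev p \<in> carrier QW"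
proof (induction rule: fa_induct)
  case zero
  then show ?case using QW.zero_closed by (simp add: ev_0 QW_zero)
next
  case (single w r)
  then show ?case by (simp add: ev_single scale_carrier evw_carrier)
next
  case (add p q)
  then show ?case by (simp add: ev_add QW_closed)
qed

lemma scale_mult:
  "(\<lambda>u. scalar r * f u) \<otimes>\<^bsub>QW\<^esub> g = (\<lambda>u. scalar r * (f \<otimes>\<^bsub>QW\<^esub> g) u)"
  "f \<otimes>\<^bsub>QW\<^esub> (\<lambda>u. scalar r * g u) = (\<lambda>u. scalar r * (f \<otimes>\<^bsub>QW\<^esub> g) u)"
proof -
  show "(\<lambda>u. scalar r * f u) \<otimes>\<^bsub>QW\<^esub> g = (\<lambda>u. scalar r * (f \<otimes>\<^bsub>QW\<^esub> g) u)"
  proof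
    fix u show "((\<lambda>u. scalar r * f u) \<otimes>\<^bsub>QW\<^esub> g) u = scalar r * (f \<otimes>\<^bsub>QW\<^esub> g) u"
      by (cases "u \<in> W") (simp_all add: QW_mult QW_mult_outside W_act sum_distrib_left mult.assoc)
  qed
  show "f \<otimes>\<^bsub>QW\<^esub> (\<lambda>u. scalar r * g u) = (\<lambda>u. scalar r * (f \<otimes>\<^bsub>QW\<^esub> g) u)"
  proof
    fix u show "(f \<otimes>\<^bsub>QW\<^esub> (\<lambda>u. scalar r * g u)) u = scalar r * (f \<otimes>\<^bsub>QW\<^esub> g) u"
      by (cases "u \<in> W") (simp_all add: QW_mult QW_mult_outside sum_distrib_left mult.left_commute)
  qed
qed

lemma zero_mult: "(\<lambda>u. 0) \<otimes>\<^bsub>QW\<^esub> g = (\<lambda>u. 0)" "g \<otimes>\<^bsub>QW\<^esub> (\<lambda>u. 0) = (\<lambda>u. 0)"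
  using scale_mult(1)[of 0 "\<lambda>u. 0" g] scale_mult(2)[of g 0 "\<lambda>u. 0"] by (simp_all add: scalar_hom)

lemma ev_mult: "p \<in> fa \<Longrightarrow> q \<in> fa \<Longrightarrow> ev (p * q) = ev p \<otimes>\<^bsub>QW\<^esub> ev q"
proof (induction p rule: fa_induct)
  case zero
  then show ?case by (simp add: ev_0 zero_mult)
next
  case (add p p')
  then show ?case by (simp add: distrib_right ev_add QW_distrib)
next
  case (single w r)
  from \<open>q \<in> fa\<close> show ?case
  proof (induction q rule: fa_induct)
    case zero
    then show ?case by (simp add: ev_0 zero_mult)
  next
    case (add p p')
    then show ?case by (simp add: distrib_left ev_add QW_distrib)
  next
    case (single w' r')
    then show ?case using \<open>set (letters w) \<subseteq> Gens\<close>
      by (simp add: mult_single ev_single evw_append scale_mult scalar_hom mult_ac)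
  qed
qed

lemma ev_1: "ev 1 = E"
  using ev_single[of 0 1] by (simp add: scalar_hom)

lemma ev_hom: "ring_hom_ring (FA S) QW ev"
  by (rule ring_hom_ringI[OF FA_ring QW_ring]) (simp_all add: ev_carrier ev_mult ev_add QW_add ev_1 QW_one)

sublocale evh: ring_hom_ring "FA S" QW ev by (rule ev_hom)

lemma ev_uminus: "ev (- p) = (\<lambda>u. - ev p u)"
  using ev_add[of p "- p"] by (auto simp: ev_0 fun_eq_iff eq_neg_iff_add_eq_0 add.commute)

lemma ev_diff: "ev (p - q) = (\<lambda>u. ev p u - ev q u)"
  using ev_add[of p "- q"] by (simp add: ev_uminus)

lemma ev_sum: "ev (sum g A) = (\<lambda>u. \<Sum>k\<in>A. ev (g k) u)"
  by (induction A rule: infinite_finite_induct) (auto simp: ev_0 ev_add)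

lemma ev_genA: "a \<in> S \<Longrightarrow> ev (genA a) = coef a"
  using mult_coef[of "coef a" 1] by (simp add: free_gen_def ev_single scalar_hom)

lemma ev_genX: "i \<in> I \<Longrightarrow> ev (genX i) = Xel i"
  using mult_coef[OF QW_supp[OF Xel_carrier[of i]], of 1] by (simp add: free_gen_def ev_single scalar_hom)

lemma ev_scalar: "ev (Poly_Mapping.single 0 r) = coef (scalar r)"
  by (auto simp: ev_single coef_def)

definition Xm :: "'i list \<Rightarrow> ('k + 'i) word \<Rightarrow>\<^sub>0 'r" where "Xm ks = monomial (FA S) genX ks"

lemma Xm_simps [simp]: "Xm [] = 1" "Xm (k # ks) = genX k * Xm ks"
  by (simp_all add: Xm_def monomial_def)

lemma Xm_append: "Xm (js @ ks) = Xm js * Xm ks"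
  by (induction js) (simp_all add: mult.assoc)

lemma fa_Xm [simp]: "set ks \<subseteq> I \<Longrightarrow> Xm ks \<in> fa"
  by (induction ks) (auto intro: fa_mult)

lemma ev_Xm: "set ks \<subseteq> I \<Longrightarrow> ev (Xm ks) = monomial QW Xel ks"
  by (induction ks) (simp_all add: ev_1 ev_mult ev_genX)

section \<open>The image of the evaluation\<close>

text \<open>The image of the evaluation is an \<open>R\<close>-subalgebra containing the generators of \<open>D\<close>, and it
  lies in every such subalgebra.\<close>

lemma image_ev: "ev ` fa = D"
proof (intro equalityI subsetI)
  fix f assume "f \<in> D"
  moreover have "R_subalgebra (ev ` fa)"
    unfolding R_subalgebra_def
  proof (intro conjI allI ballI)
    show "subring (ev ` fa) QW" by (rule evh.img_is_subring[OF FAr.carrier_is_subring])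
    fix r f assume "f \<in> ev ` fa"
    then obtain p where "p \<in> fa" "f = ev p" by blast
    then show "coef (scalar r) \<otimes>\<^bsub>QW\<^esub> f \<in> ev ` fa"
      by (intro image_eqI[of _ _ "Poly_Mapping.single 0 r * p"]) (simp_all add: ev_mult ev_scalar fa_mult)
  qed
  moreover have "coef a \<in> ev ` fa" if "a \<in> S" for a
    using imageI[OF fa_genA[OF that], of ev] ev_genA[OF that] by simp
  moreover have "Xel i \<in> ev ` fa" if "i \<in> I" for i
    using imageI[OF fa_genX[OF that], of ev] ev_genX[OF that] by simp
  ultimately show "f \<in> ev ` fa" unfolding D_def image_subset_iff by blast
next
  fix f assume "f \<in> ev ` fa"
  then obtain p where p: "p \<in> fa" "f = ev p" by blast
  show "f \<in> D"
    unfolding D_def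
  proof (rule InterI, elim CollectE conjE)
    fix B assume B: "R_subalgebra B" "coef ` S \<subseteq> B" "Xel ` I \<subseteq> B"
    then have sub: "subring B QW" and scal: "\<And>r b. b \<in> B \<Longrightarrow> coef (scalar r) \<otimes>\<^bsub>QW\<^esub> b \<in> B"
      by (auto simp: R_subalgebra_def)
    note B' = subringE[OF sub]
    have w: "evw gs \<in> B" if "set gs \<subseteq> Gens" for gs
      using that by (induction gs) (use B B' in \<open>auto simp: QW_one\<close>)
    from p(1) have "ev p \<in> B"
    proof (induction rule: fa_induct)
      case zero
      then show ?case using B'(2) by (simp add: ev_0 QW_zero)
    next
      case (single w r)
      have "ev (Poly_Mapping.single w r) = coef (scalar r) \<otimes>\<^bsub>QW\<^esub> evw (letters w)"
        using scalar_central[OF QW_supp[OF evw_carrier[OF single]]] mult_coef[OF QW_supp[OF evw_carrier[OF single]]]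
        by (simp add: ev_single mult.commute)
      then show ?case using w[OF single] scal by simp
    next
      case (add p q)
      then show ?case using B'(7)[of "ev p" "ev q"] by (simp add: ev_add QW_add)
    qed
    then show "f \<in> B" by (simp add: p)
  qed
qed

lemma D_subring: "subring D QW"
  using evh.img_is_subring[OF FAr.carrier_is_subring] by (simp add: image_ev)

lemma D_props: "R_subalgebra D" "coef ` S \<union> Xel ` I \<subseteq> D"
  "R_subalgebra B \<Longrightarrow> coef ` S \<union> Xel ` I \<subseteq> B \<Longrightarrow> D \<subseteq> B"
proof -
  show "coef ` S \<union> Xel ` I \<subseteq> D" by (auto simp: D_def)
  show "D \<subseteq> B" if "R_subalgebra B" "coef ` S \<union> Xel ` I \<subseteq> B" using that by (auto simp: D_def)
  show "R_subalgebra D" using D_subring by (auto simp: R_subalgebra_def) (auto simp: D_def R_subalgebra_def)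
qed

section \<open>The presentation ideal\<close>

abbreviation PI :: "(('k + 'i) word \<Rightarrow>\<^sub>0 'r) set" where "PI \<equiv> presentation_ideal S"

abbreviation rels :: "((('k + 'i) word \<Rightarrow>\<^sub>0 'r) \<times> (('k + 'i) word \<Rightarrow>\<^sub>0 'r)) set" where
  "rels \<equiv> coefficient_relations S \<union> relations (FA S) genA genX S"

lemma act_s_closed [simp]: "i \<in> I \<Longrightarrow> q \<in> S \<Longrightarrow> act (s i) q \<in> S"
  by (simp add: W_act)

lemma xi_Dlt_S:
  assumes "i \<in> I" "j \<in> I" "i \<noteq> j" "cr (al i) (al j) = -1" "cr (al j) (al i) = -3"
  shows "Dlt i (xi_ji i j) \<in> S" "Dlt j (xi_ij i j) \<in> S"
  using assms by (auto intro!: Dlt_S xi_S)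

lemma kappa_al_S: "i \<in> I \<Longrightarrow> j \<in> I \<Longrightarrow> i \<noteq> j \<Longrightarrow> kappa (al i) (al j) \<in> S"
  unfolding kappa_al(1)[of i j] by (rule kappa_rt_S) auto

lemma mono_hom:
  "set ks \<subseteq> I \<Longrightarrow> monomial (FA S) genX ks \<in> fa \<and> ev (monomial (FA S) genX ks) = monomial QW Xel ks"
  using fa_Xm[of ks] ev_Xm[of ks] by (simp add: Xm_def)

lemma ev_minus: "p \<in> fa \<Longrightarrow> q \<in> fa \<Longrightarrow> ev (p \<ominus>\<^bsub>FA S\<^esub> q) = ev p \<ominus>\<^bsub>QW\<^esub> ev q"
  by (simp only: a_minus_def evh.hom_add evh.hom_a_inv FAr.a_inv_closed)

lemma fa_minus: "p \<in> fa \<Longrightarrow> q \<in> fa \<Longrightarrow> p \<ominus>\<^bsub>FA S\<^esub> q \<in> fa"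
  by (rule FAr.minus_closed)

lemmas rel_hom = ev_minus evh.hom_add evh.hom_mult ev_genA ev_genX mono_hom[THEN conjunct2]
lemmas rel_carrier = fa_minus FAr.a_closed FAr.m_closed fa_genA fa_genX mono_hom[THEN conjunct1]
lemmas rel_side = list.set insert_subset empty_subsetI simp_thms

text \<open>The relations are written with the same expressions over the free and over the twisted algebra, so the homomorphism
  \<open>ev\<close> carries the former to the latter. The coefficients have to lie in \<open>S\<close> for the expressions over the
  free algebra to make sense; this is where their integrality is used.\<close>

lemma relations_ev:
  assumes "(l, r) \<in> relations (FA S) genA genX S"
  shows "l \<in> fa \<and> r \<in> fa \<and> (ev l, ev r) \<in> relations QW coef Xel S"
proof -
  have 1: "l \<in> fa \<and> r \<in> fa \<and> (ev l, ev r) \<in> rel1 QW coef Xel S" if "(l, r) \<in> rel1 (FA S) genA genX S"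
  proof -
    from that obtain i q where iq: "i \<in> I" "q \<in> S" and e: "l = genA q \<otimes>\<^bsub>FA S\<^esub> genX i"
      "r = genX i \<otimes>\<^bsub>FA S\<^esub> genA (act (s i) q) \<oplus>\<^bsub>FA S\<^esub> genA (Dlt i q)"
      unfolding rel1_def by blast
    show ?thesis
      unfolding rel1_def using iq
      by (intro conjI CollectI exI[of _ i] exI[of _ q])
        (simp_all only: e rel_hom rel_carrier rel_side act_s_closed Dlt_S prod.inject)
  qed
  have 2: "l \<in> fa \<and> r \<in> fa \<and> (ev l, ev r) \<in> rel2 QW coef Xel" if "(l, r) \<in> rel2 (FA S) genA genX"
  proof -
    from that obtain i where i: "i \<in> I" and e: "l = genX i \<otimes>\<^bsub>FA S\<^esub> genX i"
      "r = genX i \<otimes>\<^bsub>FA S\<^esub> genA (kappa1 i)"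
      unfolding rel2_def by blast
    show ?thesis
      unfolding rel2_def using i
      by (intro conjI CollectI exI[of _ i]) (simp_all only: e rel_hom rel_carrier rel_side kappa1_S prod.inject)
  qed
  have 3: "l \<in> fa \<and> r \<in> fa \<and> (ev l, ev r) \<in> rel3 QW Xel" if "(l, r) \<in> rel3 (FA S) genX"
  proof -
    from that obtain i j where ij: "i \<in> I" "j \<in> I" "cr (al i) (al j) = 0" and e: "l = genX i \<otimes>\<^bsub>FA S\<^esub> genX j"
      "r = genX j \<otimes>\<^bsub>FA S\<^esub> genX i"
      unfolding rel3_def by blast
    show ?thesis
      unfolding rel3_def using ij
      by (intro conjI CollectI exI[of _ i] exI[of _ j]) (simp_all only: e rel_hom rel_carrier rel_side prod.inject)
  qed
  have r4a: "l \<in> fa \<and> r \<in> fa \<and> (ev l, ev r) \<in> rel4a QW coef Xel" if "(l, r) \<in> rel4a (FA S) genA genX"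
  proof -
    from that obtain i j where ij: "i \<in> I" "j \<in> I" "i \<noteq> j" "cr (al i) (al j) = -1" "cr (al j) (al i) = -1"
      and e: "l = monomial (FA S) genX [j,i,j] \<ominus>\<^bsub>FA S\<^esub> monomial (FA S) genX [i,j,i]"
        "r = genX i \<otimes>\<^bsub>FA S\<^esub> genA (kappa (al i) (al j)) \<ominus>\<^bsub>FA S\<^esub> genX j \<otimes>\<^bsub>FA S\<^esub> genA (kappa (al j) (al i))"
      unfolding rel4a_def by blast
    show ?thesis
      unfolding rel4a_def Let_def using ij
      by (intro conjI CollectI exI[of _ i] exI[of _ j])
        (simp_all only: e rel_hom rel_carrier rel_side prod.inject kappa_al_S[OF ij(1,2,3)] kappa_al_S[OF ij(2,1) ij(3)[symmetric]])
  qed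
  have r4b: "l \<in> fa \<and> r \<in> fa \<and> (ev l, ev r) \<in> rel4b QW coef Xel" if "(l, r) \<in> rel4b (FA S) genA genX"
  proof -
    from that obtain i j where ij: "i \<in> I" "j \<in> I" "i \<noteq> j" "cr (al i) (al j) = -1" "cr (al j) (al i) = -2"
      and e0: "l = monomial (FA S) genX [j,i,j,i] \<ominus>\<^bsub>FA S\<^esub> monomial (FA S) genX [i,j,i,j]"
        "r = monomial (FA S) genX [i,j] \<otimes>\<^bsub>FA S\<^esub> genA (B2A i j) \<ominus>\<^bsub>FA S\<^esub> monomial (FA S) genX [j,i] \<otimes>\<^bsub>FA S\<^esub> genA (B2B i j) \<oplus>\<^bsub>FA S\<^esub> genX j \<otimes>\<^bsub>FA S\<^esub> genA (Dlt i (B2B i j)) \<ominus>\<^bsub>FA S\<^esub> genX i \<otimes>\<^bsub>FA S\<^esub> genA (Dlt j (B2A i j))"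
      unfolding rel4b_def Let_def by blast
    define A B where "A = B2A i j"
      and "B = B2B i j"
    note e = e0[folded A_def B_def]
    have "A \<in> S" "B \<in> S" unfolding A_def B_def by (rule rel4b_coeffs[OF ij(1-3)])+
    note AB = this Dlt_S[OF ij(1) this(2)] Dlt_S[OF ij(2) this(1)]
    show ?thesis
      unfolding rel4b_def Let_def using ij
      by (intro conjI CollectI exI[of _ i] exI[of _ j])
        (simp_all only: e rel_hom rel_carrier rel_side prod.inject AB A_def[symmetric] B_def[symmetric])
  qed
  have r4c: "l \<in> fa \<and> r \<in> fa \<and> (ev l, ev r) \<in> rel4c QW coef Xel" if "(l, r) \<in> rel4c (FA S) genA genX"
  proof -
    from that obtain i j where ij: "i \<in> I" "j \<in> I" "i \<noteq> j" "cr (al i) (al j) = -1" "cr (al j) (al i) = -3"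
      and e0: "l = monomial (FA S) genX [j,i,j,i,j,i] \<ominus>\<^bsub>FA S\<^esub> monomial (FA S) genX [i,j,i,j,i,j]"
        "r = monomial (FA S) genX [i,j,i,j] \<otimes>\<^bsub>FA S\<^esub> genA (G2A i j) \<ominus>\<^bsub>FA S\<^esub> monomial (FA S) genX [j,i,j,i] \<otimes>\<^bsub>FA S\<^esub> genA (G2B i j)
          \<oplus>\<^bsub>FA S\<^esub> monomial (FA S) genX [j,i,j] \<otimes>\<^bsub>FA S\<^esub> genA (Dlt i (G2B i j)) \<ominus>\<^bsub>FA S\<^esub> monomial (FA S) genX [i,j,i] \<otimes>\<^bsub>FA S\<^esub> genA (Dlt j (G2A i j))
          \<oplus>\<^bsub>FA S\<^esub> monomial (FA S) genX [i,j] \<otimes>\<^bsub>FA S\<^esub> genA (xi_ij i j) \<ominus>\<^bsub>FA S\<^esub> monomial (FA S) genX [j,i] \<otimes>\<^bsub>FA S\<^esub> genA (xi_ji i j)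
          \<oplus>\<^bsub>FA S\<^esub> genX j \<otimes>\<^bsub>FA S\<^esub> genA (Dlt i (xi_ji i j)) \<ominus>\<^bsub>FA S\<^esub> genX i \<otimes>\<^bsub>FA S\<^esub> genA (Dlt j (xi_ij i j))"
      unfolding rel4c_def Let_def by blast
    define A B where "A = G2A i j"
      and "B = G2B i j"
    note e = e0[folded A_def B_def]
    have "A \<in> S" "B \<in> S" unfolding A_def B_def by (rule rel4c_coeffs[OF ij(1-3)])+
    note AB = this Dlt_S[OF ij(1) this(2)] Dlt_S[OF ij(2) this(1)]
    show ?thesis
      unfolding rel4c_def Let_def using ij
      by (intro conjI CollectI exI[of _ i] exI[of _ j])
        (simp_all only: e rel_hom rel_carrier rel_side prod.inject AB xi_S[OF ij] xi_Dlt_S[OF ij] A_def[symmetric] B_def[symmetric])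
  qed
  show ?thesis using 1 2 3 r4a r4b r4c assms unfolding relations_def by blast
qed

end

context formal_demazure
begin

section \<open>Computing modulo the relations\<close>

lemma rels_fa: "(l, r) \<in> rels \<Longrightarrow> l \<in> fa \<and> r \<in> fa"
  using relations_ev by (auto simp: coefficient_relations_def S_add S_mult fa_add fa_mult)

lemma rels_ev: "(l, r) \<in> rels \<Longrightarrow> ev l = ev r"
proof -
  assume "(l, r) \<in> rels"
  then consider "(l, r) \<in> relations (FA S) genA genX S" | "(l, r) \<in> coefficient_relations S" by blast
  then show ?thesis
  proof cases
    case 1
    then have "(ev l, ev r) \<in> relations QW coef Xel S" using relations_ev by blast
    moreover have "rel1 QW coef Xel S \<subseteq> rel1 QW coef Xel Q" unfolding rel1_def using Q_S by blast
    then have "relations QW coef Xel S \<subseteq> relations QW coef Xel Q"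
      unfolding relations_def by (intro Un_mono order_refl)
    ultimately have "(ev l, ev r) \<in> relations QW coef Xel Q" by (rule rev_subsetD)
    from bspec[OF relations_hold this] show ?thesis by simp
  next
    case 2
    then show ?thesis
      by (auto simp: coefficient_relations_def ev_genA S_add S_mult ev_add ev_mult ev_scalar coef_hom QW_add)
  qed
qed

lemma PI_eq: "PI = genideal (FA S) ((\<lambda>(l, r). l - r) ` rels)"
proof -
  have "(\<lambda>(l, r). l \<ominus>\<^bsub>FA S\<^esub> r) ` rels = (\<lambda>(l, r). l - r) ` rels"
  proof (rule image_cong[OF refl])
    fix p assume p: "p \<in> rels"
    obtain l r where lr: "p = (l, r)" by (cases p)
    then have "r \<in> fa" using p rels_fa by blast
    then show "(case p of (l, r) \<Rightarrow> l \<ominus>\<^bsub>FA S\<^esub> r) = (case p of (l, r) \<Rightarrow> l - r)"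
      by (simp add: lr FA_minus)
  qed
  then show ?thesis by (simp add: presentation_ideal_def)
qed

lemma PI_gens_fa: "(\<lambda>(l, r). l - r) ` rels \<subseteq> fa"
  using rels_fa fa_diff by auto

lemma PI_ideal: "ideal PI (FA S)"
  unfolding PI_eq by (rule FAr.genideal_ideal[OF PI_gens_fa])

lemma PI_rel: "(l, r) \<in> rels \<Longrightarrow> l - r \<in> PI"
  unfolding PI_eq using FAr.genideal_self[OF PI_gens_fa] by force

lemma PI_fa: "p \<in> PI \<Longrightarrow> p \<in> fa"
  using ideal.Icarr[OF PI_ideal] by blast

lemma PI_0 [simp]: "0 \<in> PI"
  using additive_subgroup.zero_closed[OF ideal.axioms(1)[OF PI_ideal]] by simp

lemma PI_add: "p \<in> PI \<Longrightarrow> q \<in> PI \<Longrightarrow> p + q \<in> PI"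
  using additive_subgroup.a_closed[OF ideal.axioms(1)[OF PI_ideal]] by simp

lemma PI_mult: "p \<in> PI \<Longrightarrow> q \<in> fa \<Longrightarrow> q * p \<in> PI" "p \<in> PI \<Longrightarrow> q \<in> fa \<Longrightarrow> p * q \<in> PI"
  using ideal.I_l_closed[OF PI_ideal] ideal.I_r_closed[OF PI_ideal] by simp_all

lemma PI_uminus: "p \<in> PI \<Longrightarrow> - p \<in> PI"
  using PI_mult(1)[of p "- 1"] fa_uminus[OF fa_1] by simp

lemma kernel_iff: "p \<in> a_kernel (FA S) QW ev \<longleftrightarrow> p \<in> fa \<and> ev p = (\<lambda>u. 0)"
  unfolding a_kernel_def' QW_zero by blast

lemma PI_ev:
  assumes "p \<in> PI"
  shows "ev p = (\<lambda>u. 0)"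
proof -
  have "ideal (a_kernel (FA S) QW ev) (FA S)" by (rule evh.kernel_is_ideal)
  moreover have "(\<lambda>(l, r). l - r) ` rels \<subseteq> a_kernel (FA S) QW ev"
  proof (rule image_subsetI)
    fix p assume p: "p \<in> rels"
    obtain l r where lr: "p = (l, r)" by (cases p)
    have "l \<in> fa" "r \<in> fa" "ev l = ev r"
      using rels_fa[OF p[unfolded lr]] rels_ev[OF p[unfolded lr]] by simp_all
    then show "(case p of (l, r) \<Rightarrow> l - r) \<in> a_kernel (FA S) QW ev"
      unfolding kernel_iff lr prod.case by (simp only: ev_diff diff_self fa_diff simp_thms)
  qed
  ultimately have "PI \<subseteq> a_kernel (FA S) QW ev" unfolding PI_eq by (rule FAr.genideal_minimal)
  then have "p \<in> a_kernel (FA S) QW ev" using assms by (rule subsetD)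
  then show ?thesis unfolding kernel_iff by blast
qed

definition eqv :: "(('k + 'i) word \<Rightarrow>\<^sub>0 'r) \<Rightarrow> (('k + 'i) word \<Rightarrow>\<^sub>0 'r) \<Rightarrow> bool" (infix \<open>\<doteq>\<close> 50) where
  "p \<doteq> q \<longleftrightarrow> p - q \<in> PI"

lemma eqv_refl [simp]: "p \<doteq> p" by (simp add: eqv_def)

lemma eqv_sym: "p \<doteq> q \<Longrightarrow> q \<doteq> p" using PI_uminus[of "p - q"] by (simp add: eqv_def)

lemma eqv_trans [trans]: "p \<doteq> q \<Longrightarrow> q \<doteq> r \<Longrightarrow> p \<doteq> r"
  using PI_add[of "p - q" "q - r"] by (simp add: eqv_def)

lemma eqv_add: "p \<doteq> p' \<Longrightarrow> q \<doteq> q' \<Longrightarrow> p + q \<doteq> p' + q'"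
  using PI_add[of "p - p'" "q - q'"] by (simp add: eqv_def algebra_simps)

lemma eqv_sum: "(\<And>k. k \<in> A \<Longrightarrow> g k \<doteq> h k) \<Longrightarrow> sum g A \<doteq> sum h A"
  by (induction A rule: infinite_finite_induct) (auto intro: eqv_add)

lemma eqv_mult_left: "q \<in> fa \<Longrightarrow> p \<doteq> p' \<Longrightarrow> q * p \<doteq> q * p'"
  using PI_mult(1)[of "p - p'" q] by (simp add: eqv_def right_diff_distrib)

lemma eqv_mult_right: "q \<in> fa \<Longrightarrow> p \<doteq> p' \<Longrightarrow> p * q \<doteq> p' * q"
  using PI_mult(2)[of "p - p'" q] by (simp add: eqv_def left_diff_distrib)

lemma eqv_rel: "(l, r) \<in> rels \<Longrightarrow> l \<doteq> r"
  by (simp add: eqv_def PI_rel)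

lemma genA_hom: "a \<in> S \<Longrightarrow> b \<in> S \<Longrightarrow> genA (a + b) \<doteq> genA a + genA b"
  "a \<in> S \<Longrightarrow> b \<in> S \<Longrightarrow> genA (a * b) \<doteq> genA a * genA b"
  "genA (scalar r) \<doteq> Poly_Mapping.single 0 r"
  by (intro eqv_rel, auto simp: coefficient_relations_def)+

lemma genA_0: "genA 0 \<doteq> 0" and genA_1: "genA 1 \<doteq> 1"
  using genA_hom(3)[of 0] genA_hom(3)[of 1] by (simp_all add: scalar_hom)

lemma eqv_commute: "i \<in> I \<Longrightarrow> q \<in> S \<Longrightarrow> genA q * genX i \<doteq> genX i * genA (act (s i) q) + genA (Dlt i q)"
  by (rule eqv_rel) (auto simp: relations_def rel1_def)

lemma eqv_square: "i \<in> I \<Longrightarrow> genX i * genX i \<doteq> genX i * genA (kappa1 i)"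
  by (rule eqv_rel) (auto simp: relations_def rel2_def)

text \<open>The elements congruent to combinations of words of length less than \<open>n\<close> in the \<open>X\<^sub>i\<close>,
  with coefficients from \<open>S\<close> on the right. The spanning argument is an induction along this filtration, and the strict
  inequality makes \<open>V (length ks)\<close> the part that is shorter than the word \<open>ks\<close>.\<close>

inductive_set V :: "nat \<Rightarrow> (('k + 'i) word \<Rightarrow>\<^sub>0 'r) set" for n where
  V_word: "set ks \<subseteq> I \<Longrightarrow> length ks < n \<Longrightarrow> a \<in> S \<Longrightarrow> Xm ks * genA a \<in> V n"
| V_0: "0 \<in> V n"
| V_add: "p \<in> V n \<Longrightarrow> q \<in> V n \<Longrightarrow> p + q \<in> V n"
| V_eqv: "p \<in> V n \<Longrightarrow> q \<in> fa \<Longrightarrow> q \<doteq> p \<Longrightarrow> q \<in> V n"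

lemma V_fa: "p \<in> V n \<Longrightarrow> p \<in> fa"
  by (induction rule: V.induct) (auto intro: fa_add fa_mult)

lemma V_mono: "p \<in> V n \<Longrightarrow> n \<le> m \<Longrightarrow> p \<in> V m"
  by (induction rule: V.induct) (auto intro: V.intros)

lemma V_rA: "p \<in> V n \<Longrightarrow> b \<in> S \<Longrightarrow> p * genA b \<in> V n"
proof (induction rule: V.induct)
  case (V_word ks a)
  have "Xm ks * (genA a * genA b) \<doteq> Xm ks * genA (a * b)"
    using V_word by (intro eqv_mult_left eqv_sym[OF genA_hom(2)] fa_Xm)
  then have eqv: "Xm ks * genA a * genA b \<doteq> Xm ks * genA (a * b)" by (simp only: mult.assoc)
  have mem: "Xm ks * genA (a * b) \<in> V n" using V_word by (intro V.V_word S_mult)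
  have "Xm ks * genA a * genA b \<in> fa" using V_word by (intro fa_mult fa_Xm fa_genA)
  then show ?case using eqv by (rule V.V_eqv[OF mem])
next
  case (V_eqv p q)
  have "p * genA b \<in> V n" by (rule V_eqv.IH[OF V_eqv.prems])
  moreover have "q * genA b \<in> fa" using V_eqv.hyps V_eqv.prems by (intro fa_mult fa_genA)
  moreover have "q * genA b \<doteq> p * genA b" using V_eqv.hyps V_eqv.prems by (intro eqv_mult_right fa_genA)
  ultimately show ?case by (rule V.V_eqv)
qed (auto simp: distrib_right intro: V.intros)

lemma V_uminus: "p \<in> V n \<Longrightarrow> - p \<in> V n"
proof -
  assume p: "p \<in> V n"
  have "p * genA (scalar (- 1)) \<in> V n" using p by (intro V_rA) auto
  moreover have "- p \<doteq> p * genA (scalar (- 1))"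
  proof -
    have "- p = p * Poly_Mapping.single 0 (- 1)" by (simp add: single_uminus)
    moreover have "p * Poly_Mapping.single 0 (- 1) \<doteq> p * genA (scalar (- 1))"
      by (intro eqv_mult_left eqv_sym[OF genA_hom(3)] V_fa[OF p])
    ultimately show ?thesis by simp
  qed
  ultimately show ?thesis using V_eqv fa_uminus[OF V_fa[OF p]] by blast
qed

lemma V_diff: "p \<in> V n \<Longrightarrow> q \<in> V n \<Longrightarrow> p - q \<in> V n"
  using V_add[OF _ V_uminus] by fastforce

lemma V_lX: "p \<in> V n \<Longrightarrow> i \<in> I \<Longrightarrow> genX i * p \<in> V (Suc n)"
proof (induction rule: V.induct)
  case (V_word ks a)
  then have "Xm (i # ks) * genA a \<in> V (Suc n)" by (intro V.V_word) auto
  then show ?case by (simp add: mult.assoc)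
next
  case (V_eqv p q)
  have "genX i * p \<in> V (Suc n)" by (rule V_eqv.IH[OF V_eqv.prems])
  moreover have "genX i * q \<in> fa" using V_eqv.hyps V_eqv.prems by (intro fa_mult fa_genX)
  moreover have "genX i * q \<doteq> genX i * p" using V_eqv.hyps V_eqv.prems by (intro eqv_mult_left fa_genX)
  ultimately show ?case by (rule V.V_eqv)
qed (auto simp: distrib_left intro: V.intros)

lemma V_lXm: "set ks \<subseteq> I \<Longrightarrow> p \<in> V n \<Longrightarrow> Xm ks * p \<in> V (length ks + n)"
  by (induction ks) (auto simp: mult.assoc intro: V_lX)

text \<open>The commutation relation moves a coefficient to the right past one letter, at the cost of a term with this letter
  deleted.\<close>

lemma V_lA_word: "set ks \<subseteq> I \<Longrightarrow> a \<in> S \<Longrightarrow> genA a * Xm ks \<in> V (Suc (length ks))"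
proof (induction ks arbitrary: a)
  case Nil
  have "Xm [] * genA a \<in> V (Suc 0)" using Nil by (intro V_word) auto
  then show ?case by simp
next
  case (Cons k ks)
  have k: "k \<in> I" "set ks \<subseteq> I" using Cons.prems by auto
  have "(genA a * genX k) * Xm ks \<doteq> (genX k * genA (act (s k) a) + genA (Dlt k a)) * Xm ks"
    using k Cons.prems by (intro eqv_mult_right eqv_commute) auto
  then have "genA a * Xm (k # ks) \<doteq> genX k * (genA (act (s k) a) * Xm ks) + genA (Dlt k a) * Xm ks"
    by (simp add: distrib_right mult.assoc)
  moreover have "genX k * (genA (act (s k) a) * Xm ks) \<in> V (Suc (Suc (length ks)))"
    using k Cons.prems by (intro V_lX Cons.IH act_s_closed)
  moreover have "genA (Dlt k a) * Xm ks \<in> V (Suc (Suc (length ks)))"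
    by (rule V_mono[OF Cons.IH[OF k(2) Dlt_S[OF k(1) Cons.prems(2)]]]) simp
  moreover have "genA a * Xm (k # ks) \<in> fa" using Cons.prems by (intro fa_mult fa_genA fa_Xm)
  ultimately show ?case unfolding list.size add_Suc_right add_0_right by (rule V_eqv[OF V_add, rotated 3])
qed

lemma V_lA: "p \<in> V n \<Longrightarrow> b \<in> S \<Longrightarrow> genA b * p \<in> V n"
proof (induction rule: V.induct)
  case (V_word ks a)
  have "genA b * Xm ks \<in> V n" by (rule V_mono[OF V_lA_word]) (use V_word in auto)
  then have "(genA b * Xm ks) * genA a \<in> V n" by (rule V_rA) (use V_word in simp)
  then show ?case by (simp add: mult.assoc)
next
  case (V_eqv p q)
  have "genA b * p \<in> V n" by (rule V_eqv.IH[OF V_eqv.prems])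
  moreover have "genA b * q \<in> fa" using V_eqv.hyps V_eqv.prems by (intro fa_mult fa_genA)
  moreover have "genA b * q \<doteq> genA b * p" using V_eqv.hyps V_eqv.prems by (intro eqv_mult_left fa_genA)
  ultimately show ?case by (rule V.V_eqv)
qed (auto simp: distrib_left intro: V.intros)

lemma V_rXm: "p \<in> V n \<Longrightarrow> set vs \<subseteq> I \<Longrightarrow> p * Xm vs \<in> V (n + length vs)"
proof (induction rule: V.induct)
  case (V_word ks a)
  have "genA a * Xm vs \<in> V (Suc (length vs))" using V_word by (intro V_lA_word)
  then have "Xm ks * (genA a * Xm vs) \<in> V (length ks + Suc (length vs))" using V_word by (intro V_lXm)
  then show ?case using V_word by (auto simp: mult.assoc intro: V_mono)
next
  case (V_eqv p q)
  have "p * Xm vs \<in> V (n + length vs)" by (rule V_eqv.IH[OF V_eqv.prems])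
  moreover have "q * Xm vs \<in> fa" using V_eqv.hyps V_eqv.prems by (intro fa_mult fa_Xm)
  moreover have "q * Xm vs \<doteq> p * Xm vs" using V_eqv.hyps V_eqv.prems by (intro eqv_mult_right fa_Xm)
  ultimately show ?case by (rule V.V_eqv)
qed (auto simp: distrib_right intro: V.intros)

lemma fa_V: "p \<in> fa \<Longrightarrow> \<exists>n. p \<in> V n"
proof (induction rule: fa_induct)
  case zero
  then show ?case by (blast intro: V_0)
next
  case (add p q)
  then obtain n m where "p \<in> V n" "q \<in> V m" by blast
  then have "p + q \<in> V (max n m)" using V_mono[of p n "max n m"] V_mono[of q m "max n m"] by (intro V_add) simp_all
  then show ?case by blast
next
  case (single w r)
  have "\<exists>n. Poly_Mapping.single (Word gs) r \<in> V n" if "set gs \<subseteq> Gens" for gs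
    using that
  proof (induction gs)
    case Nil
    have "Poly_Mapping.single (Word []) r \<doteq> Xm [] * genA (scalar r)"
      using eqv_sym[OF genA_hom(3)[of r]] by (simp add: zero_word_def)
    moreover have "Xm [] * genA (scalar r) \<in> V 1" by (intro V_word) auto
    moreover have "Poly_Mapping.single (Word []) r \<in> fa" by (intro fa_single) simp
    ultimately show ?case using V_eqv by blast
  next
    case (Cons g gs)
    then obtain n where n: "Poly_Mapping.single (Word gs) r \<in> V n" by auto
    have eq: "Poly_Mapping.single (Word (g # gs)) r = free_gen g * Poly_Mapping.single (Word gs) r"
      by (simp add: free_gen_def mult_single plus_word_def)
    from Cons.prems consider a where "g = Inl a" "a \<in> S" | i where "g = Inr i" "i \<in> I" by auto
    then show ?case unfolding eq using V_lA[OF n] V_lX[OF n] by cases blast+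
  qed
  from this[of "letters w"] show ?case using single by (cases w) auto
qed

text \<open>All words on the right of the braid relations are shorter than the two on the left.\<close>

lemma braid_V:
  assumes "(p, q) \<in> braids"
  shows "Xm p - Xm q \<in> V (length p)"
proof -
  have Xi: "genX i * genA a \<in> V n" if "i \<in> I" "a \<in> S" "n > 1" for i a n
    using V_word[of "[i]" n a] that by simp
  have rel: "Xm p - Xm q \<in> V n"
    if "(l, r) \<in> relations (FA S) genA genX S" "l = Xm p - Xm q" "r \<in> V n" for l r n
    using V_eqv[OF that(3), of l] eqv_rel[of l r] relations_ev[OF that(1)] that by auto
  from assms consider
    i j where "p = [i, j]" "q = [j, i]" "i \<in> I" "j \<in> I" "cr (al i) (al j) = 0"
  | i j where "p = [j, i, j]" "q = [i, j, i]" "i \<in> I" "j \<in> I" "i \<noteq> j" "cr (al i) (al j) = -1" "cr (al j) (al i) = -1"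
  | i j where "p = [j, i, j, i]" "q = [i, j, i, j]" "i \<in> I" "j \<in> I" "i \<noteq> j" "cr (al i) (al j) = -1" "cr (al j) (al i) = -2"
  | i j where "p = [j, i, j, i, j, i]" "q = [i, j, i, j, i, j]" "i \<in> I" "j \<in> I" "i \<noteq> j"
      "cr (al i) (al j) = -1" "cr (al j) (al i) = -3"
    unfolding braids_def by blast
  then show ?thesis
  proof cases
    case 1
    then have "(genX i * genX j, genX j * genX i) \<in> rels" by (auto simp: relations_def rel3_def)
    then have "Xm p \<doteq> Xm q" using 1 eqv_rel by simp
    then have "Xm p - Xm q \<doteq> 0" by (simp add: eqv_def)
    moreover have "Xm p - Xm q \<in> fa" using 1 by (intro fa_diff fa_Xm) auto
    ultimately show ?thesis using V_eqv[OF V_0] by blast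
  next
    case (2 i j)
    have "(Xm p \<ominus>\<^bsub>FA S\<^esub> Xm q, genX i * genA (kappa (al i) (al j)) \<ominus>\<^bsub>FA S\<^esub> genX j * genA (kappa (al j) (al i))) \<in> rel4a (FA S) genA genX"
      using 2 unfolding rel4a_def Xm_def FA_ops[symmetric] by blast
    then show ?thesis
      using 2 kappa_al_S[of i j] kappa_al_S[of j i]
      by (intro rel[of "Xm p \<ominus>\<^bsub>FA S\<^esub> Xm q"])
        (auto simp: relations_def FA_minus fa_mult simp del: Xm_simps intro!: V_diff Xi)
  next
    case (3 i j)
    let ?A = "B2A i j"
    let ?B = "B2B i j"
    let ?r = "Xm [i, j] * genA ?A \<ominus>\<^bsub>FA S\<^esub> Xm [j, i] * genA ?B + genX j * genA (Dlt i ?B) \<ominus>\<^bsub>FA S\<^esub> genX i * genA (Dlt j ?A)"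
    have AB: "?A \<in> S" "?B \<in> S" using rel4b_coeffs[of i j] 3 by auto
    have "(Xm p \<ominus>\<^bsub>FA S\<^esub> Xm q, ?r) \<in> rel4b (FA S) genA genX"
      using 3 unfolding rel4b_def Let_def Xm_def FA_ops[symmetric] by blast
    then show ?thesis
      using 3 AB Dlt_S[OF _ AB(1)] Dlt_S[OF _ AB(2)]
      by (intro rel[of "Xm p \<ominus>\<^bsub>FA S\<^esub> Xm q" ?r])
        (auto simp: relations_def FA_minus fa_mult simp del: Xm_simps intro!: V_diff V_add Xi V_word)
  next
    case (4 i j)
    let ?A = "G2A i j"
    let ?B = "G2B i j"
    let ?r = "Xm [i, j, i, j] * genA ?A \<ominus>\<^bsub>FA S\<^esub> Xm [j, i, j, i] * genA ?B
       + Xm [j, i, j] * genA (Dlt i ?B) \<ominus>\<^bsub>FA S\<^esub> Xm [i, j, i] * genA (Dlt j ?A)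
       + Xm [i, j] * genA (xi_ij i j) \<ominus>\<^bsub>FA S\<^esub> Xm [j, i] * genA (xi_ji i j)
       + genX j * genA (Dlt i (xi_ji i j)) \<ominus>\<^bsub>FA S\<^esub> genX i * genA (Dlt j (xi_ij i j))"
    have AB: "?A \<in> S" "?B \<in> S" using rel4c_coeffs[of i j] 4 by auto
    have "(Xm p \<ominus>\<^bsub>FA S\<^esub> Xm q, ?r) \<in> rel4c (FA S) genA genX"
      using 4 unfolding rel4c_def Let_def Xm_def FA_ops[symmetric] by blast
    then show ?thesis
      using 4 AB Dlt_S[OF _ AB(1)] Dlt_S[OF _ AB(2)] xi_S[of i j] xi_Dlt_S[of i j]
      by (intro rel[of "Xm p \<ominus>\<^bsub>FA S\<^esub> Xm q" ?r])
        (auto simp: relations_def FA_minus fa_mult simp del: Xm_simps intro!: V_diff V_add Xi V_word)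
  qed
qed

text \<open>Being equal up to shorter words is a congruence of the kind treated by the theorem of Matsumoto.\<close>

lemma reduced_words_V:
  assumes u: "set u \<subseteq> I" "length u = len (wd u)" and v: "set v \<subseteq> I" "length v = len (wd v)" and uv: "wd u = wd v"
  shows "Xm u - Xm v \<in> V (length u)"
proof -
  define R where "R u v \<longleftrightarrow> set u \<subseteq> I \<and> set v \<subseteq> I \<and> length u = length v \<and> Xm u - Xm v \<in> V (length u)" for u v
  have "R u v"
  proof (rule word_property[OF _ _ _ _ _ u v uv])
    show "R u u" if "set u \<subseteq> I" for u using that V_0 by (simp add: R_def)
    have Rd: "set u \<subseteq> I" "set v \<subseteq> I" "length v = length u" "Xm u - Xm v \<in> V (length u)" if "R u v" for u v
      using that unfolding R_def by (blast intro: sym)+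
    show "R v u" if "R u v" for u v
      unfolding R_def using Rd[OF that] V_uminus[OF Rd(4)[OF that]] by simp
    show "R u w" if "R u v" "R v w" for u v w
      unfolding R_def using Rd[OF that(1)] Rd[OF that(2)] V_add[of "Xm u - Xm v" "length u" "Xm v - Xm w"] by simp
    show "R (i # u) (i # v)" if "i \<in> I" "R u v" for i u v
      unfolding R_def using Rd[OF that(2)] that(1) V_lX[OF Rd(4)[OF that(2)] that(1)] by (simp add: right_diff_distrib)
    show "R (p @ vs) (q @ vs)" if pq: "(p, q) \<in> braids" and vs: "set vs \<subseteq> I" for p q vs
    proof -
      have "(Xm p - Xm q) * Xm vs \<in> V (length p + length vs)" by (rule V_rXm[OF braid_V[OF pq] vs])
      then show ?thesis using braid_set[OF pq] vs by (simp add: R_def Xm_append left_diff_distrib)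
    qed
  qed
  then show ?thesis unfolding R_def by blast
qed

text \<open>Consider the shortest non-reduced tail of the word. Up to shorter words its reduced part can be replaced by a reduced
  word with the same first letter as the one in front of it, and then the relation for the square of this letter shortens the
  word.\<close>

lemma nonreduced_V:
  assumes "set ks \<subseteq> I" "len (wd ks) < length ks"
  shows "Xm ks \<in> V (length ks)"
  using assms
proof (induction ks)
  case Nil
  then show ?case by simp
next
  case (Cons k ks)
  have k: "k \<in> I" "set ks \<subseteq> I" using Cons.prems by auto
  show ?case
  proof (cases "len (wd ks) < length ks")
    case True
    then show ?thesis using Cons.IH k V_lX by simp
  next
    case False
    then have red: "len (wd ks) = length ks" using len_le[OF k(2)] by simp
    define v where "v = rw (wd (k # ks))"
    have W: "wd (k # ks) \<in> W" using Cons.prems wd_W by blast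
    have v: "set v \<subseteq> I" "length v = len (wd (k # ks))" "wd v = wd (k # ks)" using rw_props[OF W] by (auto simp: v_def)
    have kv: "wd (k # v) = wd ks" using k v by (simp add: refl_refl_comp)
    have "len (wd ks) \<le> Suc (length v)" using len_le[of "k # v"] k v kv by simp
    then have "Suc (length v) = length ks \<or> Suc (length v) = Suc (length ks)"
      using Cons.prems(2) red v(2) by (simp del: wd_simps) linarith
    moreover have "length v \<noteq> length ks"
    proof
      assume e: "length v = length ks"
      show False
      proof (cases "pos (inv_into UNIV (wd ks) (al k))")
        case True
        then show False using len_ascent[OF k(1) wd_W[OF k(2)]] e v red by simp
      next
        case False
        then show False using len_descent[OF k(1) wd_W[OF k(2)]] e v red by simp
      qed
    qed
    ultimately have lv: "Suc (length v) = length ks" by simp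
    have "Xm ks - Xm (k # v) \<in> V (length ks)"
      by (rule reduced_words_V) (use k v kv lv red in auto)
    then have 1: "genX k * (Xm ks - Xm (k # v)) \<in> V (Suc (length ks))" using k by (intro V_lX)
    have "(genX k * genX k) * Xm v \<doteq> (genX k * genA (kappa1 k)) * Xm v"
      using k v by (intro eqv_mult_right eqv_square) auto
    then have "genX k * Xm (k # v) \<doteq> genX k * (genA (kappa1 k) * Xm v)" by (simp add: mult.assoc)
    moreover have "genX k * (genA (kappa1 k) * Xm v) \<in> V (Suc (Suc (length v)))"
      using k v by (intro V_lX V_lA_word kappa1_S) auto
    moreover have "genX k * Xm (k # v) \<in> fa"
      unfolding Xm_simps by (intro fa_mult fa_genX fa_Xm k v)
    ultimately have 2: "genX k * Xm (k # v) \<in> V (Suc (length ks))" using V_eqv unfolding lv by blast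
    have "Xm (k # ks) = genX k * (Xm ks - Xm (k # v)) + genX k * Xm (k # v)" by (simp add: right_diff_distrib)
    then show ?thesis using V_add[OF 1 2] by simp
  qed
qed

section \<open>The standard monomials span\<close>

text \<open>Right \<open>S\<close>-combinations of the standard monomials, one for each \<open>w\<close> in
  \<open>W\<close>.\<close>

definition normal :: "(('k + 'i) word \<Rightarrow>\<^sub>0 'r) \<Rightarrow> bool" where
  "normal p \<longleftrightarrow> (\<exists>c. (\<forall>w\<in>W. c w \<in> S) \<and> p \<doteq> (\<Sum>w\<in>W. Xm (rw w) * genA (c w)))"

lemma fa_rw [simp]: "w \<in> W \<Longrightarrow> Xm (rw w) \<in> fa"
  using rw_props fa_Xm by blast

lemma normal_0: "normal 0"
proof -
  have "(\<Sum>w\<in>W. Xm (rw w) * genA 0) \<doteq> (\<Sum>w\<in>W. Xm (rw w) * 0)"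
    by (intro eqv_sum eqv_mult_left genA_0) simp
  then show ?thesis unfolding normal_def by (intro exI[of _ "\<lambda>w. 0"]) (simp add: eqv_sym)
qed

lemma normal_eqv: "normal p \<Longrightarrow> q \<doteq> p \<Longrightarrow> normal q"
  unfolding normal_def using eqv_trans by blast

lemma normal_add: "normal p \<Longrightarrow> normal q \<Longrightarrow> normal (p + q)"
proof -
  assume "normal p" "normal q"
  then obtain c d where c: "\<forall>w\<in>W. c w \<in> S" "p \<doteq> (\<Sum>w\<in>W. Xm (rw w) * genA (c w))"
    and d: "\<forall>w\<in>W. d w \<in> S" "q \<doteq> (\<Sum>w\<in>W. Xm (rw w) * genA (d w))" by (auto simp: normal_def)
  have "p + q \<doteq> (\<Sum>w\<in>W. Xm (rw w) * (genA (c w) + genA (d w)))"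
    using eqv_add[OF c(2) d(2)] by (simp add: distrib_left sum.distrib)
  also have "\<dots> \<doteq> (\<Sum>w\<in>W. Xm (rw w) * genA (c w + d w))"
    using c d by (intro eqv_sum eqv_mult_left eqv_sym[OF genA_hom(1)]) auto
  finally show ?thesis using c d unfolding normal_def by (intro exI[of _ "\<lambda>w. c w + d w"]) (auto intro: S_add)
qed

lemma normal_rA: "normal p \<Longrightarrow> b \<in> S \<Longrightarrow> normal (p * genA b)"
proof -
  assume "normal p" and b: "b \<in> S"
  then obtain c where c: "\<forall>w\<in>W. c w \<in> S" "p \<doteq> (\<Sum>w\<in>W. Xm (rw w) * genA (c w))" by (auto simp: normal_def)
  have "p * genA b \<doteq> (\<Sum>w\<in>W. Xm (rw w) * genA (c w)) * genA b" using c b by (intro eqv_mult_right) auto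
  also have "\<dots> = (\<Sum>w\<in>W. Xm (rw w) * (genA (c w) * genA b))" by (simp add: sum_distrib_right mult.assoc)
  also have "\<dots> \<doteq> (\<Sum>w\<in>W. Xm (rw w) * genA (c w * b))"
    using c b by (intro eqv_sum eqv_mult_left eqv_sym[OF genA_hom(2)]) auto
  finally show ?thesis using c b unfolding normal_def by (intro exI[of _ "\<lambda>w. c w * b"]) (auto intro: S_mult)
qed

lemma normal_rw: "w \<in> W \<Longrightarrow> normal (Xm (rw w))"
proof -
  assume w: "w \<in> W"
  have "Xm (rw w) = (\<Sum>v\<in>W. Xm (rw v) * (if v = w then 1 else 0))"
    using w finite_W by (simp add: if_distrib sum.delta cong: if_cong)
  also have "\<dots> \<doteq> (\<Sum>v\<in>W. Xm (rw v) * genA (if v = w then 1 else 0))"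
    by (intro eqv_sum eqv_mult_left) (auto intro: eqv_sym genA_0 genA_1)
  finally show ?thesis unfolding normal_def by (intro exI[of _ "\<lambda>v. if v = w then 1 else 0"]) auto
qed

text \<open>Non-reduced words are shorter ones modulo the relations, and a reduced word is the chosen one up to shorter
  words.\<close>

lemma V_normal: "p \<in> V n \<Longrightarrow> normal p"
proof (induction n arbitrary: p rule: less_induct)
  case (less n)
  from less.prems show ?case
  proof (induction rule: V.induct)
    case (V_word ks a)
    have "normal (Xm ks)"
    proof (cases "len (wd ks) < length ks")
      case True
      then show ?thesis using less.IH[OF _ nonreduced_V] V_word by blast
    next
      case False
      then have red: "length ks = len (wd ks)" using len_le[OF V_word(1)] by simp
      have w: "wd ks \<in> W" using V_word wd_W by blast
      have "Xm ks - Xm (rw (wd ks)) \<in> V (length ks)"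
        by (rule reduced_words_V) (use V_word red rw_props[OF w] in auto)
      then have "normal (Xm ks - Xm (rw (wd ks)))" using less.IH V_word by blast
      from normal_add[OF this normal_rw[OF w]] show ?thesis by simp
    qed
    then show ?case using V_word by (intro normal_rA)
  qed (auto intro: normal_0 normal_add normal_eqv)
qed

section \<open>Triangularity and completeness of the relations\<close>

text \<open>The monomial of a word of length \<open>n\<close> lives on elements of length at most \<open>n\<close>, and among
  those of length \<open>n\<close> only on the product of the word, since each letter acts by comparing the values at
  \<open>u\<close> and \<open>s\<^sub>k u\<close>.\<close>

lemma mono_support:
  assumes "set ks \<subseteq> I" "u \<in> W" "monomial QW Xel ks u \<noteq> 0"
  shows "len u \<le> length ks \<and> (len u = length ks \<longrightarrow> u = wd ks)"
  using assms
proof (induction ks arbitrary: u)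
  case Nil
  have "len id = 0" using len_le[of "[]"] by simp
  moreover have "u = id" using Nil by (simp add: coef_def split: if_splits)
  ultimately show ?case by (simp only: list.size wd_simps(1) order_refl simp_thms)
next
  case (Cons k ks)
  have k: "k \<in> I" "set ks \<subseteq> I" using Cons.prems by auto
  have "monomial QW Xel ks u \<noteq> 0 \<or> monomial QW Xel ks (s k \<circ> u) \<noteq> 0"
    using Cons.prems X_mult[OF k(1) mono_carrier[OF k(2)]] by auto
  then show ?case
  proof
    assume "monomial QW Xel ks u \<noteq> 0"
    then show ?thesis using Cons.IH[OF k(2) Cons.prems(2)] by auto
  next
    assume n: "monomial QW Xel ks (s k \<circ> u) \<noteq> 0"
    have su: "s k \<circ> u \<in> W" using k Cons.prems by (simp add: W_comp)
    have ih: "len (s k \<circ> u) \<le> length ks \<and> (len (s k \<circ> u) = length ks \<longrightarrow> s k \<circ> u = wd ks)"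
      by (rule Cons.IH[OF k(2) su n])
    have "len u \<le> Suc (len (s k \<circ> u))"
      using len_refl_le[OF k(1) su] k by (simp add: s_invol)
    moreover have "u = s k \<circ> wd ks" if "s k \<circ> u = wd ks" using that k by (metis s_invol)
    ultimately show ?thesis using ih by (auto simp: le_Suc_eq)
  qed
qed

text \<open>At each letter of a reduced word the value at the shorter element is multiplied, up to sign, by the inverse of
  \<open>x\<close> at a root, while the value at the longer element was still \<open>0\<close>.\<close>

lemma mono_leading:
  assumes "set ks \<subseteq> I" "length ks = len (wd ks)"
  shows "monomial QW Xel ks (wd ks) \<noteq> 0"
  using assms
proof (induction ks)
  case Nil
  have "E id \<noteq> 0" by (simp only: coef_def simp_thms if_True one_neq_zero not_False_eq_True)
  then show ?case unfolding mono_simps(1) wd_simps(1) .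
next
  case (Cons k ks)
  have k: "k \<in> I" "set ks \<subseteq> I" using Cons.prems by auto
  have W: "wd (k # ks) \<in> W" using Cons.prems wd_W by blast
  have "len (wd (k # ks)) \<le> Suc (len (wd ks))" using len_refl_le[OF k(1) wd_W[OF k(2)]] by simp
  then have red: "length ks = len (wd ks)" using len_le[OF k(2)] Cons.prems(2) by (simp del: wd_simps)
  have "monomial QW Xel ks (wd (k # ks)) = 0"
  proof (rule ccontr)
    assume "monomial QW Xel ks (wd (k # ks)) \<noteq> 0"
    then have "len (wd (k # ks)) \<le> length ks" using mono_support[OF k(2) W] by blast
    then show False using Cons.prems(2) by (simp del: wd_simps)
  qed
  moreover have "s k \<circ> wd (k # ks) = wd ks" using k by (simp add: s_invol)
  moreover have "z (Inv (wd (k # ks)) (al k)) \<noteq> 0"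
    using W_inv_Phi[OF W, of "al k"] Phi_nonzero k by (simp add: z_def x_eq_0_iff)
  ultimately show ?case
    using X_mult[OF k(1) mono_carrier[OF k(2)] W] Cons.IH[OF k(2) red] by (simp del: wd_simps)
qed

text \<open>By the two preceding lemmas the standard monomials are triangular with non-zero diagonal: a longest \<open>v\<close>
  with \<open>c v \<noteq> 0\<close> is reached by its own monomial only.\<close>

lemma standard_independent:
  assumes c: "\<And>u. u \<in> W \<Longrightarrow> (\<Sum>w\<in>W. monomial QW Xel (rw w) u * c w) = 0" and w: "w \<in> W"
  shows "c w = 0"
proof (rule ccontr)
  assume "c w \<noteq> 0"
  define N where "N = {w \<in> W. c w \<noteq> 0}"
  have N: "finite N" "N \<noteq> {}" using finite_W w \<open>c w \<noteq> 0\<close> by (auto simp: N_def)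
  define m where "m = Max (len ` N)"
  have "m \<in> len ` N" unfolding m_def using N by (intro Max_in) auto
  then obtain v where v: "v \<in> W" "c v \<noteq> 0" "len v = m" by (auto simp: N_def)
  have le: "len w \<le> m" if "w \<in> W" "c w \<noteq> 0" for w
    unfolding m_def using N(1) that by (intro Max_ge) (auto simp: N_def)
  have "monomial QW Xel (rw w) v * c w = 0" if "w \<in> W" "w \<noteq> v" for w
  proof (rule ccontr)
    assume "monomial QW Xel (rw w) v * c w \<noteq> 0"
    then have n: "monomial QW Xel (rw w) v \<noteq> 0" "c w \<noteq> 0" by auto
    have "m \<le> len w \<and> (m = len w \<longrightarrow> v = w)"
      using mono_support[of "rw w" v] rw_props[OF that(1)] n(1) v by auto
    then show False using le[OF that(1) n(2)] that by auto
  qed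
  then have "(\<Sum>w\<in>W. monomial QW Xel (rw w) v * c w) = (\<Sum>w\<in>W. if w = v then monomial QW Xel (rw v) v * c v else 0)"
    by (intro sum.cong) auto
  then have "monomial QW Xel (rw v) v * c v = 0" using c[OF v(1)] v(1) finite_W by simp
  moreover have "monomial QW Xel (rw v) v \<noteq> 0" using mono_leading[of "rw v"] rw_props[OF v(1)] by auto
  ultimately show False using v by simp
qed

text \<open>Modulo the relations an element of the kernel is a combination of standard monomials, and these are independent after
  evaluation.\<close>

lemma kernel_ev: "a_kernel (FA S) QW ev = PI"
proof (intro equalityI subsetI)
  fix p assume "p \<in> PI"
  from PI_ev[OF this] PI_fa[OF this] show "p \<in> a_kernel (FA S) QW ev" unfolding kernel_iff by blast
next
  fix p assume "p \<in> a_kernel (FA S) QW ev"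
  then have p: "p \<in> fa" "ev p = (\<lambda>u. 0)" unfolding kernel_iff by blast+
  obtain c where c: "\<forall>w\<in>W. c w \<in> S" "p \<doteq> (\<Sum>w\<in>W. Xm (rw w) * genA (c w))" (is "_ \<doteq> ?q")
    using fa_V[OF p(1)] V_normal unfolding normal_def by blast
  have "ev (p - ?q) = (\<lambda>u. 0)" using c(2) PI_ev by (simp add: eqv_def)
  then have 0: "ev ?q u = 0" for u using p(2) by (simp add: ev_diff fun_eq_iff)
  have "ev ?q u = (\<Sum>w\<in>W. monomial QW Xel (rw w) u * c w)" for u
    unfolding ev_sum
  proof (rule sum.cong[OF refl])
    fix w assume w: "w \<in> W"
    have "ev (Xm (rw w) * genA (c w)) = monomial QW Xel (rw w) \<otimes>\<^bsub>QW\<^esub> coef (c w)"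
      using w c rw_props[OF w] by (simp add: ev_mult ev_Xm ev_genA)
    also have "\<dots> = (\<lambda>u. monomial QW Xel (rw w) u * c w)"
      using rw_props[OF w] by (intro mult_coef QW_supp mono_carrier) auto
    finally show "ev (Xm (rw w) * genA (c w)) u = monomial QW Xel (rw w) u * c w" by simp
  qed
  then have "c w = 0" if "w \<in> W" for w using standard_independent[of c w] 0 that by simp
  then have "?q = (\<Sum>w\<in>W. Xm (rw w) * genA 0)" by simp
  also have "\<dots> \<doteq> (\<Sum>w\<in>W. Xm (rw w) * 0)" by (intro eqv_sum eqv_mult_left genA_0) simp
  finally have "p \<doteq> 0" using eqv_trans[OF c(2)] by simp
  then show "p \<in> PI" by (simp add: eqv_def)
qed

theorem complete_D: "complete_relations S D_ring coef Xel"
proof -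
  define h where "h = (\<lambda>C. the_elem (ev ` C))"
  have "h \<in> ring_iso (presented S) D_ring"
    using evh.FactRing_iso_set_aux unfolding h_def presented_def D_ring_def kernel_ev image_ev .
  moreover have "h (PI +>\<^bsub>FA S\<^esub> p) = ev p" if "p \<in> fa" for p
    using evh.the_elem_simp[OF that] by (simp add: h_def kernel_ev)
  ultimately show ?thesis
    unfolding complete_relations_def by (intro bexI[of _ h]) (auto simp: ev_genA ev_genX)
qed

end

section \<open>Extension of coefficients\<close>

context formal_demazure
begin

lemma D_closed:
  assumes "d \<in> D" "e \<in> D"
  shows "d \<in> carrier QW" "(\<lambda>u. d u + e u) \<in> D" "(\<lambda>u. d u - e u) \<in> D" "d \<otimes>\<^bsub>QW\<^esub> e \<in> D" "(\<lambda>u. 0) \<in> D"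
proof -
  note sub = subringE[OF D_subring]
  show "d \<in> carrier QW" using assms sub(1) by blast
  have ce: "e \<in> carrier QW" using assms sub(1) by blast
  show "(\<lambda>u. d u + e u) \<in> D" using sub(7)[OF assms] by (simp add: QW_add)
  show "(\<lambda>u. d u - e u) \<in> D" using sub(7)[OF assms(1) sub(5)[OF assms(2)]] ce by (simp add: QW_add QW_minus)
  show "d \<otimes>\<^bsub>QW\<^esub> e \<in> D" by (rule sub(6)[OF assms])
  show "(\<lambda>u. 0) \<in> D" using sub(2) by (simp add: QW_zero)
qed

lemma D_coef: "a \<in> S \<Longrightarrow> coef a \<in> D" and D_X: "i \<in> I \<Longrightarrow> Xel i \<in> D"
  using D_props(2) by blast+

lemma D_one: "E \<in> D"
  by (rule D_coef) simp

text \<open>The tensor product is the free abelian group \<open>pg\<close> on the pairs modulo the subgroup generated by the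
  bilinearity relations. Since the coefficient ring has not grown, these relations take the form of \<open>tgens\<close>.\<close>

abbreviation pg :: "(((('l \<Rightarrow> 'l) \<Rightarrow> 'k) \<times> 'k) \<Rightarrow>\<^sub>0 int) set" where "pg \<equiv> carrier pairs_group"

lemma pg_iff: "c \<in> pg \<longleftrightarrow> Poly_Mapping.keys c \<subseteq> D \<times> S"
  by (simp add: pairs_group_def S_tilde_eq)

lemma pg_group: "comm_group pairs_group"
  by (simp add: pairs_group_def abelian_free_Abelian_group)

lemma pg_ops: "g \<otimes>\<^bsub>pairs_group\<^esub> g' = g + g'" "\<one>\<^bsub>pairs_group\<^esub> = 0" "g \<in> pg \<Longrightarrow> inv\<^bsub>pairs_group\<^esub> g = - g"
  by (simp_all add: pairs_group_def)

lemma pg_closed: "g \<in> pg \<Longrightarrow> g' \<in> pg \<Longrightarrow> g + g' \<in> pg" "g \<in> pg \<Longrightarrow> g' \<in> pg \<Longrightarrow> g - g' \<in> pg" "g \<in> pg \<Longrightarrow> - g \<in> pg"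
  using Poly_Mapping.keys_add[of g g'] keys_diff[of g g'] unfolding pg_iff by (blast, blast, simp)

lemma pg_frag: "d \<in> D \<Longrightarrow> a \<in> S \<Longrightarrow> frag_of (d, a) \<in> pg"
  by (simp add: pg_iff)

lemma tensor_lin_add: "tensor_lin (g + g') = (\<lambda>u. tensor_lin g u + tensor_lin g' u)"
  unfolding tensor_lin_def by (rule ext, rule setsum_keys_plus_distrib) (simp_all add: distrib_right)

lemma tensor_lin_0: "tensor_lin 0 = (\<lambda>u. 0)"
  by (simp add: tensor_lin_def)

lemma tensor_lin_diff: "tensor_lin (g - g') = (\<lambda>u. tensor_lin g u - tensor_lin g' u)"
  using tensor_lin_add[of "g - g'" g'] by (simp add: fun_eq_iff)

lemma tensor_lin_frag: "tensor_lin (frag_of (d, a)) = d \<otimes>\<^bsub>QW\<^esub> coef a"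
  by (simp add: tensor_lin_def)

abbreviation tgens :: "(((('l \<Rightarrow> 'l) \<Rightarrow> 'k) \<times> 'k) \<Rightarrow>\<^sub>0 int) set" where
  "tgens \<equiv> {frag_of (d \<oplus>\<^bsub>QW\<^esub> e, a) - frag_of (d, a) - frag_of (e, a) | d e a. d \<in> D \<and> e \<in> D \<and> a \<in> S} \<union>
      {frag_of (d, a + b) - frag_of (d, a) - frag_of (d, b) | d a b. d \<in> D \<and> a \<in> S \<and> b \<in> S} \<union>
      {frag_of (d \<otimes>\<^bsub>QW\<^esub> coef r, a) - frag_of (d, r * a) | d r a. d \<in> D \<and> r \<in> S \<and> a \<in> S}"

lemma tensor_kernel_eq: "tensor_kernel = generate pairs_group tgens"
  by (simp add: tensor_kernel_def S_tilde_eq)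

lemma tgens_pg: "tgens \<subseteq> pg"
  by (auto simp: QW_add intro!: pg_closed pg_frag D_closed S_add S_mult D_coef)

lemma tk_subgroup: "subgroup tensor_kernel pairs_group"
  unfolding tensor_kernel_eq using tgens_pg pg_group comm_group.axioms(2)
  by (intro group.generate_is_subgroup) auto

lemma tk_normal: "tensor_kernel \<lhd> pairs_group"
  using comm_group.subgroup_imp_normal[OF pg_group tk_subgroup] .

lemma tk_pg: "g \<in> tensor_kernel \<Longrightarrow> g \<in> pg"
  using subgroup.subset[OF tk_subgroup] by blast

lemma tk_add: "g \<in> tensor_kernel \<Longrightarrow> g' \<in> tensor_kernel \<Longrightarrow> g + g' \<in> tensor_kernel"
  using subgroup.m_closed[OF tk_subgroup] by (simp add: pg_ops)

lemma tk_uminus: "g \<in> tensor_kernel \<Longrightarrow> - g \<in> tensor_kernel"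
  using subgroup.m_inv_closed[OF tk_subgroup] pg_ops(3)[OF tk_pg] by fastforce

lemma tk_diff: "g \<in> tensor_kernel \<Longrightarrow> g' \<in> tensor_kernel \<Longrightarrow> g - g' \<in> tensor_kernel"
  using tk_add[OF _ tk_uminus] by fastforce

lemma tk_gen: "g \<in> tgens \<Longrightarrow> g \<in> tensor_kernel"
  unfolding tensor_kernel_eq by (rule generate.incl)

lemma tk_rel_add: "d \<in> D \<Longrightarrow> e \<in> D \<Longrightarrow> frag_of (\<lambda>u. d u + e u, 1) - frag_of (d, 1) - frag_of (e, 1) \<in> tensor_kernel"
  by (rule tk_gen, rule UnI1, rule UnI1, simp only: QW_add[symmetric]) (blast intro: S_1)

lemma tk_rel_coef: "d \<in> D \<Longrightarrow> a \<in> S \<Longrightarrow> frag_of (d \<otimes>\<^bsub>QW\<^esub> coef a, 1) - frag_of (d, a) \<in> tensor_kernel"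
  by (rule tk_gen, rule UnI2, rule CollectI, rule exI[of _ d], rule exI[of _ a], rule exI[of _ 1]) simp

lemma tensor_lin_tgens:
  assumes "h \<in> tgens"
  shows "tensor_lin h = (\<lambda>u. 0)"
proof -
  have m: "d \<otimes>\<^bsub>QW\<^esub> coef a = (\<lambda>u. d u * a)" if "d \<in> D" for d a
    using mult_coef[OF QW_supp[OF D_closed(1)[OF that that]]] .
  from assms consider
      (left) d e a where "h = frag_of (d \<oplus>\<^bsub>QW\<^esub> e, a) - frag_of (d, a) - frag_of (e, a)" "d \<in> D" "e \<in> D"
    | (right) d a b where "h = frag_of (d, a + b) - frag_of (d, a) - frag_of (d, b)" "d \<in> D"
    | (scalar) d r a where "h = frag_of (d \<otimes>\<^bsub>QW\<^esub> coef r, a) - frag_of (d, r * a)" "d \<in> D" "r \<in> S"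
    by blast
  then show ?thesis
  proof cases
    case left
    show ?thesis
      unfolding left(1) tensor_lin_diff tensor_lin_frag QW_add m[OF left(2)] m[OF left(3)] m[OF D_closed(2)[OF left(2,3)]]
      by (simp add: distrib_right)
  next
    case right
    show ?thesis
      unfolding right(1) tensor_lin_diff tensor_lin_frag m[OF right(2)] by (simp add: distrib_left)
  next
    case scalar
    show ?thesis
      unfolding scalar(1) tensor_lin_diff tensor_lin_frag m[OF D_closed(4)[OF scalar(2) D_coef[OF scalar(3)]]]
      unfolding m[OF scalar(2)] by (simp add: mult.assoc)
  qed
qed

lemma tensor_lin_kernel: "g \<in> tensor_kernel \<Longrightarrow> tensor_lin g = (\<lambda>u. 0)"
  unfolding tensor_kernel_eq
proof (induction rule: generate.induct)
  case one
  then show ?case by (simp only: pg_ops tensor_lin_0)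
next
  case (incl h)
  then show ?case by (rule tensor_lin_tgens)
next
  case (inv h)
  have "h \<in> pg" using tgens_pg inv by (rule subsetD)
  then show ?case
    using tensor_lin_diff[of 0 h] by (simp add: pg_ops tensor_lin_tgens[OF inv] tensor_lin_0)
next
  case (eng h1 h2)
  then show ?case by (simp add: pg_ops tensor_lin_add)
qed

text \<open>Every tensor is pure: \<open>d \<otimes> a = d a \<otimes> 1\<close>. Hence the canonical map to the twisted algebra
  is injective with image \<open>D\<close>.\<close>

lemma tensor_normal_form:
  assumes "g \<in> pg"
  shows "tensor_lin g \<in> D \<and> g - frag_of (tensor_lin g, 1) \<in> tensor_kernel"
  using assms unfolding pg_iff
proof (induction rule: frag_induction)
  case zero
  have z: "(\<lambda>u. 0) \<in> D" using D_closed(5)[OF D_one D_one] .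
  have "frag_of (\<lambda>u. 0, 1) - frag_of (\<lambda>u. 0, 1) - frag_of (\<lambda>u. 0, 1) \<in> tensor_kernel"
    using tk_rel_add[OF z z] by simp
  then show ?case using z by (simp add: tensor_lin_0)
next
  case (one p)
  obtain d a where p: "p = (d, a)" "d \<in> D" "a \<in> S" using one by (cases p) auto
  have "d \<otimes>\<^bsub>QW\<^esub> coef a \<in> D" using p D_closed(4)[OF p(2) D_coef[OF p(3)]] by simp
  moreover have "frag_of (d, a) - frag_of (d \<otimes>\<^bsub>QW\<^esub> coef a, 1) \<in> tensor_kernel"
    using tk_uminus[OF tk_rel_coef[OF p(2,3)]] by simp
  ultimately show ?case by (simp add: p tensor_lin_frag)
next
  case (diff g g')
  let ?d = "\<lambda>u. tensor_lin g u - tensor_lin g' u"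
  have d: "?d \<in> D" using diff D_closed(3) by blast
  have "frag_of (\<lambda>u. ?d u + tensor_lin g' u, 1) - frag_of (?d, 1) - frag_of (tensor_lin g', 1) \<in> tensor_kernel"
    using tk_rel_add[OF d] diff by blast
  then have "frag_of (tensor_lin g, 1) - frag_of (?d, 1) - frag_of (tensor_lin g', 1) \<in> tensor_kernel" by simp
  moreover have "(g - frag_of (tensor_lin g, 1)) - (g' - frag_of (tensor_lin g', 1)) \<in> tensor_kernel"
    using diff tk_diff by blast
  ultimately have "((g - frag_of (tensor_lin g, 1)) - (g' - frag_of (tensor_lin g', 1))) +
      (frag_of (tensor_lin g, 1) - frag_of (?d, 1) - frag_of (tensor_lin g', 1)) \<in> tensor_kernel"
    using tk_add by blast
  moreover have "((g - frag_of (tensor_lin g, 1)) - (g' - frag_of (tensor_lin g', 1))) +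
      (frag_of (tensor_lin g, 1) - frag_of (?d, 1) - frag_of (tensor_lin g', 1)) = (g - g') - frag_of (?d, 1)"
    by simp
  ultimately show ?case using d by (simp add: tensor_lin_diff)
qed

abbreviation tcoset :: "(((('l \<Rightarrow> 'l) \<Rightarrow> 'k) \<times> 'k) \<Rightarrow>\<^sub>0 int) \<Rightarrow> (((('l \<Rightarrow> 'l) \<Rightarrow> 'k) \<times> 'k) \<Rightarrow>\<^sub>0 int) set" where
  "tcoset g \<equiv> tensor_kernel #>\<^bsub>pairs_group\<^esub> g"

lemma tensor_can_coset: "tensor_can (tcoset g) = tensor_lin g"
proof -
  have "tcoset g = (\<lambda>k. k + g) ` tensor_kernel" by (auto simp: r_coset_def pg_ops)
  moreover have "tensor_lin (k + g) = tensor_lin g" if "k \<in> tensor_kernel" for k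
    using that by (simp add: tensor_lin_add tensor_lin_kernel)
  moreover have "0 \<in> tensor_kernel" using subgroup.one_closed[OF tk_subgroup] by (simp add: pg_ops)
  ultimately have "tensor_lin ` tcoset g = {tensor_lin g}" by (auto simp: image_iff)
  then show ?thesis by (simp add: tensor_can_def)
qed

lemma tensor_group_carrier: "carrier tensor_group = tcoset ` pg"
  by (auto simp: tensor_group_def FactGroup_def RCOSETS_def)

lemma tcoset_eq: "g \<in> pg \<Longrightarrow> g' \<in> pg \<Longrightarrow> g - g' \<in> tensor_kernel \<Longrightarrow> tcoset g = tcoset g'"
proof -
  assume "g \<in> pg" "g' \<in> pg" "g - g' \<in> tensor_kernel"
  then have "g \<in> tcoset g'" by (force simp: r_coset_def pg_ops)
  then show ?thesis
    using group.repr_independence[OF comm_group.axioms(2)[OF pg_group] _ \<open>g' \<in> pg\<close> tk_subgroup] by simp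
qed

lemma tensor_can_inj: "inj_on tensor_can (carrier tensor_group)"
proof (rule inj_onI)
  fix s t assume "s \<in> carrier tensor_group" "t \<in> carrier tensor_group" and eq: "tensor_can s = tensor_can t"
  then obtain g g' where xy: "g \<in> pg" "g' \<in> pg" "s = tcoset g" "t = tcoset g'" by (auto simp: tensor_group_carrier)
  then have "tensor_lin g = tensor_lin g'" using eq by (simp add: tensor_can_coset)
  then have "(g - frag_of (tensor_lin g, 1)) - (g' - frag_of (tensor_lin g, 1)) \<in> tensor_kernel"
    using tensor_normal_form[OF xy(1)] tensor_normal_form[OF xy(2)] tk_diff by metis
  then show "s = t" using tcoset_eq xy by simp
qed

lemma tensor_can_image: "tensor_can ` carrier tensor_group = D"
proof (intro equalityI subsetI)
  fix d assume "d \<in> tensor_can ` carrier tensor_group"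
  then show "d \<in> D" using tensor_normal_form by (auto simp: tensor_group_carrier tensor_can_coset)
next
  fix d assume d: "d \<in> D"
  then have "tensor_can (tcoset (frag_of (d, 1))) = d"
    using mult_coef[OF QW_supp[OF D_closed(1)[OF d d]], of 1] by (simp add: tensor_can_coset tensor_lin_frag)
  moreover have "tcoset (frag_of (d, 1)) \<in> carrier tensor_group"
    unfolding tensor_group_carrier by (intro imageI pg_frag d S_1)
  ultimately show "d \<in> tensor_can ` carrier tensor_group" by (metis imageI)
qed

lemma tensor_carrier: "d \<in> D \<Longrightarrow> a \<in> S \<Longrightarrow> tensor d a \<in> carrier tensor_group"
  unfolding tensor_def tensor_group_carrier by (intro imageI pg_frag)

lemma tensor_can_tensor: "tensor_can (tensor d a) = d \<otimes>\<^bsub>QW\<^esub> coef a"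
  by (simp add: tensor_def tensor_can_coset tensor_lin_frag)

lemma tensor_can_add:
  assumes "p \<in> carrier tensor_group" "t \<in> carrier tensor_group"
  shows "p \<otimes>\<^bsub>tensor_group\<^esub> t \<in> carrier tensor_group"
    "tensor_can (p \<otimes>\<^bsub>tensor_group\<^esub> t) = tensor_can p \<oplus>\<^bsub>QW\<^esub> tensor_can t"
proof -
  obtain g g' where xy: "g \<in> pg" "g' \<in> pg" "p = tcoset g" "t = tcoset g'" using assms by (auto simp: tensor_group_carrier)
  have "p \<otimes>\<^bsub>tensor_group\<^esub> t = tcoset (g + g')"
    using normal.rcos_sum[OF tk_normal xy(1,2)] by (simp add: tensor_group_def xy pg_ops)
  then show "p \<otimes>\<^bsub>tensor_group\<^esub> t \<in> carrier tensor_group"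
    "tensor_can (p \<otimes>\<^bsub>tensor_group\<^esub> t) = tensor_can p \<oplus>\<^bsub>QW\<^esub> tensor_can t"
    using xy by (auto simp: tensor_group_carrier pg_closed tensor_can_coset tensor_lin_add QW_add)
qed

text \<open>The map \<open>d \<mapsto> d \<otimes> 1\<close>, as the inverse of the canonical map; the product of the extended
  algebra is defined through it.\<close>

abbreviation uncan :: "(('l \<Rightarrow> 'l) \<Rightarrow> 'k) \<Rightarrow> (((('l \<Rightarrow> 'l) \<Rightarrow> 'k) \<times> 'k) \<Rightarrow>\<^sub>0 int) set" where
  "uncan \<equiv> the_inv_into (carrier tensor_group) tensor_can"

lemma uncan: "d \<in> D \<Longrightarrow> uncan d \<in> carrier tensor_group" "d \<in> D \<Longrightarrow> tensor_can (uncan d) = d"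
  using the_inv_into_into[OF tensor_can_inj _ order_refl, of d] f_the_inv_into_f[OF tensor_can_inj, of d]
  by (auto simp: tensor_can_image)

lemma uncan_eq: "t \<in> carrier tensor_group \<Longrightarrow> tensor_can t = d \<Longrightarrow> uncan d = t"
  using the_inv_into_f_f[OF tensor_can_inj] by blast

lemma can_D: "t \<in> carrier tensor_group \<Longrightarrow> tensor_can t \<in> D"
  using tensor_can_image by blast

lemma D_tensor_simps: "carrier D_tensor = carrier tensor_group"
  "p \<otimes>\<^bsub>D_tensor\<^esub> t = uncan (tensor_can p \<otimes>\<^bsub>QW\<^esub> tensor_can t)"
  "p \<oplus>\<^bsub>D_tensor\<^esub> t = p \<otimes>\<^bsub>tensor_group\<^esub> t" "\<one>\<^bsub>D_tensor\<^esub> = tensor E 1"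
  by (simp_all add: D_tensor_def QW_one)

lemma E_mult: "f \<in> carrier QW \<Longrightarrow> f \<otimes>\<^bsub>QW\<^esub> E = f" "f \<in> carrier QW \<Longrightarrow> E \<otimes>\<^bsub>QW\<^esub> f = f"
  using QW.r_one[of f] QW.l_one[of f] by (simp_all only: QW_one)

lemma E_E: "E \<otimes>\<^bsub>QW\<^esub> E = E"
  by (rule E_mult) simp

lemma tensor_can_hom: "tensor_can \<in> ring_hom D_tensor QW"
proof (rule ring_hom_memI)
  fix p t assume p: "p \<in> carrier D_tensor" and t: "t \<in> carrier D_tensor"
  then have c: "tensor_can p \<in> D" "tensor_can t \<in> D" by (simp_all only: D_tensor_simps can_D)
  show "tensor_can p \<in> carrier QW" using D_closed(1)[OF c] .
  show "tensor_can (p \<otimes>\<^bsub>D_tensor\<^esub> t) = tensor_can p \<otimes>\<^bsub>QW\<^esub> tensor_can t"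
    unfolding D_tensor_simps by (rule uncan(2)[OF D_closed(4)[OF c]])
  show "tensor_can (p \<oplus>\<^bsub>D_tensor\<^esub> t) = tensor_can p \<oplus>\<^bsub>QW\<^esub> tensor_can t"
    unfolding D_tensor_simps by (rule tensor_can_add(2)) (use p t in \<open>simp_all only: D_tensor_simps\<close>)
next
  show "tensor_can \<one>\<^bsub>D_tensor\<^esub> = \<one>\<^bsub>QW\<^esub>"
    unfolding D_tensor_simps tensor_can_tensor by (simp only: QW_one E_E)
qed

text \<open>Transport of the completeness over \<open>S\<close> along the isomorphism between \<open>D\<close> and its
  extension.\<close>

theorem complete_tensor:
  "complete_relations S_tilde D_tensor (\<lambda>a. tensor \<one>\<^bsub>QW\<^esub> a) (\<lambda>i. tensor (Xel i) 1)"
proof -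
  obtain h where h: "h \<in> ring_iso (presented S) D_ring" and hA: "\<And>a. a \<in> S \<Longrightarrow> h (PI +>\<^bsub>FA S\<^esub> genA a) = coef a"
    and hX: "\<And>i. i \<in> I \<Longrightarrow> h (PI +>\<^bsub>FA S\<^esub> genX i) = Xel i"
    using complete_D unfolding complete_relations_def by blast
  have D: "carrier D_ring = D" "monoid.mult D_ring = monoid.mult QW" "add D_ring = add QW" "one D_ring = E"
    by (simp_all add: D_ring_def QW_one)
  note hm = ring_iso_memE[OF h, unfolded D]
  have iso: "uncan \<circ> h \<in> ring_iso (presented S) D_tensor"
  proof (rule ring_iso_memI)
    fix p q assume p: "p \<in> carrier (presented S)" and q: "q \<in> carrier (presented S)"
    note c = hm(1)[OF p] hm(1)[OF q]
    show "(uncan \<circ> h) p \<in> carrier D_tensor" unfolding D_tensor_simps comp_apply by (rule uncan(1)[OF c(1)])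
    show "(uncan \<circ> h) (p \<otimes>\<^bsub>presented S\<^esub> q) = (uncan \<circ> h) p \<otimes>\<^bsub>D_tensor\<^esub> (uncan \<circ> h) q"
      unfolding comp_apply hm(2)[OF p q] D_tensor_simps uncan(2)[OF c(1)] uncan(2)[OF c(2)] ..
    show "(uncan \<circ> h) (p \<oplus>\<^bsub>presented S\<^esub> q) = (uncan \<circ> h) p \<oplus>\<^bsub>D_tensor\<^esub> (uncan \<circ> h) q"
      unfolding comp_apply hm(3)[OF p q] D_tensor_simps
      by (rule uncan_eq) (simp_all only: tensor_can_add uncan c)
  next
    show "(uncan \<circ> h) \<one>\<^bsub>presented S\<^esub> = \<one>\<^bsub>D_tensor\<^esub>"
      unfolding comp_apply hm(4) D_tensor_simps
      by (rule uncan_eq) (simp_all only: tensor_can_tensor E_E tensor_carrier D_one S_1)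
  next
    have "bij_betw uncan D (carrier tensor_group)"
      using bij_betw_the_inv_into[of tensor_can "carrier tensor_group" D] tensor_can_inj tensor_can_image
      by (simp add: bij_betw_def)
    then show "bij_betw (uncan \<circ> h) (carrier (presented S)) (carrier D_tensor)"
      unfolding D_tensor_simps using hm(5) by (rule bij_betw_trans[rotated])
  qed
  have "(uncan \<circ> h) (PI +>\<^bsub>FA S\<^esub> genA a) = tensor \<one>\<^bsub>QW\<^esub> a" if "a \<in> S" for a
    unfolding comp_apply hA[OF that] QW_one
    by (rule uncan_eq) (simp_all add: tensor_carrier D_one that tensor_can_tensor E_mult Q_S)
  moreover have "(uncan \<circ> h) (PI +>\<^bsub>FA S\<^esub> genX i) = tensor (Xel i) 1" if "i \<in> I" for i
    unfolding comp_apply hX[OF that]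
    by (rule uncan_eq) (simp_all add: tensor_carrier D_X that tensor_can_tensor E_mult)
  ultimately show ?thesis
    unfolding complete_relations_def S_tilde_eq using iso by blast
qed

end

theorem theorem6p14:
  fixes F :: "'r::idom fps fps"
    and Phi :: "'l::ab_group_add set"
    and cr :: "'l \<Rightarrow> 'l \<Rightarrow> int"
    and I :: "'i set"
    and al :: "'i \<Rightarrow> 'l"
    and \<iota> :: "('l, 'r) fga \<Rightarrow> 'k::field"
  assumes fgl: "formal_group_law F"
    and lattice: "\<exists>B :: 'l set. finite B \<and> z_basis B"
    and roots: "reduced_root_datum Phi cr"
    and simple: "simple_roots Phi I al"
    and frac: "fraction_field (FGA F) \<iota>"
    and x_nonzero: "\<And>l :: 'l. l \<noteq> 0 \<Longrightarrow> fga_var F l \<noteq> \<zero>\<^bsub>FGA F\<^esub>"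
  shows
    "(demazure.R_subalgebra F \<iota> Phi cr (demazure.D F \<iota> Phi cr I al) \<and>
      demazure.coef ` demazure.S F \<iota> \<union> demazure.Xel F \<iota> Phi cr al ` I \<subseteq> demazure.D F \<iota> Phi cr I al \<and>
      (\<forall>B. demazure.R_subalgebra F \<iota> Phi cr B \<and>
           demazure.coef ` demazure.S F \<iota> \<union> demazure.Xel F \<iota> Phi cr al ` I \<subseteq> B \<longrightarrow>
           demazure.D F \<iota> Phi cr I al \<subseteq> B)) \<and>
     (\<forall>i\<in>I. demazure.kappa1 F \<iota> al i \<in> demazure.S F \<iota>) \<and>
     (\<forall>(lhs, rhs) \<in> demazure.relations F \<iota> cr I al (demazure.QW F \<iota> Phi cr) demazure.coef
          (demazure.Xel F \<iota> Phi cr al) (demazure.S F \<iota>). lhs = rhs) \<and>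
     ((\<forall>i\<in>I. \<forall>j\<in>I. demazure.cox cr al i j \<noteq> 6) \<longrightarrow>
        demazure.complete_relations F \<iota> cr I al (demazure.S F \<iota>)
          (demazure.D_ring F \<iota> Phi cr I al) demazure.coef (demazure.Xel F \<iota> Phi cr al)) \<and>
     (inj_on (demazure.tensor_can F \<iota> Phi cr) (carrier (demazure.D_tensor F \<iota> Phi cr I al)) \<and>
      demazure.tensor_can F \<iota> Phi cr \<in> ring_hom (demazure.D_tensor F \<iota> Phi cr I al) (demazure.QW F \<iota> Phi cr) \<and>
      demazure.complete_relations F \<iota> cr I al (demazure.S_tilde F \<iota> Phi cr I al)
        (demazure.D_tensor F \<iota> Phi cr I al)
        (\<lambda>a. demazure.tensor F \<iota> Phi cr I al (\<one>\<^bsub>demazure.QW F \<iota> Phi cr\<^esub>) a)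
        (\<lambda>i. demazure.tensor F \<iota> Phi cr I al (demazure.Xel F \<iota> Phi cr al i) 1))"
proof -
  interpret formal_demazure F \<iota> Phi cr I al
    by unfold_locales (rule fgl frac x_nonzero lattice roots simple, assumption?)+
  have "relations QW coef Xel S \<subseteq> relations QW coef Xel Q"
    unfolding relations_def rel1_def using Q_S by blast
  then have "\<forall>(lhs, rhs) \<in> relations QW coef Xel S. lhs = rhs"
    by (rule ballI[OF bspec[OF relations_hold subsetD]])
  moreover have "inj_on tensor_can (carrier D_tensor)"
    unfolding D_tensor_simps by (rule tensor_can_inj)
  moreover have "R_subalgebra D" "coef ` S \<union> Xel ` I \<subseteq> D"
    by (rule D_props)+
  moreover have "\<forall>B. R_subalgebra B \<and> coef ` S \<union> Xel ` I \<subseteq> B \<longrightarrow> D \<subseteq> B"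
    using D_props(3) by simp
  moreover have "\<forall>i\<in>I. kappa1 i \<in> S" using kappa1_S by blast
  ultimately show ?thesis
    using complete_D tensor_can_hom complete_tensor by (intro conjI impI) assumption+
qed

end
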